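(* Let $R$ be a commutative ring, let $n,r$ be positive integers and let $E_R$ be a free $R$-module with basis $e_{1,R},\ldots,e_{n,R}$, regarded as an $R\mathrm{Sym}(n)$-module with $\mathrm{Sym}(n)$ permuting the basis in the natural way. Let $\mathrm{Sym}(n)$ act on the $r$-fold tensor product $E_R^{\otimes r}$ over $R$ by the induced (diagonal) action, so that $E_R^{\otimes r}$ is identified with the permutation module $RI(n,r)$. Then the endomorphism algebra $\mathrm{End}_{\mathrm{Sym}(n)}(E_R^{\otimes r})=\mathrm{End}_{\mathrm{Sym}(n)}(RI(n,r))$ is a cellular $R$-algebra.
   Context: $I(n,r)$ is the set of maps $i:\{1,\ldots,r\}\to\{1,\ldots,n\}$, with $\mathrm{Sym}(n)$ acting by $w\cdot i=w\circ i$; $E_R^{\otimes r}$ has $R$-basis $e_{i,R}=e_{i(1),R}\otimes\cdots\otimes e_{i(r),R}$, $i\in I(n,r)$, and $w\cdot e_{i,R}=e_{w\circ i,R}$. An algebra $A$ over a commutative ring $R$ is cellular if it admits a cell datum $(\Lambda^+,N,C,{}^* )$, consisting of: (C1) a partially ordered set $\Lambda^+$, for each $\lambda\in\Lambda^+$ a finite set $N(\lambda)$, and an injective map $C:\coprod_{\lambda\in\Lambda^+}N(\lambda)\times N(\lambda)\to A$ whose image is an $R$-basis of $A$; (C2) writing $C(t,u)=C^\lambda_{t,u}\in A$ for $t,u\in N(\lambda)$, an $R$-linear anti-involution ${}^*$ of $A$ with $(C^\lambda_{t,u})^*=C^\lambda_{u,t}$; (C3) for $\lambda\in\Lambda^+$,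 $t,u\in N(\lambda)$ and $a\in A$, $aC^\lambda_{t,u}\equiv\sum_{t'\in N(\lambda)}r_a(t',t)C^\lambda_{t',u}\pmod{A(>\lambda)}$, where $r_a(t',t)\in R$ is independent of $u$ and $A(>\lambda)$ is the $R$-submodule of $A$ generated by the $C^\mu_{t'',u''}$ with $\mu\in\Lambda^+$, $\mu>\lambda$ and $t'',u''\in N(\mu)$. *)

theory Defs
  imports
    "HOL-Algebra.AbelCoset"
    "HOL-Algebra.Sym_Groups"
    "HOL-Algebra.Group_Action"
    "Jordan_Normal_Form.Missing_VectorSpace"
begin

section \<open>Cellular algebras\<close>

text \<open>The locale \<^locale>\<open>algebra\<close> of the library is restricted to commutative algebras.\<close>

locale assoc_algebra = module R A + ring A for R and A (structure) +
  assumes smult_mult_left: "\<lbrakk>c \<in> carrier R; x \<in> carrier A; y \<in> carrier A\<rbrakk>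
      \<Longrightarrow> (c \<odot> x) \<otimes> y = c \<odot> (x \<otimes> y)"
    and smult_mult_right: "\<lbrakk>c \<in> carrier R; x \<in> carrier A; y \<in> carrier A\<rbrakk>
      \<Longrightarrow> x \<otimes> (c \<odot> y) = c \<odot> (x \<otimes> y)"

definition is_basis :: "('a, 'm) ring_scheme \<Rightarrow> ('a, 'b, 'k) module_scheme \<Rightarrow> 'b set \<Rightarrow> bool" where
  "is_basis R M B \<longleftrightarrow>
     B \<subseteq> carrier M \<and> \<not> module.lin_dep R M B \<and> module.span R M B = carrier M"

text \<open>The order on \<open>\<Lambda>\<close> is given by its graph \<open>leq\<close>, with \<open>(l, m) \<in> leq\<close> meaning \<open>l \<le> m\<close>, so
  \<open>aboveS leq l\<close> consists of the \<open>m > l\<close>. \<open>N l\<close> and \<open>C l t u\<close> are relevant only for \<open>l \<in> \<Lambda>\<close>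
  and \<open>t, u \<in> N l\<close>.\<close>

definition cell_datum ::
  "('a, 'm) ring_scheme \<Rightarrow> ('a, 'c, 'k) module_scheme \<Rightarrow>
   'l set \<Rightarrow> ('l \<times> 'l) set \<Rightarrow> ('l \<Rightarrow> 't set) \<Rightarrow> ('l \<Rightarrow> 't \<Rightarrow> 't \<Rightarrow> 'c) \<Rightarrow> ('c \<Rightarrow> 'c) \<Rightarrow> bool"
where
  "cell_datum R A \<Lambda> leq N C star \<longleftrightarrow>
     \<comment> \<open>(C1)\<close>
     partial_order_on \<Lambda> leq \<and> (\<forall>l\<in>\<Lambda>. finite (N l)) \<and>
     inj_on (\<lambda>(l, t, u). C l t u) (SIGMA l:\<Lambda>. N l \<times> N l) \<and>
     is_basis R A ((\<lambda>(l, t, u). C l t u) ` (SIGMA l:\<Lambda>. N l \<times> N l)) \<and>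
     \<comment> \<open>(C2)\<close>
     star \<in> module_hom R A A \<and>
     (\<forall>x\<in>carrier A. star (star x) = x) \<and>
     (\<forall>x\<in>carrier A. \<forall>y\<in>carrier A. star (x \<otimes>\<^bsub>A\<^esub> y) = star y \<otimes>\<^bsub>A\<^esub> star x) \<and>
     (\<forall>l\<in>\<Lambda>. \<forall>t\<in>N l. \<forall>u\<in>N l. star (C l t u) = C l u t) \<and>
     \<comment> \<open>(C3)\<close>
     (\<forall>l\<in>\<Lambda>. \<forall>a\<in>carrier A. \<exists>\<rho>. (\<forall>t'\<in>N l. \<forall>t\<in>N l. \<rho> t' t \<in> carrier R) \<and>
        (\<forall>t\<in>N l. \<forall>u\<in>N l.
           a \<otimes>\<^bsub>A\<^esub> C l t u \<ominus>\<^bsub>A\<^esub> (\<Oplus>\<^bsub>A\<^esub>t'\<in>N l. \<rho> t' t \<odot>\<^bsub>A\<^esub> C l t' u)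
             \<in> module.span R A {C m t'' u'' | m t'' u''. m \<in> aboveS leq l \<and> t'' \<in> N m \<and> u'' \<in> N m}))"

text \<open>Taking \<open>\<Lambda>\<close> and the \<open>N l\<close> inside the type of elements of \<open>A\<close> is no restriction: see
  \<open>cell_datum_imp_cellular\<close> below.\<close>

definition cellular :: "('a, 'm) ring_scheme \<Rightarrow> ('a, 'c, 'k) module_scheme \<Rightarrow> bool" where
  "cellular R A \<longleftrightarrow> assoc_algebra R A \<and>
     (\<exists>(\<Lambda> :: 'c set) leq (N :: 'c \<Rightarrow> 'c set) C star. cell_datum R A \<Lambda> leq N C star)"

lemma cell_datum_transport:
  fixes C :: "'l \<Rightarrow> 't \<Rightarrow> 't \<Rightarrow> 'c"
  assumes am: "module R A"
    and cd: "cell_datum R A \<Lambda> leq N C star"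
    and d: "inj_on d \<Lambda>'" and \<Lambda>': "\<Lambda>' = {l \<in> \<Lambda>. N l \<noteq> {}}"
    and f: "\<And>l. l \<in> \<Lambda>' \<Longrightarrow> inj_on (f l) (N l)"
    and L: "L = d ` \<Lambda>'"
    and leq': "leq' = {(d l, d m) | l m. l \<in> \<Lambda>' \<and> m \<in> \<Lambda>' \<and> (l, m) \<in> leq}"
    and N: "\<And>l. l \<in> \<Lambda>' \<Longrightarrow> N' (d l) = f l ` N l"
    and C: "\<And>l t u. \<lbrakk>l \<in> \<Lambda>'; t \<in> N l; u \<in> N l\<rbrakk> \<Longrightarrow> C' (d l) (f l t) (f l u) = C l t u"
  shows "cell_datum R A L leq' N' C' star"
proof -
  note cd' = cd[unfolded cell_datum_def]
  have po: "partial_order_on \<Lambda> leq" and fin: "\<And>l. l \<in> \<Lambda> \<Longrightarrow> finite (N l)"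
    and inj: "inj_on (\<lambda>(l, t, u). C l t u) (SIGMA l:\<Lambda>. N l \<times> N l)"
    and bas: "is_basis R A ((\<lambda>(l, t, u). C l t u) ` (SIGMA l:\<Lambda>. N l \<times> N l))"
    and star: "\<And>l t u. \<lbrakk>l \<in> \<Lambda>; t \<in> N l; u \<in> N l\<rbrakk> \<Longrightarrow> star (C l t u) = C l u t"
    using cd' by blast+
  note c3_old = cd'[THEN conjunct2, THEN conjunct2, THEN conjunct2, THEN conjunct2,
    THEN conjunct2, THEN conjunct2, THEN conjunct2, THEN conjunct2]
  have sub: "\<Lambda>' \<subseteq> \<Lambda>" using \<Lambda>' by auto
  have leq: "(d l, d m) \<in> leq' \<longleftrightarrow> (l, m) \<in> leq" if "l \<in> \<Lambda>'" "m \<in> \<Lambda>'" for l m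
    unfolding leq' using that d by (auto simp: inj_on_def)
  have po': "partial_order_on L leq'"
    unfolding partial_order_on_def preorder_on_def
  proof (intro conjI)
    show "leq' \<subseteq> L \<times> L" unfolding leq' L by auto
    show "refl_on L leq'"
      using po sub unfolding leq' L partial_order_on_def preorder_on_def refl_on_def by auto blast
    show "trans leq'"
    proof (rule transI)
      fix x y z assume "(x, y) \<in> leq'" "(y, z) \<in> leq'"
      then obtain l m m' k where 1: "x = d l" "y = d m" "l \<in> \<Lambda>'" "m \<in> \<Lambda>'" "(l, m) \<in> leq"
        and 2: "y = d m'" "z = d k" "m' \<in> \<Lambda>'" "k \<in> \<Lambda>'" "(m', k) \<in> leq" unfolding leq' by blast
      have "m' = m" using inj_onD[OF d, of m' m] 1 2 by simp
      then have "(l, k) \<in> leq"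
        using po 1 2 unfolding partial_order_on_def preorder_on_def by (blast dest: transD)
      then show "(x, z) \<in> leq'" unfolding leq' using 1 2 by blast
    qed
    show "antisym leq'"
    proof (rule antisymI)
      fix x y assume "(x, y) \<in> leq'" "(y, x) \<in> leq'"
      then obtain l m m' k where 1: "x = d l" "y = d m" "l \<in> \<Lambda>'" "m \<in> \<Lambda>'" "(l, m) \<in> leq"
        and 2: "y = d m'" "x = d k" "m' \<in> \<Lambda>'" "k \<in> \<Lambda>'" "(m', k) \<in> leq" unfolding leq' by blast
      have "m' = m" "k = l" using inj_onD[OF d, of m' m] inj_onD[OF d, of k l] 1 2 by simp_all
      then have "l = m"
        using po 1 2 unfolding partial_order_on_def by (blast dest: antisymD)
      then show "x = y" using 1 by simp
    qed
  qed
  have mem: "\<exists>l t u. x = (d l, f l t, f l u) \<and> l \<in> \<Lambda>' \<and> t \<in> N l \<and> u \<in> N l"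
    if x: "x \<in> (SIGMA l:L. N' l \<times> N' l)" for x
  proof -
    from x obtain y p q where y: "x = (y, p, q)" "y \<in> L" "p \<in> N' y" "q \<in> N' y" by auto
    then obtain l where l: "y = d l" "l \<in> \<Lambda>'" unfolding L by auto
    with y N[OF l(2)] obtain t u where "p = f l t" "q = f l u" "t \<in> N l" "u \<in> N l" by auto
    then show ?thesis using y l by blast
  qed
  have inj': "inj_on (\<lambda>(l, t, u). C' l t u) (SIGMA l:L. N' l \<times> N' l)"
  proof (rule inj_onI)
    fix x y assume "x \<in> (SIGMA l:L. N' l \<times> N' l)" "y \<in> (SIGMA l:L. N' l \<times> N' l)"
      and eq: "(\<lambda>(l, t, u). C' l t u) x = (\<lambda>(l, t, u). C' l t u) y"
    with mem[of x] mem[of y] obtain l t u m p q where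
      x: "x = (d l, f l t, f l u)" "l \<in> \<Lambda>'" "t \<in> N l" "u \<in> N l" and
      y: "y = (d m, f m p, f m q)" "m \<in> \<Lambda>'" "p \<in> N m" "q \<in> N m" by blast
    have "C l t u = C m p q" using eq C x y by simp
    then have "(l, t, u) = (m, p, q)"
      using inj_onD[OF inj, of "(l, t, u)" "(m, p, q)"] x y sub by auto
    then show "x = y" using x y by simp
  qed
  have img: "(\<lambda>(l, t, u). C' l t u) ` (SIGMA l:L. N' l \<times> N' l)
      = (\<lambda>(l, t, u). C l t u) ` (SIGMA l:\<Lambda>. N l \<times> N l)" (is "?X = ?Y")
  proof
    show "?X \<subseteq> ?Y"
    proof
      fix z assume "z \<in> ?X"
      then obtain x where x: "x \<in> (SIGMA l:L. N' l \<times> N' l)"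
        and z: "z = (\<lambda>(l, t, u). C' l t u) x" by blast
      from mem[OF x] z obtain l t u where "l \<in> \<Lambda>'" "t \<in> N l" "u \<in> N l" "z = C' (d l) (f l t) (f l u)"
        by auto
      then have "z = C l t u" "l \<in> \<Lambda>" "t \<in> N l" "u \<in> N l" using C sub by auto
      then show "z \<in> ?Y" by force
    qed
    show "?Y \<subseteq> ?X"
    proof
      fix z assume "z \<in> ?Y"
      then obtain l t u where "l \<in> \<Lambda>" "t \<in> N l" "u \<in> N l" and z: "z = C l t u" by auto
      then have l: "l \<in> \<Lambda>'" "t \<in> N l" "u \<in> N l" using \<Lambda>' by auto
      then have "(d l, f l t, f l u) \<in> (SIGMA l:L. N' l \<times> N' l)" using N L by auto
      moreover have "z = (\<lambda>(l, t, u). C' l t u) (d l, f l t, f l u)" using C[OF l] z by simp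
      ultimately show "z \<in> ?X" by (rule rev_image_eqI)
    qed
  qed
  have above: "{C' m t'' u'' | m t'' u''. m \<in> aboveS leq' (d l) \<and> t'' \<in> N' m \<and> u'' \<in> N' m}
      = {C m t'' u'' | m t'' u''. m \<in> aboveS leq l \<and> t'' \<in> N m \<and> u'' \<in> N m}" (is "?X = ?Y")
    if l: "l \<in> \<Lambda>'" for l
  proof
    show "?X \<subseteq> ?Y"
    proof
      fix z assume "z \<in> ?X"
      then obtain x p q where z: "z = C' x p q" and x: "x \<in> aboveS leq' (d l)"
        and pq: "p \<in> N' x" "q \<in> N' x" by blast
      from x obtain m where m: "x = d m" "m \<in> \<Lambda>'" "m \<noteq> l" "(d l, d m) \<in> leq'"
        unfolding aboveS_def leq' by auto
      from pq N[OF m(2)] m(1) obtain t u where "p = f m t" "q = f m u" "t \<in> N m" "u \<in> N m" by auto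
      moreover have "m \<in> aboveS leq l" using leq[OF l m(2)] m unfolding aboveS_def by simp
      ultimately show "z \<in> ?Y" using z C[OF m(2)] m(1) by blast
    qed
    show "?Y \<subseteq> ?X"
    proof
      fix z assume "z \<in> ?Y"
      then obtain m t u where z: "z = C m t u" and m: "m \<noteq> l" "(l, m) \<in> leq"
        and tu: "t \<in> N m" "u \<in> N m" unfolding aboveS_def by auto
      have "m \<in> \<Lambda>" using m po unfolding partial_order_on_def preorder_on_def by auto
      then have m': "m \<in> \<Lambda>'" using tu \<Lambda>' by auto
      have "d m \<noteq> d l" using m m' l d by (auto dest: inj_onD)
      then have "d m \<in> aboveS leq' (d l)" using leq[OF l m'] m unfolding aboveS_def by blast
      moreover have "f m t \<in> N' (d m)" "f m u \<in> N' (d m)" using N[OF m'] tu by auto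
      moreover have "z = C' (d m) (f m t) (f m u)" using C[OF m' tu] z by simp
      ultimately show "z \<in> ?X" by blast
    qed
  qed
  have c3: "\<exists>\<rho>. (\<forall>t'\<in>N' x. \<forall>t\<in>N' x. \<rho> t' t \<in> carrier R) \<and>
        (\<forall>t\<in>N' x. \<forall>u\<in>N' x.
           a \<otimes>\<^bsub>A\<^esub> C' x t u \<ominus>\<^bsub>A\<^esub> (\<Oplus>\<^bsub>A\<^esub>t'\<in>N' x. \<rho> t' t \<odot>\<^bsub>A\<^esub> C' x t' u)
             \<in> module.span R A {C' m t'' u'' | m t'' u''. m \<in> aboveS leq' x \<and> t'' \<in> N' m \<and> u'' \<in> N' m})"
    if x: "x \<in> L" and a: "a \<in> carrier A" for x a
  proof -
    from x obtain l where l: "l \<in> \<Lambda>'" and xl: "x = d l" unfolding L by auto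
    from l sub have "l \<in> \<Lambda>" by auto
    from bspec[OF bspec[OF c3_old this] a] obtain \<rho>
      where \<rho>: "\<forall>t'\<in>N l. \<forall>t\<in>N l. \<rho> t' t \<in> carrier R"
      and s': "\<forall>t\<in>N l. \<forall>u\<in>N l.
           a \<otimes>\<^bsub>A\<^esub> C l t u \<ominus>\<^bsub>A\<^esub> (\<Oplus>\<^bsub>A\<^esub>t'\<in>N l. \<rho> t' t \<odot>\<^bsub>A\<^esub> C l t' u)
             \<in> module.span R A {C m t'' u'' | m t'' u''. m \<in> aboveS leq l \<and> t'' \<in> N m \<and> u'' \<in> N m}"
      by (elim exE conjE)
    note s = bspec[OF bspec[OF s']]
    let ?g = "inv_into (N l) (f l)"
    have g: "?g (f l t) = t" if "t \<in> N l" for t using f[OF l] that by simp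
    have sum: "(\<Oplus>\<^bsub>A\<^esub>p\<in>f l ` N l. \<rho> (?g p) t \<odot>\<^bsub>A\<^esub> C' (d l) p (f l u))
        = (\<Oplus>\<^bsub>A\<^esub>t'\<in>N l. \<rho> t' t \<odot>\<^bsub>A\<^esub> C l t' u)"
      if tu: "t \<in> N l" "u \<in> N l" for t u
    proof -
      interpret module R A by (rule am)
      have cl: "C l t' u \<in> carrier A" if "t' \<in> N l" for t'
        using bas that tu l sub unfolding is_basis_def by force
      have "(\<Oplus>\<^bsub>A\<^esub>p\<in>f l ` N l. \<rho> (?g p) t \<odot>\<^bsub>A\<^esub> C' (d l) p (f l u))
          = (\<Oplus>\<^bsub>A\<^esub>t'\<in>N l. \<rho> (?g (f l t')) t \<odot>\<^bsub>A\<^esub> C' (d l) (f l t') (f l u))"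
        by (rule finsum_reindex) (use \<rho> cl g tu f[OF l] C[OF l] in auto)
      also have "\<dots> = (\<Oplus>\<^bsub>A\<^esub>t'\<in>N l. \<rho> t' t \<odot>\<^bsub>A\<^esub> C l t' u)"
        by (rule finsum_cong') (use \<rho> cl g tu C[OF l] in auto)
      finally show ?thesis .
    qed
    show ?thesis
      unfolding xl above[OF l] N[OF l]
    proof (intro exI[of _ "\<lambda>p q. \<rho> (?g p) (?g q)"] conjI ballI)
      fix p q assume "p \<in> f l ` N l" "q \<in> f l ` N l"
      then show "\<rho> (?g p) (?g q) \<in> carrier R" using \<rho> g by auto
    next
      fix p q assume "p \<in> f l ` N l" "q \<in> f l ` N l"
      then obtain t u where p: "p = f l t" "q = f l u" and tu: "t \<in> N l" "u \<in> N l" by auto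
      show "a \<otimes>\<^bsub>A\<^esub> C' (d l) p q
          \<ominus>\<^bsub>A\<^esub> (\<Oplus>\<^bsub>A\<^esub>t'\<in>f l ` N l. \<rho> (?g t') (?g p) \<odot>\<^bsub>A\<^esub> C' (d l) t' q)
        \<in> module.span R A {C m t'' u'' | m t'' u''. m \<in> aboveS leq l \<and> t'' \<in> N m \<and> u'' \<in> N m}"
        unfolding p g[OF tu(1)] sum[OF tu] C[OF l tu] by (rule s[OF tu])
    qed
  qed
  have star': "star (C' x p q) = C' x q p" if "x \<in> L" "p \<in> N' x" "q \<in> N' x" for x p q
  proof -
    from that obtain l where l: "l \<in> \<Lambda>'" and x: "x = d l" unfolding L by auto
    from that N[OF l] x obtain t u where "p = f l t" "q = f l u" "t \<in> N l" "u \<in> N l" by auto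
    then show ?thesis using C[OF l] star l sub x by auto
  qed
  have fin': "finite (N' x)" if "x \<in> L" for x
  proof -
    from that obtain l where l: "l \<in> \<Lambda>'" and x: "x = d l" unfolding L by auto
    then show ?thesis unfolding x N[OF l] using fin sub by auto
  qed
  have star0: "star \<in> module_hom R A A" "\<forall>x\<in>carrier A. star (star x) = x"
    "\<forall>x\<in>carrier A. \<forall>y\<in>carrier A. star (x \<otimes>\<^bsub>A\<^esub> y) = star y \<otimes>\<^bsub>A\<^esub> star x"
    using cd' by blast+
  show ?thesis
    unfolding cell_datum_def
    by (intro conjI star0 po' inj' bas[folded img]) (rule ballI fin' star' c3 | assumption)+
qed

lemma cell_datum_imp_cellular:
  fixes C :: "'l \<Rightarrow> 't \<Rightarrow> 't \<Rightarrow> 'c"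
  assumes alg: "assoc_algebra R A" and cd: "cell_datum R A \<Lambda> leq N C star"
  shows "cellular R A"
proof -
  define \<Lambda>' where "\<Lambda>' = {l \<in> \<Lambda>. N l \<noteq> {}}"
  define t0 where "t0 l = (SOME t. t \<in> N l)" for l
  define d where "d l = C l (t0 l) (t0 l)" for l
  have inj: "inj_on (\<lambda>(l, t, u). C l t u) (SIGMA l:\<Lambda>. N l \<times> N l)"
    using cd unfolding cell_datum_def by blast
  have t0: "t0 l \<in> N l" if "l \<in> \<Lambda>'" for l
    using that unfolding \<Lambda>'_def t0_def by (auto intro: someI)
  have "inj_on d \<Lambda>'"
  proof (rule inj_onI)
    fix l m assume "l \<in> \<Lambda>'" "m \<in> \<Lambda>'" "d l = d m"
    then show "l = m"
      using inj_onD[OF inj, of "(l, t0 l, t0 l)" "(m, t0 m, t0 m)"] t0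
      unfolding d_def \<Lambda>'_def by auto
  qed
  moreover have "inj_on (\<lambda>t. C l t t) (N l)" if "l \<in> \<Lambda>'" for l
  proof (rule inj_onI)
    fix t u assume "t \<in> N l" "u \<in> N l" "C l t t = C l u u"
    then show "t = u"
      using inj_onD[OF inj, of "(l, t, t)" "(l, u, u)"] that unfolding \<Lambda>'_def by auto
  qed
  moreover have d: "inv_into \<Lambda>' d (d l) = l" if "l \<in> \<Lambda>'" for l
    using that calculation(1) by simp
  moreover have f: "inv_into (N l) (\<lambda>t. C l t t) (C l t t) = t" if "l \<in> \<Lambda>'" "t \<in> N l" for l t
    using that calculation(2) by (simp add: inv_into_f_f[where f = "\<lambda>t. C l t t"])
  moreover have "module R A" using alg by (simp add: assoc_algebra_def)
  ultimately have "cell_datum R A (d ` \<Lambda>') {(d l, d m) | l m. l \<in> \<Lambda>' \<and> m \<in> \<Lambda>' \<and> (l, m) \<in> leq}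
      (\<lambda>x. (\<lambda>t. C (inv_into \<Lambda>' d x) t t) ` N (inv_into \<Lambda>' d x))
      (\<lambda>x p q. let l = inv_into \<Lambda>' d x; g = inv_into (N l) (\<lambda>t. C l t t) in C l (g p) (g q)) star"
    by (intro cell_datum_transport[OF _ cd, of d \<Lambda>' "\<lambda>l t. C l t t"])
       (simp_all add: d f Let_def \<Lambda>'_def[symmetric])
  with alg show ?thesis unfolding cellular_def by blast
qed

section \<open>Modules with a group action\<close>

text \<open>\<open>M\<close> is a module over the group ring \<open>R G\<close>.\<close>

definition group_module ::
  "('g, 'h) monoid_scheme \<Rightarrow> ('a, 'm) ring_scheme \<Rightarrow> ('a, 'b, 'k) module_scheme \<Rightarrow> ('g \<Rightarrow> 'b \<Rightarrow> 'b) \<Rightarrow> bool"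
where
  "group_module G R M \<phi> \<longleftrightarrow>
     module R M \<and> group_action G (carrier M) \<phi> \<and> (\<forall>g\<in>carrier G. \<phi> g \<in> module_hom R M M)"

definition endo_algebra ::
  "('g, 'h) monoid_scheme \<Rightarrow> ('a, 'm) ring_scheme \<Rightarrow> ('a, 'b, 'k) module_scheme \<Rightarrow> ('g \<Rightarrow> 'b \<Rightarrow> 'b) \<Rightarrow>
   ('a, 'b \<Rightarrow> 'b) module"
where
  "endo_algebra G R M \<phi> =
     \<lparr>carrier = {f \<in> module_hom R M M \<inter> extensional (carrier M).
                   \<forall>g\<in>carrier G. \<forall>x\<in>carrier M. f (\<phi> g x) = \<phi> g (f x)},
      monoid.mult = (\<lambda>f h. compose (carrier M) f h),
      one = (\<lambda>x\<in>carrier M. x),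
      ring.zero = (\<lambda>x\<in>carrier M. \<zero>\<^bsub>M\<^esub>),
      add = (\<lambda>f h. \<lambda>x\<in>carrier M. f x \<oplus>\<^bsub>M\<^esub> h x),
      smult = (\<lambda>c f. \<lambda>x\<in>carrier M. c \<odot>\<^bsub>M\<^esub> f x)\<rparr>"

section \<open>Free modules, quotients and tensor powers\<close>

text \<open>A family rather than a set, because over the zero ring \<open>e\<^sub>1, \<dots>, e\<^sub>n\<close> is a basis of the zero
  module for every \<open>n\<close>, although the \<open>e\<^sub>i\<close> coincide.\<close>

definition basis_family ::
  "('a, 'm) ring_scheme \<Rightarrow> ('a, 'b, 'k) module_scheme \<Rightarrow> 'i set \<Rightarrow> ('i \<Rightarrow> 'b) \<Rightarrow> bool" where
  "basis_family R M I e \<longleftrightarrow> finite I \<and> e \<in> I \<rightarrow> carrier M \<and>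
     (\<forall>x\<in>carrier M. \<exists>!c. c \<in> I \<rightarrow>\<^sub>E carrier R \<and> x = (\<Oplus>\<^bsub>M\<^esub>i\<in>I. c i \<odot>\<^bsub>M\<^esub> e i))"

text \<open>The free module \<open>R X\<close>, consisting of the functions of finite support; \<open>free_gen R X x\<close> is the basis
  element belonging to \<open>x\<close>. (Its \<open>mult\<close> and \<open>one\<close> fields, like those of the modules constructed
  below, are irrelevant.)\<close>

definition free_module :: "('a, 'm) ring_scheme \<Rightarrow> 'x set \<Rightarrow> ('a, 'x \<Rightarrow> 'a) module" where
  "free_module R X =
     \<lparr>carrier = {f \<in> X \<rightarrow>\<^sub>E carrier R. finite {x \<in> X. f x \<noteq> \<zero>\<^bsub>R\<^esub>}},
      monoid.mult = undefined, one = undefined,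
      ring.zero = (\<lambda>x\<in>X. \<zero>\<^bsub>R\<^esub>),
      add = (\<lambda>f g. \<lambda>x\<in>X. f x \<oplus>\<^bsub>R\<^esub> g x),
      smult = (\<lambda>c f. \<lambda>x\<in>X. c \<otimes>\<^bsub>R\<^esub> f x)\<rparr>"

definition free_gen :: "('a, 'm) ring_scheme \<Rightarrow> 'x set \<Rightarrow> 'x \<Rightarrow> ('x \<Rightarrow> 'a)" where
  "free_gen R X x = (\<lambda>y\<in>X. if y = x then \<one>\<^bsub>R\<^esub> else \<zero>\<^bsub>R\<^esub>)"

definition quotient_module ::
  "('a, 'b, 'k) module_scheme \<Rightarrow> 'b set \<Rightarrow> ('a, 'b set) module" where
  "quotient_module M H =
     \<lparr>carrier = a_rcosets\<^bsub>M\<^esub> H, monoid.mult = undefined, one = undefined,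
      ring.zero = H, add = (\<lambda>S T. S <+>\<^bsub>M\<^esub> T),
      smult = (\<lambda>c S. \<Union>x\<in>S. H +>\<^bsub>M\<^esub> (c \<odot>\<^bsub>M\<^esub> x))\<rparr>"

abbreviation tuples :: "nat \<Rightarrow> 'b set \<Rightarrow> (nat \<Rightarrow> 'b) set" where
  "tuples r X \<equiv> {1..r} \<rightarrow>\<^sub>E X"

text \<open>The \<open>r\<close>-fold tensor power is the free module on \<open>r\<close>-tuples modulo multilinearity.\<close>

definition tensor_relations ::
  "('a, 'm) ring_scheme \<Rightarrow> ('a, 'b, 'k) module_scheme \<Rightarrow> nat \<Rightarrow> ((nat \<Rightarrow> 'b) \<Rightarrow> 'a) set" where
  "tensor_relations R E r =
     (let X = tuples r (carrier E); F = free_module R X in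
       {free_gen R X (x(k := a \<oplus>\<^bsub>E\<^esub> b)) \<ominus>\<^bsub>F\<^esub> (free_gen R X (x(k := a)) \<oplus>\<^bsub>F\<^esub> free_gen R X (x(k := b))) | x k a b.
          x \<in> X \<and> k \<in> {1..r} \<and> a \<in> carrier E \<and> b \<in> carrier E} \<union>
       {free_gen R X (x(k := c \<odot>\<^bsub>E\<^esub> a)) \<ominus>\<^bsub>F\<^esub> c \<odot>\<^bsub>F\<^esub> free_gen R X (x(k := a)) | x k c a.
          x \<in> X \<and> k \<in> {1..r} \<and> c \<in> carrier R \<and> a \<in> carrier E})"

definition tensor_kernel ::
  "('a, 'm) ring_scheme \<Rightarrow> ('a, 'b, 'k) module_scheme \<Rightarrow> nat \<Rightarrow> ((nat \<Rightarrow> 'b) \<Rightarrow> 'a) set" where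
  "tensor_kernel R E r =
     module.span R (free_module R (tuples r (carrier E))) (tensor_relations R E r)"

definition tensor_power ::
  "('a, 'm) ring_scheme \<Rightarrow> ('a, 'b, 'k) module_scheme \<Rightarrow> nat \<Rightarrow> ('a, ((nat \<Rightarrow> 'b) \<Rightarrow> 'a) set) module" where
  "tensor_power R E r =
     quotient_module (free_module R (tuples r (carrier E))) (tensor_kernel R E r)"

text \<open>\<open>pure_tensor R E r x\<close> is \<open>x\<^sub>1 \<otimes> \<dots> \<otimes> x\<^sub>r\<close>.\<close>

definition pure_tensor ::
  "('a, 'm) ring_scheme \<Rightarrow> ('a, 'b, 'k) module_scheme \<Rightarrow> nat \<Rightarrow> (nat \<Rightarrow> 'b) \<Rightarrow> ((nat \<Rightarrow> 'b) \<Rightarrow> 'a) set" where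
  "pure_tensor R E r x =
     a_r_coset (free_module R (tuples r (carrier E))) (tensor_kernel R E r)
       (free_gen R (tuples r (carrier E)) x)"

text \<open>For an endomorphism \<open>g\<close> of \<open>E\<close>, the endomorphism \<open>g \<otimes> \<dots> \<otimes> g\<close> of the tensor power, i.e. the
  unique linear map taking \<open>x\<^sub>1 \<otimes> \<dots> \<otimes> x\<^sub>r\<close> to \<open>g x\<^sub>1 \<otimes> \<dots> \<otimes> g x\<^sub>r\<close>.\<close>

definition tensor_map ::
  "('a, 'm) ring_scheme \<Rightarrow> ('a, 'b, 'k) module_scheme \<Rightarrow> nat \<Rightarrow> ('b \<Rightarrow> 'b) \<Rightarrow>
   ((nat \<Rightarrow> 'b) \<Rightarrow> 'a) set \<Rightarrow> ((nat \<Rightarrow> 'b) \<Rightarrow> 'a) set" where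
  "tensor_map R E r g =
     (THE h. h \<in> module_hom R (tensor_power R E r) (tensor_power R E r)
              \<inter> extensional (carrier (tensor_power R E r)) \<and>
        (\<forall>x\<in>tuples r (carrier E).
           h (pure_tensor R E r x) = pure_tensor R E r (compose {1..r} g x)))"

section \<open>The permutation module on multi-indices\<close>

definition multi_indices :: "nat \<Rightarrow> nat \<Rightarrow> (nat \<Rightarrow> nat) set" where
  "multi_indices n r = tuples r {1..n}"

text \<open>\<open>(w \<cdot> f)(i) = f (w\<^sup>-\<^sup>1 \<circ> i)\<close>, so that \<open>w\<close> takes the basis element \<open>free_gen i\<close> to \<open>free_gen (w \<circ> i)\<close>.\<close>

definition index_action ::
  "('a, 'm) ring_scheme \<Rightarrow> nat \<Rightarrow> nat \<Rightarrow> (nat \<Rightarrow> nat) \<Rightarrow> ((nat \<Rightarrow> nat) \<Rightarrow> 'a) \<Rightarrow> ((nat \<Rightarrow> nat) \<Rightarrow> 'a)" where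
  "index_action R n r w =
     (\<lambda>f\<in>carrier (free_module R (multi_indices n r)).
        \<lambda>i\<in>multi_indices n r. f (compose {1..r} (inv\<^bsub>sym_group n\<^esub> w) i))"

end

theory Submission
  imports Defs "HOL-Library.Nat_Bijection"
begin

text \<open>
  Recording the fibres of a multi-index \<open>i \<in> I(n,r)\<close> turns it into a word of length \<open>n\<close> whose letters
  are subsets of \<open>{1..r}\<close>, and \<open>Sym(n)\<close> then acts by place permutations. So the endomorphism algebra is
  an idempotent truncation \<open>e S e\<close> of a Schur algebra of degree \<open>n\<close>, where \<open>e\<close> is a sum of weight
  idempotents. Its cellular basis consists of codeterminants: for semistandard tableaux \<open>S, T\<close> of the
  same shape, the matrix entry at the words \<open>(x, y)\<close> is the number of row fillings \<open>\<rho>\<close> of that shape for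
  which \<open>(x, \<rho>)\<close> has type \<open>S\<close> and \<open>(y, \<rho>)\<close> has type \<open>T\<close>.

  A tableau that is not semistandard is straightened by a Garnir relation that factors through a shape
  with a longer row. This gives both spanning and (C3). Linear independence follows by antisymmetrising
  over the column group, which makes the pairing with the basis unitriangular. All of this takes place
  over the integers, and structure constants are then mapped to \<open>R\<close>.
\<close>


section \<open>Words and invariant kernels\<close>

text \<open>An equivariant endomorphism has a matrix that is constant on the orbits of place
  permutations on pairs of words, and such an orbit is recorded by the multiset of pairs
  \<open>(x p, y p)\<close>. A tableau is encoded as a multiset of the same kind, with row labels as
  second components, so orbits and tableaux are one type and the order inside a row never enters.
  Only the outer words are truncated by \<open>e\<close>. They are therefore compared by a number,
  \<open>weight\<close>, that does not see the names of the rows: rows can be renamed by decreasing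
  length before the next step, the number is bounded for fixed \<open>P\<close>, and it serves as
  the cell order too. Independence rests on different statistics. The sum of the row labels of the
  shape separates the diagram at hand from the others, and the moments of the two tableaux separate
  the cells that remain.\<close>

lemma card_set_mset_le_size: "card (set_mset M) \<le> size M"
  unfolding size_multiset_overloaded_eq
  by (metis (no_types, lifting) Suc_leI card_eq_sum count_greater_zero_iff One_nat_def sum_mono)

locale position_set =
  fixes P :: "nat set"
  assumes finite_P [simp, intro]: "finite P"
begin

text \<open>The value \<open>0\<close> off \<open>P\<close> makes a word determined by its letters
  on \<open>P\<close>, so equality of words is equality of functions.\<close>

definition words :: "(nat \<Rightarrow> nat) set" where
  "words = {x. \<forall>p. p \<notin> P \<longrightarrow> x p = 0}"

definition content :: "(nat \<Rightarrow> nat) \<Rightarrow> nat multiset" where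
  "content x = image_mset x (mset_set P)"

text \<open>The complete invariant of the orbit of \<open>(x, y)\<close> under simultaneous place
  permutations. With letters in the first component and row labels in the second it is a tableau
  with unordered rows.\<close>

definition joint :: "(nat \<Rightarrow> nat) \<Rightarrow> (nat \<Rightarrow> nat) \<Rightarrow> (nat \<times> nat) multiset" where
  "joint x y = image_mset (\<lambda>p. (x p, y p)) (mset_set P)"

definition words_of :: "nat multiset \<Rightarrow> (nat \<Rightarrow> nat) set" where
  "words_of \<nu> = {x \<in> words. content x = \<nu>}"

text \<open>These are the matrices that commute with place permutations. The condition is imposed on
  all functions, so that no membership has to be carried along when kernels are multiplied.\<close>

definition invariant :: "((nat \<Rightarrow> nat) \<Rightarrow> (nat \<Rightarrow> nat) \<Rightarrow> 'v) \<Rightarrow> bool" where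
  "invariant h \<longleftrightarrow> (\<forall>\<sigma> x y. \<sigma> permutes P \<longrightarrow> h (x \<circ> \<sigma>) (y \<circ> \<sigma>) = h x y)"

lemma invariantD: "invariant h \<Longrightarrow> \<sigma> permutes P \<Longrightarrow> h (x \<circ> \<sigma>) (y \<circ> \<sigma>) = h x y"
  by (simp add: invariant_def)

lemma words_comp: "x \<in> words \<Longrightarrow> \<sigma> permutes P \<Longrightarrow> x \<circ> \<sigma> \<in> words"
  by (auto simp: words_def permutes_def)

lemma words_eqI: "x \<in> words \<Longrightarrow> y \<in> words \<Longrightarrow> (\<And>p. p \<in> P \<Longrightarrow> x p = y p) \<Longrightarrow> x = y"
  unfolding words_def fun_eq_iff by fastforce

lemma image_mset_comp_permutes:
  assumes "\<sigma> permutes P"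
  shows "image_mset (\<lambda>p. f (\<sigma> p)) (mset_set P) = image_mset f (mset_set P)"
proof -
  have "image_mset \<sigma> (mset_set P) = mset_set P"
    using assms by (simp add: image_mset_mset_set permutes_inj_on permutes_image)
  then have "image_mset f (image_mset \<sigma> (mset_set P)) = image_mset f (mset_set P)"
    by simp
  then show ?thesis by (simp add: multiset.map_comp o_def)
qed

lemma content_comp [simp]: "\<sigma> permutes P \<Longrightarrow> content (x \<circ> \<sigma>) = content x"
  using image_mset_comp_permutes[of \<sigma> x] by (simp add: content_def o_def)

lemma joint_comp [simp]: "\<sigma> permutes P \<Longrightarrow> joint (x \<circ> \<sigma>) (y \<circ> \<sigma>) = joint x y"
  using image_mset_comp_permutes[of \<sigma> "\<lambda>p. (x p, y p)"] by (simp add: joint_def o_def)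

lemma joint_snd: "image_mset snd (joint x y) = content y"
  by (simp add: joint_def content_def multiset.map_comp o_def)

lemma joint_eqE:
  assumes "joint x y = joint x' y'" "x \<in> words" "y \<in> words" "x' \<in> words" "y' \<in> words"
  obtains \<sigma> where "\<sigma> permutes P" "x = x' \<circ> \<sigma>" "y = y' \<circ> \<sigma>"
proof -
  obtain \<sigma> where \<sigma>: "\<sigma> permutes P" "\<forall>p\<in>P. (x p, y p) = (x' (\<sigma> p), y' (\<sigma> p))"
    using image_mset_eq_implies_permutes[OF finite_P assms(1)[unfolded joint_def]] by metis
  show ?thesis
    by (rule that[OF \<sigma>(1)]) (use \<sigma> assms in \<open>auto intro!: words_eqI words_comp\<close>)
qed

lemma content_eqE:
  assumes "content x = content y" "x \<in> words" "y \<in> words"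
  obtains \<sigma> where "\<sigma> permutes P" "x = y \<circ> \<sigma>"
proof -
  obtain \<sigma> where \<sigma>: "\<sigma> permutes P" "\<forall>p\<in>P. x p = y (\<sigma> p)"
    using image_mset_eq_implies_permutes[OF finite_P assms(1)[unfolded content_def]] by metis
  show ?thesis
    by (rule that[OF \<sigma>(1)]) (use \<sigma> assms in \<open>auto intro!: words_eqI words_comp\<close>)
qed

lemma invariant_joint_cong:
  assumes "invariant h" "joint x y = joint x' y'" "x \<in> words" "y \<in> words" "x' \<in> words" "y' \<in> words"
  shows "h x y = h x' y'"
  using joint_eqE[OF assms(2-)] invariantD[OF assms(1)] by metis

lemma words_of_comp: "\<sigma> permutes P \<Longrightarrow> x \<in> words_of \<nu> \<Longrightarrow> x \<circ> \<sigma> \<in> words_of \<nu>"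
  by (simp add: words_of_def words_comp)

lemma finite_words_of [simp, intro]: "finite (words_of \<nu>)"
proof (rule finite_subset)
  show "words_of \<nu> \<subseteq> {x. \<forall>p. (p \<in> P \<longrightarrow> x p \<in> set_mset \<nu>) \<and> (p \<notin> P \<longrightarrow> x p = 0)}"
    by (auto simp: words_of_def words_def content_def)
  show "finite {x. \<forall>p. (p \<in> P \<longrightarrow> x p \<in> set_mset \<nu>) \<and> (p \<notin> P \<longrightarrow> x p = (0::nat))}"
    by (rule finite_set_of_finite_funs) auto
qed

lemma sum_words_of_comp:
  assumes "\<sigma> permutes P"
  shows "(\<Sum>x\<in>words_of \<nu>. f (x \<circ> \<sigma>)) = (\<Sum>x\<in>words_of \<nu>. f x)"
proof (rule sum.reindex_bij_witness[where j = "\<lambda>x. x \<circ> \<sigma>" and i = "\<lambda>x. x \<circ> inv_into UNIV \<sigma>"])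
  note i = permutes_inv[OF assms]
  fix x assume x: "x \<in> words_of \<nu>"
  show "x \<circ> \<sigma> \<circ> inv_into UNIV \<sigma> = x" "x \<circ> inv_into UNIV \<sigma> \<circ> \<sigma> = x"
    using permutes_inv_o[OF assms] by (simp_all add: o_assoc[symmetric])
  show "x \<circ> \<sigma> \<in> words_of \<nu>" "x \<circ> inv_into UNIV \<sigma> \<in> words_of \<nu>"
    using words_of_comp x assms i by auto
qed auto

lemma size_filter_joint:
  "size (filter_mset (\<lambda>(a, i). Q a i) (joint x y)) = card {p \<in> P. Q (x p) (y p)}"
  by (simp add: joint_def filter_mset_image_mset filter_mset_mset_set case_prod_beta o_def)

lemma count_image_mset_set: "finite A \<Longrightarrow> count (image_mset f (mset_set A)) b = card {a \<in> A. f a = b}"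
proof (induction A rule: finite_induct)
  case (insert x A)
  have "{a \<in> insert x A. f a = b} = (if f x = b then insert x {a \<in> A. f a = b} else {a \<in> A. f a = b})"
    by auto
  then show ?case using insert by simp
qed simp

lemma count_joint: "count (joint x y) (a, i) = card {p \<in> P. x p = a \<and> y p = i}"
  by (simp add: joint_def count_image_mset_set)

lemma count_content: "count (content x) a = card {p \<in> P. x p = a}"
  by (simp add: content_def count_image_mset_set)

lemma size_content [simp]: "size (content x) = card P"
  by (simp add: content_def)

text \<open>The orbital basis of the centraliser algebra.\<close>

definition ind :: "(nat \<times> nat) multiset \<Rightarrow> (nat \<Rightarrow> nat) \<Rightarrow> (nat \<Rightarrow> nat) \<Rightarrow> int" where
  "ind S x y = of_bool (joint x y = S)"

text \<open>The matrix product with the weight idempotent of \<open>\<nu>\<close> inserted between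
  the factors. Keeping \<open>\<nu>\<close> in the term makes a factorisation through a given
  content visible.\<close>

definition kmult :: "nat multiset \<Rightarrow> ((nat \<Rightarrow> nat) \<Rightarrow> (nat \<Rightarrow> nat) \<Rightarrow> int) \<Rightarrow>
    ((nat \<Rightarrow> nat) \<Rightarrow> (nat \<Rightarrow> nat) \<Rightarrow> int) \<Rightarrow> (nat \<Rightarrow> nat) \<Rightarrow> (nat \<Rightarrow> nat) \<Rightarrow> int" where
  "kmult \<nu> g h x y = (\<Sum>\<rho>\<in>words_of \<nu>. g x \<rho> * h \<rho> y)"

lemma invariant_ind [simp]: "invariant (ind S)"
  by (simp add: invariant_def ind_def)

lemma invariant_kmult: "invariant g \<Longrightarrow> invariant h \<Longrightarrow> invariant (kmult \<nu> g h)"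
proof -
  assume i: "invariant g" "invariant h"
  show "invariant (kmult \<nu> g h)"
    unfolding invariant_def
  proof (intro allI impI)
    fix \<sigma> x y assume s: "\<sigma> permutes P"
    have "kmult \<nu> g h (x \<circ> \<sigma>) (y \<circ> \<sigma>) = (\<Sum>\<rho>\<in>words_of \<nu>. g (x \<circ> \<sigma>) (\<rho> \<circ> \<sigma>) * h (\<rho> \<circ> \<sigma>) (y \<circ> \<sigma>))"
      unfolding kmult_def by (rule sum_words_of_comp[OF s, symmetric])
    then show "kmult \<nu> g h (x \<circ> \<sigma>) (y \<circ> \<sigma>) = kmult \<nu> g h x y"
      using invariantD[OF i(1) s] invariantD[OF i(2) s] by (simp add: kmult_def)
  qed
qed

lemma kmult_assoc: "kmult \<nu> (kmult \<nu>' f g) h x y = kmult \<nu>' f (kmult \<nu> g h) x y"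
  unfolding kmult_def sum_distrib_left sum_distrib_right mult.assoc by (rule sum.swap)

text \<open>The base \<open>3\<close> makes one longer row outweigh two rows: \<open>3\<^sup>p\<^sup>+\<^sup>1 > 3\<^sup>p + 3\<^sup>q\<close> for \<open>q \<le> p\<close>.\<close>

definition weight :: "nat multiset \<Rightarrow> nat" where
  "weight \<nu> = (\<Sum>i\<in>set_mset \<nu>. 3 ^ count \<nu> i)"

lemma weight_superset:
  assumes "finite D" "set_mset \<nu> \<subseteq> D"
  shows "weight \<nu> = (\<Sum>i\<in>D. if count \<nu> i = 0 then 0 else 3 ^ count \<nu> i)"
  unfolding weight_def using assms
  by (intro sum.mono_neutral_cong_left) (auto simp: count_eq_zero_iff)

text \<open>Bounds the length of chains of straightening steps. The contents of actual words have
  size \<open>card P\<close>, which limits both the number of labels and each multiplicity.\<close>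

lemma weight_bound: "words_of \<nu> \<noteq> {} \<Longrightarrow> weight \<nu> \<le> card P * 3 ^ card P"
proof -
  assume "words_of \<nu> \<noteq> {}"
  then have s: "size \<nu> = card P" by (auto simp: words_of_def)
  have "weight \<nu> \<le> (\<Sum>i\<in>set_mset \<nu>. 3 ^ card P)"
    unfolding weight_def s[symmetric] by (intro sum_mono power_increasing count_le_size) simp
  also have "\<dots> = card (set_mset \<nu>) * 3 ^ card P" by simp
  also have "card (set_mset \<nu>) \<le> card P"
    unfolding s[symmetric] by (rule card_set_mset_le_size)
  finally show ?thesis by simp
qed

end

section \<open>Straightening\<close>

context position_set
begin

definition moment :: "(nat \<times> nat) multiset \<Rightarrow> nat" where
  "moment S = (\<Sum>(a, i)\<in>#S. a * i)"

lemma moment_joint: "moment (joint x y) = (\<Sum>p\<in>P. x p * y p)"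
  by (simp add: moment_def joint_def multiset.map_comp o_def sum_unfold_sum_mset)

lemma joint_setD:
  assumes "joint x y = joint x' y'" "p \<in> P"
  obtains q where "q \<in> P" "x' q = x p" "y' q = y p"
proof -
  have "(x p, y p) \<in># joint x y" using assms(2) by (auto simp: joint_def)
  then show ?thesis using that by (auto simp: assms(1)) (auto simp: joint_def)
qed

text \<open>The Garnir relation: the letters \<open>\<ge> b\<close> of row \<open>j\<close> and the letters \<open>\<le> b\<close> of row \<open>j + 1\<close> are merged
  into one row, which by the violated inequality is longer than row \<open>j\<close>, and the remaining letters of row
  \<open>j + 1\<close> move to a new row \<open>z\<close>. As the merged letters are the largest of row \<open>j\<close> and the smallest of
  row \<open>j + 1\<close>, the original tableau occurs with coefficient \<open>1\<close>, and all others have greater moment.\<close>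

lemma straightening_kernel:
  assumes x0: "x0 \<in> words" and \<rho>0: "\<rho>0 \<in> words"
    and viol: "card {p \<in> P. \<rho>0 p = j \<and> x0 p < b} < card {p \<in> P. \<rho>0 p = Suc j \<and> x0 p \<le> b}"
    and anti: "count (content \<rho>0) (Suc j) \<le> count (content \<rho>0) j"
  obtains \<tau> where "\<tau> \<in> words" "weight (content \<rho>0) < weight (content \<tau>)"
    "kmult (content \<tau>) (ind (joint x0 \<tau>)) (ind (joint \<tau> \<rho>0)) x0 \<rho>0 = 1"
    "\<And>x \<rho>. x \<in> words \<Longrightarrow> \<rho> \<in> words \<Longrightarrow>
       kmult (content \<tau>) (ind (joint x0 \<tau>)) (ind (joint \<tau> \<rho>0)) x \<rho> \<noteq> 0 \<Longrightarrow>
       joint x \<rho> = joint x0 \<rho>0 \<or> moment (joint x0 \<rho>0) < moment (joint x \<rho>)"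
proof -
  have "finite (insert j (insert (Suc j) (\<rho>0 ` P)))" by simp
  then obtain z where z: "z \<noteq> j" "z \<noteq> Suc j" "z \<notin> \<rho>0 ` P"
    using ex_new_if_finite[OF infinite_UNIV_nat] by blast
  define \<tau> where "\<tau> p = (if p \<notin> P then 0 else if \<rho>0 p = j \<and> \<not> x0 p < b then Suc j
    else if \<rho>0 p = Suc j \<and> \<not> x0 p \<le> b then z else \<rho>0 p)" for p
  have \<tau>w: "\<tau> \<in> words" by (simp add: \<tau>_def words_def)
  have \<tau>_other: "\<rho>0 p = \<tau> p" if "p \<in> P" "\<tau> p \<noteq> j" "\<tau> p \<noteq> Suc j" "\<tau> p \<noteq> z" for p
    using that by (auto simp: \<tau>_def split: if_splits)
  have \<tau>_j: "\<tau> p = j \<longleftrightarrow> \<rho>0 p = j \<and> x0 p < b" if "p \<in> P" for p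
    using that z by (auto simp: \<tau>_def)
  have \<tau>_Sj: "\<tau> p = Suc j \<longleftrightarrow> (\<rho>0 p = j \<and> \<not> x0 p < b) \<or> (\<rho>0 p = Suc j \<and> x0 p \<le> b)" if "p \<in> P" for p
    using that z by (auto simp: \<tau>_def)
  have \<tau>_z: "\<tau> p = z \<longleftrightarrow> \<rho>0 p = Suc j \<and> \<not> x0 p \<le> b" if "p \<in> P" for p
    using that z by (auto simp: \<tau>_def)
  have \<tau>_other': "\<tau> p = i \<longleftrightarrow> \<rho>0 p = i" if "p \<in> P" "i \<noteq> j" "i \<noteq> Suc j" "i \<noteq> z" for p i
    using that z by (auto simp: \<tau>_def)
  let ?pr = "kmult (content \<tau>) (ind (joint x0 \<tau>)) (ind (joint \<tau> \<rho>0))"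

  have weight: "weight (content \<rho>0) < weight (content \<tau>)"
  proof -
    define c1 where "c1 = card {p \<in> P. \<rho>0 p = j \<and> x0 p < b}"
    define c2 where "c2 = card {p \<in> P. \<rho>0 p = Suc j \<and> x0 p \<le> b}"
    define D where "D = set_mset (content \<rho>0) \<union> set_mset (content \<tau>) - {j, Suc j, z}"
    \<comment> \<open>\<open>weight\<close> runs over the labels that occur, so an empty row counts
      \<open>0\<close> and not \<open>3 ^ 0\<close>.\<close>
    define g :: "nat \<Rightarrow> nat" where "g c = (if c = 0 then 0 else 3 ^ c)" for c
    have split: "weight (content y) = g (count (content y) j) + g (count (content y) (Suc j))
        + g (count (content y) z) + (\<Sum>i\<in>D. g (count (content y) i))"
      if "y = \<rho>0 \<or> y = \<tau>" for y
    proof -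
      have "weight (content y) = (\<Sum>i\<in>insert j (insert (Suc j) (insert z D)). g (count (content y) i))"
        unfolding g_def by (rule weight_superset) (use that in \<open>auto simp: D_def\<close>)
      then show ?thesis using z by (simp add: D_def)
    qed
    have cj: "count (content \<rho>0) j = c1 + card {p \<in> P. \<rho>0 p = j \<and> \<not> x0 p < b}"
      unfolding count_content c1_def
      by (subst card_Un_disjoint[symmetric]) (auto intro!: arg_cong[of _ _ card])
    have cSj: "count (content \<rho>0) (Suc j) = c2 + card {p \<in> P. \<rho>0 p = Suc j \<and> \<not> x0 p \<le> b}"
      unfolding count_content c2_def
      by (subst card_Un_disjoint[symmetric]) (auto intro!: arg_cong[of _ _ card])
    have "count (content \<tau>) (Suc j) = c2 + card {p \<in> P. \<rho>0 p = j \<and> \<not> x0 p < b}"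
    proof -
      have "{p \<in> P. \<tau> p = Suc j} = {p \<in> P. \<rho>0 p = Suc j \<and> x0 p \<le> b} \<union> {p \<in> P. \<rho>0 p = j \<and> \<not> x0 p < b}"
        using \<tau>_Sj by blast
      then show ?thesis unfolding count_content c2_def by (simp, subst card_Un_disjoint) auto
    qed
    then have "count (content \<rho>0) j < count (content \<tau>) (Suc j)"
      using cj viol by (simp add: c1_def c2_def)
    \<comment> \<open>With \<open>m\<close> the length of row \<open>j\<close>, the merged row
      counts at least \<open>3 * 3 ^ m\<close>, while the two old rows together count at most
      \<open>2 * 3 ^ m\<close>.\<close>
    then have big: "3 * 3 ^ count (content \<rho>0) j \<le> g (count (content \<tau>) (Suc j))"
      using power_increasing[of "Suc (count (content \<rho>0) j)" "count (content \<tau>) (Suc j)" "3::nat"]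
      by (simp add: g_def)
    have z0: "g (count (content \<rho>0) z) = 0"
      using z by (auto simp: count_content g_def)
    have "g (count (content \<rho>0) j) \<le> 3 ^ count (content \<rho>0) j" by (simp add: g_def)
    moreover have "g (count (content \<rho>0) (Suc j)) \<le> 3 ^ count (content \<rho>0) j"
      using anti by (simp add: g_def power_increasing)
    moreover have "(1::nat) \<le> 3 ^ count (content \<rho>0) j" by simp
    ultimately have "g (count (content \<rho>0) j) + g (count (content \<rho>0) (Suc j))
        + g (count (content \<rho>0) z) < g (count (content \<tau>) (Suc j))"
      using big z0 by linarith
    moreover have "(\<Sum>i\<in>D. g (count (content \<rho>0) i)) = (\<Sum>i\<in>D. g (count (content \<tau>) i))"
    proof (rule sum.cong)
      fix i assume "i \<in> D"
      then have "{p \<in> P. \<rho>0 p = i} = {p \<in> P. \<tau> p = i}" using \<tau>_other' by (auto simp: D_def)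
      then show "g (count (content \<rho>0) i) = g (count (content \<tau>) i)" by (simp add: count_content)
    qed simp
    ultimately show ?thesis
      unfolding split[of \<rho>0, simplified] split[of \<tau>, simplified] by linarith
  qed

  \<comment> \<open>Rows \<open>j\<close> and \<open>z\<close> of \<open>\<tau>\<close> are each cut
    out by one condition on \<open>\<rho>0\<close> and one on \<open>x0\<close>. So
    \<open>\<rho>'\<close> can use these labels only where \<open>\<tau>\<close> does, and since the
    counts agree it uses them everywhere there. At the remaining places \<open>\<tau>\<close> is a
    function of \<open>\<rho>0\<close>.\<close>
  have unique: "\<rho>' = \<tau>" if w: "\<rho>' \<in> words" and e1: "joint x0 \<rho>' = joint x0 \<tau>"
    and e2: "joint \<rho>' \<rho>0 = joint \<tau> \<rho>0" for \<rho>'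
  proof -
    have c: "card {p \<in> P. \<rho>' p = i} = card {p \<in> P. \<tau> p = i}" for i
      using arg_cong[OF e1, of "\<lambda>M. count (image_mset snd M) i"] by (simp add: joint_snd count_content)
    have s1: "\<exists>q\<in>P. \<tau> q = \<rho>' p \<and> \<rho>0 q = \<rho>0 p" if "p \<in> P" for p
      using joint_setD[OF e2 that] by metis
    have s2: "\<exists>q\<in>P. x0 q = x0 p \<and> \<tau> q = \<rho>' p" if "p \<in> P" for p
      using joint_setD[OF e1 that] by metis
    have jj: "\<tau> p = j" if "p \<in> P" "\<rho>' p = j" for p
      using s1[OF that(1)] s2[OF that(1)] \<tau>_j that by metis
    have zz: "\<tau> p = z" if "p \<in> P" "\<rho>' p = z" for p
      using s1[OF that(1)] s2[OF that(1)] \<tau>_z that by metis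
    have "{p \<in> P. \<rho>' p = j} = {p \<in> P. \<tau> p = j}"
      by (rule card_subset_eq) (use jj c in auto)
    then have jj': "\<rho>' p = j" if "p \<in> P" "\<tau> p = j" for p using that by blast
    have "{p \<in> P. \<rho>' p = z} = {p \<in> P. \<tau> p = z}"
      by (rule card_subset_eq) (use zz c in auto)
    then have zz': "\<rho>' p = z" if "p \<in> P" "\<tau> p = z" for p using that by blast
    show ?thesis
    proof (rule words_eqI[OF w \<tau>w])
      fix p assume p: "p \<in> P"
      obtain q where q: "q \<in> P" "\<tau> q = \<rho>' p" "\<rho>0 q = \<rho>0 p" using s1[OF p] by blast
      consider "\<tau> p = j" | "\<tau> p = z" | "\<tau> p \<noteq> j" "\<tau> p \<noteq> z" by blast
      then show "\<rho>' p = \<tau> p"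
      proof cases
        case 3
        then have "\<tau> q \<noteq> j" "\<tau> q \<noteq> z" using jj zz p q by metis+
        then show ?thesis using 3 q p by (auto simp: \<tau>_def split: if_splits)
      qed (use jj' zz' p in auto)
    qed
  qed

  have pr1: "?pr x0 \<rho>0 = 1"
  proof -
    have "?pr x0 \<rho>0 = (\<Sum>\<rho>'\<in>words_of (content \<tau>). of_bool (\<rho>' = \<tau>))"
      unfolding kmult_def ind_def by (rule sum.cong) (auto simp: words_of_def dest: unique)
    also have "\<tau> \<in> words_of (content \<tau>)" using \<tau>w by (simp add: words_of_def)
    then have "(\<Sum>\<rho>'\<in>words_of (content \<tau>). of_bool (\<rho>' = \<tau>)) = (1::int)" by (simp add: of_bool_def)
    finally show ?thesis .
  qed

  \<comment> \<open>The hypothesis lets \<open>\<rho>\<close> exchange labels of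
    \<open>\<rho>0\<close> only inside a row of \<open>\<tau>\<close>, and only the merged row
    carries two labels, \<open>j\<close> and \<open>Suc j\<close>. There the letters of row
    \<open>j\<close> are at least \<open>b\<close> and their labels can only go up; those of row
    \<open>Suc j\<close> are at most \<open>b\<close> and their labels can only go down.\<close>
  have raise: "joint x0 \<rho> = joint x0 \<rho>0 \<or> moment (joint x0 \<rho>0) < moment (joint x0 \<rho>)"
    if e: "joint \<tau> \<rho> = joint \<tau> \<rho>0" for \<rho>
  proof -
    have con: "content \<rho> = content \<rho>0" using arg_cong[OF e, of "image_mset snd"] by (simp add: joint_snd)
    have s: "\<exists>q\<in>P. \<tau> q = \<tau> p \<and> \<rho>0 q = \<rho> p" if "p \<in> P" for p
      using joint_setD[OF e that] by metis
    \<comment> \<open>the \<open>b\<close>-terms cancel in the sum, which makes the difference of the moments a sum of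
      non-negative terms\<close>
    let ?d = "\<lambda>p. (int (x0 p) - int b) * (int (\<rho> p) - int (\<rho>0 p))"
    have nonneg: "0 \<le> ?d p" if p: "p \<in> P" for p
    proof -
      obtain q where q: "q \<in> P" "\<tau> q = \<tau> p" "\<rho>0 q = \<rho> p" using s[OF p] by blast
      show ?thesis
      proof (cases "\<tau> p = Suc j")
        case True
        then have "\<rho> p = j \<or> \<rho> p = Suc j" "\<rho>0 p = j \<and> \<not> x0 p < b \<or> \<rho>0 p = Suc j \<and> x0 p \<le> b"
          using \<tau>_Sj[OF q(1)] \<tau>_Sj[OF p] True q by metis+
        then show ?thesis by (auto intro: mult_nonpos_nonpos)
      next
        case False
        have "\<rho>0 q = \<rho>0 p"
          using False q p \<tau>_j \<tau>_z \<tau>_other by metis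
        then show ?thesis using q by simp
      qed
    qed
    have "(\<Sum>p\<in>P. int (\<rho> p)) = (\<Sum>p\<in>P. int (\<rho>0 p))"
      using arg_cong[OF con, of "\<lambda>M. \<Sum>i\<in>#M. int i"]
      by (simp add: content_def multiset.map_comp o_def sum_unfold_sum_mset)
    then have "(\<Sum>p\<in>P. ?d p) = int (moment (joint x0 \<rho>)) - int (moment (joint x0 \<rho>0))"
      unfolding moment_joint by (simp add: algebra_simps sum.distrib sum_subtractf sum_distrib_left[symmetric])
    moreover have "0 \<le> (\<Sum>p\<in>P. ?d p)" using nonneg by (rule sum_nonneg)
    \<comment> \<open>If all terms vanish, labels changed only at letters equal to \<open>b\<close>.
      As the total number of each label is fixed, the labels at the letter \<open>b\<close> are then
      determined by the rest.\<close>
    moreover have "joint x0 \<rho> = joint x0 \<rho>0" if "(\<Sum>p\<in>P. ?d p) = 0"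
    proof (rule multiset_eqI)
      fix c :: "nat \<times> nat"
      obtain a i where c: "c = (a, i)" by force
      have fixd: "x0 p = b \<or> \<rho> p = \<rho>0 p" if "p \<in> P" for p
        using \<open>(\<Sum>p\<in>P. ?d p) = 0\<close> nonneg that by (subst (asm) sum_nonneg_eq_0_iff) auto
      have tot: "card {p \<in> P. y p = i} = card {p \<in> P. x0 p = b \<and> y p = i} + card {p \<in> P. x0 p \<noteq> b \<and> y p = i}" for y
        by (subst card_Un_disjoint[symmetric]) (auto intro!: arg_cong[of _ _ card])
      have ne: "{p \<in> P. Q (x0 p) \<and> x0 p \<noteq> b \<and> \<rho> p = i} = {p \<in> P. Q (x0 p) \<and> x0 p \<noteq> b \<and> \<rho>0 p = i}" for Q
        by (rule Collect_cong) (metis fixd)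
      have "card {p \<in> P. x0 p = a \<and> \<rho> p = i} = card {p \<in> P. x0 p = a \<and> \<rho>0 p = i}"
      proof (cases "a = b")
        case True
        have "card {p \<in> P. \<rho> p = i} = card {p \<in> P. \<rho>0 p = i}"
          using con by (metis count_content)
        then show ?thesis using tot[of \<rho>] tot[of \<rho>0] ne[of "\<lambda>_. True"] True by simp
      next
        case False
        then have "{p \<in> P. x0 p = a \<and> \<rho> p = i} = {p \<in> P. x0 p = a \<and> \<rho>0 p = i}"
          using ne[of "\<lambda>c. c = a"] by auto
        then show ?thesis by simp
      qed
      then show "count (joint x0 \<rho>) c = count (joint x0 \<rho>0) c" by (simp add: c count_joint)
    qed
    ultimately show ?thesis by linarith
  qed

  show ?thesis
  proof (rule that[OF \<tau>w weight pr1])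
    fix x \<rho> assume x: "x \<in> words" and \<rho>: "\<rho> \<in> words" and nz: "?pr x \<rho> \<noteq> 0"
    from nz obtain \<rho>' where "\<rho>' \<in> words_of (content \<tau>)"
      "ind (joint x0 \<tau>) x \<rho>' * ind (joint \<tau> \<rho>0) \<rho>' \<rho> \<noteq> 0"
      unfolding kmult_def by (rule sum.not_neutral_contains_not_neutral)
    then have \<rho>': "\<rho>' \<in> words" "joint x \<rho>' = joint x0 \<tau>" "joint \<rho>' \<rho> = joint \<tau> \<rho>0"
      by (auto simp: ind_def words_of_def)
    obtain \<sigma> where \<sigma>: "\<sigma> permutes P" "x = x0 \<circ> \<sigma>" "\<rho>' = \<tau> \<circ> \<sigma>"
      using joint_eqE[OF \<rho>'(2) x \<rho>'(1) x0 \<tau>w] by metis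
    \<comment> \<open>The filling is moved along with \<open>x\<close> to \<open>x0\<close>, the
      case treated by \<open>raise\<close>.\<close>
    let ?\<rho>1 = "\<rho> \<circ> inv_into UNIV \<sigma>"
    have \<rho>1: "?\<rho>1 \<circ> \<sigma> = \<rho>" using permutes_inv_o(2)[OF \<sigma>(1)] by (simp add: o_assoc[symmetric])
    have "joint \<tau> ?\<rho>1 = joint \<tau> \<rho>0"
      using joint_comp[OF \<sigma>(1), of \<tau> ?\<rho>1] \<rho>'(3) \<sigma>(3) \<rho>1 by simp
    moreover have "joint x0 ?\<rho>1 = joint x \<rho>"
      using joint_comp[OF \<sigma>(1), of x0 ?\<rho>1] \<sigma>(2) \<rho>1 by simp
    ultimately show "joint x \<rho> = joint x0 \<rho>0 \<or> moment (joint x0 \<rho>0) < moment (joint x \<rho>)"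
      using raise[of ?\<rho>1] by simp
  qed
qed

end

section \<open>Tableaux and the renaming of rows\<close>

lemma count_image_mset_inj_on:
  assumes "inj_on f (set_mset M)" "a \<in># M"
  shows "count (image_mset f M) (f a) = count M a"
proof -
  have "{x. x \<in># M \<and> f a = f x} = {a}" using assms by (auto dest: inj_onD)
  then show ?thesis by (simp add: count_image_mset')
qed

text \<open>Straightening requires row lengths that decrease with the label, whereas Garnir steps
  return arbitrary contents. The witness sends a label to its rank when the labels are sorted by
  decreasing multiplicity.\<close>

lemma sort_multiplicities:
  fixes \<nu> :: "nat multiset"
  obtains f where "inj_on f (set_mset \<nu>)"
    "\<And>j. count (image_mset f \<nu>) (Suc j) \<le> count (image_mset f \<nu>) j"
proof -
  define xs where "xs = rev (sort_key (count \<nu>) (sorted_list_of_set (set_mset \<nu>)))"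
  have xs: "distinct xs" "set xs = set_mset \<nu>" by (simp_all add: xs_def)
  have "sorted_wrt (\<lambda>a b. count \<nu> b \<le> count \<nu> a) xs"
    unfolding xs_def sorted_wrt_rev using sorted_sort_key[of "count \<nu>" "sorted_list_of_set (set_mset \<nu>)"]
    unfolding sorted_map by simp
  then have mono: "count \<nu> (xs ! j) \<le> count \<nu> (xs ! i)" if "i < j" "j < length xs" for i j
    using that by (simp add: sorted_wrt_iff_nth_less)
  have bij: "bij_betw ((!) xs) {..<length xs} (set_mset \<nu>)"
    using bij_betw_nth[OF xs(1) refl xs(2)[symmetric]] .
  define f where "f = inv_into {..<length xs} ((!) xs)"
  have f: "f (xs ! k) = k" if "k < length xs" for k
    unfolding f_def using bij that by (simp add: bij_betw_inv_into_left)
  have fbij: "bij_betw f (set_mset \<nu>) {..<length xs}"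
    unfolding f_def by (rule bij_betw_inv_into[OF bij])
  then have inj: "inj_on f (set_mset \<nu>)" by (simp add: bij_betw_def)
  have c: "count (image_mset f \<nu>) k = (if k < length xs then count \<nu> (xs ! k) else 0)" for k
  proof (cases "k < length xs")
    case True
    then have "xs ! k \<in># \<nu>" using xs(2) nth_mem by blast
    then show ?thesis using count_image_mset_inj_on[OF inj, of "xs ! k"] f[OF True] True by simp
  next
    case False
    then have "k \<notin> f ` set_mset \<nu>" using fbij by (auto simp: bij_betw_def)
    then show ?thesis using False by (simp add: count_eq_zero_iff)
  qed
  show ?thesis by (rule that[OF inj]) (use mono in \<open>auto simp: c\<close>)
qed

definition shape :: "(nat \<times> nat) multiset \<Rightarrow> nat multiset" where
  "shape S = image_mset snd S"

text \<open>Equivalently, the columns of the tableau with increasing rows are strictly increasing; taking \<open>b\<close> large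
  shows that the row lengths decrease.\<close>

definition semistandard :: "(nat \<times> nat) multiset \<Rightarrow> bool" where
  "semistandard S \<longleftrightarrow> (\<forall>j b. size (filter_mset (\<lambda>(a, i). i = Suc j \<and> a \<le> b) S)
     \<le> size (filter_mset (\<lambda>(a, i). i = j \<and> a < b) S))"

context position_set
begin

definition relabel :: "(nat \<Rightarrow> nat) \<Rightarrow> (nat \<Rightarrow> nat) \<Rightarrow> (nat \<Rightarrow> nat)" where
  "relabel f \<rho> = (\<lambda>p. if p \<in> P then f (\<rho> p) else 0)"

lemma relabel_comp: "\<sigma> permutes P \<Longrightarrow> relabel f (\<rho> \<circ> \<sigma>) = relabel f \<rho> \<circ> \<sigma>"
  by (auto simp: relabel_def fun_eq_iff permutes_in_image)

lemma content_relabel: "content (relabel f \<rho>) = image_mset f (content \<rho>)"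
  unfolding content_def multiset.map_comp by (rule image_mset_cong) (simp add: relabel_def)

lemma relabel_words_of: "\<rho> \<in> words_of \<nu> \<Longrightarrow> relabel f \<rho> \<in> words_of (image_mset f \<nu>)"
  using content_relabel[of f \<rho>] by (auto simp: words_of_def words_def relabel_def)

lemma words_of_letters: "\<rho> \<in> words_of \<nu> \<Longrightarrow> p \<in> P \<Longrightarrow> \<rho> p \<in># \<nu>"
  by (auto simp: words_of_def content_def)

text \<open>The filling is only a summation variable: renaming the rows is a bijection between the
  fillings of the two contents, and the inverse renaming is absorbed by the kernels.\<close>

lemma kmult_relabel:
  assumes "inj_on f (set_mset \<nu>)"
  shows "kmult \<nu> g h x y = kmult (image_mset f \<nu>)
    (\<lambda>x \<rho>. g x (relabel (inv_into (set_mset \<nu>) f) \<rho>)) (\<lambda>\<rho> y. h (relabel (inv_into (set_mset \<nu>) f) \<rho>) y) x y"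
  (is "_ = kmult _ (\<lambda>x \<rho>. g x (?i \<rho>)) (\<lambda>\<rho> y. h (?i \<rho>) y) x y")
  unfolding kmult_def
proof (rule sum.reindex_bij_witness[where j = "relabel f" and i = ?i])
  fix \<rho> assume \<rho>: "\<rho> \<in> words_of \<nu>"
  show 1: "?i (relabel f \<rho>) = \<rho>"
    by (rule words_eqI) (use \<rho> assms words_of_letters[OF \<rho>] in \<open>auto simp: words_def words_of_def relabel_def\<close>)
  show "relabel f \<rho> \<in> words_of (image_mset f \<nu>)" by (rule relabel_words_of[OF \<rho>])
  show "g x (?i (relabel f \<rho>)) * h (?i (relabel f \<rho>)) y = g x \<rho> * h \<rho> y" unfolding 1 ..
next
  fix \<rho> assume \<rho>: "\<rho> \<in> words_of (image_mset f \<nu>)"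
  show "relabel f (?i \<rho>) = \<rho>"
    by (rule words_eqI)
      (use \<rho> assms words_of_letters[OF \<rho>] in \<open>auto simp: words_def words_of_def relabel_def f_inv_into_f\<close>)
  have "image_mset (inv_into (set_mset \<nu>) f) (image_mset f \<nu>) = image_mset (\<lambda>a. a) \<nu>"
    unfolding multiset.map_comp by (rule image_mset_cong) (use assms in simp)
  then show "?i \<rho> \<in> words_of \<nu>" using relabel_words_of[OF \<rho>, of "inv_into (set_mset \<nu>) f"] by simp
qed

lemma weight_image_mset:
  assumes "inj_on f (set_mset \<nu>)"
  shows "weight (image_mset f \<nu>) = weight \<nu>"
  unfolding weight_def using assms count_image_mset_inj_on[OF assms] by (simp add: sum.reindex)

lemma semistandard_joint:
  "semistandard (joint x \<rho>) \<longleftrightarrow>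
    (\<forall>j b. card {p \<in> P. \<rho> p = Suc j \<and> x p \<le> b} \<le> card {p \<in> P. \<rho> p = j \<and> x p < b})"
  unfolding semistandard_def
  using size_filter_joint[of "\<lambda>a i. i = Suc j \<and> a \<le> b" for j b] size_filter_joint[of "\<lambda>a i. i = j \<and> a < b" for j b]
  by simp

lemma semistandard_antitone:
  assumes "semistandard (joint x \<rho>)"
  shows "count (content \<rho>) (Suc j) \<le> count (content \<rho>) j"
proof -
  \<comment> \<open>A bound for all letters makes the left side of the semistandard inequality count
    the whole row; \<open>0\<close> is inserted to cover empty \<open>P\<close>.\<close>
  define b where "b = Max (insert 0 (x ` P))"
  have b: "x p \<le> b" if "p \<in> P" for p using that by (simp add: b_def)
  have "count (content \<rho>) (Suc j) = card {p \<in> P. \<rho> p = Suc j \<and> x p \<le> b}"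
    unfolding count_content using b by (metis (lifting))
  also have "\<dots> \<le> card {p \<in> P. \<rho> p = j \<and> x p < b}" using assms unfolding semistandard_joint by blast
  also have "\<dots> \<le> count (content \<rho>) j" unfolding count_content by (rule card_mono) auto
  finally show ?thesis .
qed

lemma shape_joint [simp]: "shape (joint x \<rho>) = content \<rho>"
  by (simp add: shape_def joint_snd)

lemma invariant_factor:
  assumes "invariant h"
  obtains r where "\<And>x y. x \<in> words \<Longrightarrow> y \<in> words \<Longrightarrow> h x y = r (joint x y)"
proof (rule that)
  fix x y assume xy: "x \<in> words" "y \<in> words"
  define rep where "rep U = (SOME p. fst p \<in> words \<and> snd p \<in> words \<and> joint (fst p) (snd p) = U)" for U
  have "fst (rep (joint x y)) \<in> words \<and> snd (rep (joint x y)) \<in> words \<and>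
      joint (fst (rep (joint x y))) (snd (rep (joint x y))) = joint x y"
    unfolding rep_def by (rule someI[of _ "(x, y)"]) (use xy in simp)
  then show "h x y = (\<lambda>U. h (fst (rep U)) (snd (rep U))) (joint x y)"
    using invariant_joint_cong[OF assms] xy by metis
qed

end

section \<open>Semistandard tableaux and kernels modulo heavier contents\<close>

locale word_set = position_set +
  fixes \<C> :: "nat multiset set"
  assumes finite_contents [simp, intro]: "finite \<C>"
begin

text \<open>The words on which the idempotent \<open>e\<close> is supported; \<open>\<C>\<close>
  consists of the weights that make up \<open>e\<close>.\<close>

definition wset :: "(nat \<Rightarrow> nat) set" where
  "wset = {x \<in> words. content x \<in> \<C>}"

lemma finite_wset [simp, intro]: "finite wset"
proof -
  have "wset = (\<Union>\<mu>\<in>\<C>. words_of \<mu>)" by (auto simp: wset_def words_of_def)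
  then show ?thesis by simp
qed

lemma wset_words: "x \<in> wset \<Longrightarrow> x \<in> words"
  by (simp add: wset_def)

lemma wset_comp: "x \<in> wset \<Longrightarrow> \<sigma> permutes P \<Longrightarrow> x \<circ> \<sigma> \<in> wset"
  by (simp add: wset_def words_comp)

definition tableaux :: "nat multiset \<Rightarrow> (nat \<times> nat) multiset set" where
  "tableaux \<nu> = {joint x \<rho> | x \<rho>. x \<in> wset \<and> \<rho> \<in> words_of \<nu> \<and> semistandard (joint x \<rho>)}"

lemma finite_tableaux [simp, intro]: "finite (tableaux \<nu>)"
  by (rule finite_subset[of _ "(\<lambda>(x, \<rho>). joint x \<rho>) ` (wset \<times> words_of \<nu>)"]) (auto simp: tableaux_def)

lemma shape_tableaux: "S \<in> tableaux \<nu> \<Longrightarrow> shape S = \<nu>"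
  by (auto simp: tableaux_def words_of_def)

text \<open>The span of the kernels that factor through a heavier content, seen only on
  \<open>wset\<close> and \<open>words_of \<nu>\<close>; \<open>high_cong\<close> is what makes
  agreement on these words sufficient. The inductive form yields absorption under products by rule
  induction, in \<open>kmult_high\<close>.\<close>

inductive high :: "nat multiset \<Rightarrow> ((nat \<Rightarrow> nat) \<Rightarrow> (nat \<Rightarrow> nat) \<Rightarrow> int) \<Rightarrow> bool" for \<nu> where
  high_kmult: "weight \<nu> < weight \<nu>' \<Longrightarrow> invariant g \<Longrightarrow> invariant k \<Longrightarrow> high \<nu> (kmult \<nu>' g k)"
| high_zero: "high \<nu> (\<lambda>x \<rho>. 0)"
| high_add: "high \<nu> h \<Longrightarrow> high \<nu> h' \<Longrightarrow> high \<nu> (\<lambda>x \<rho>. h x \<rho> + h' x \<rho>)"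
| high_scale: "high \<nu> h \<Longrightarrow> high \<nu> (\<lambda>x \<rho>. c * h x \<rho>)"
| high_cong: "high \<nu> h \<Longrightarrow> (\<And>x \<rho>. x \<in> wset \<Longrightarrow> \<rho> \<in> words_of \<nu> \<Longrightarrow> h' x \<rho> = h x \<rho>) \<Longrightarrow> high \<nu> h'"

definition straight :: "nat multiset \<Rightarrow> ((nat \<Rightarrow> nat) \<Rightarrow> (nat \<Rightarrow> nat) \<Rightarrow> int) \<Rightarrow> bool" where
  "straight \<nu> h \<longleftrightarrow> (\<exists>r. high \<nu> (\<lambda>x \<rho>. h x \<rho> - (\<Sum>S\<in>tableaux \<nu>. r S * ind S x \<rho>)))"

lemma straight_high: "high \<nu> h \<Longrightarrow> straight \<nu> h"
  unfolding straight_def by (rule exI[of _ "\<lambda>_. 0"]) simp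

lemma straight_add:
  assumes "straight \<nu> h" "straight \<nu> h'"
  shows "straight \<nu> (\<lambda>x \<rho>. h x \<rho> + h' x \<rho>)"
proof -
  from assms obtain r r' where
    "high \<nu> (\<lambda>x \<rho>. h x \<rho> - (\<Sum>S\<in>tableaux \<nu>. r S * ind S x \<rho>))"
    "high \<nu> (\<lambda>x \<rho>. h' x \<rho> - (\<Sum>S\<in>tableaux \<nu>. r' S * ind S x \<rho>))" unfolding straight_def by blast
  from high_add[OF this] show ?thesis
    unfolding straight_def
    by (intro exI[of _ "\<lambda>S. r S + r' S"]) (erule high_cong, simp add: algebra_simps sum.distrib)
qed

lemma straight_scale:
  assumes "straight \<nu> h"
  shows "straight \<nu> (\<lambda>x \<rho>. c * h x \<rho>)"
proof -
  from assms obtain r where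
    "high \<nu> (\<lambda>x \<rho>. h x \<rho> - (\<Sum>S\<in>tableaux \<nu>. r S * ind S x \<rho>))" unfolding straight_def by blast
  from high_scale[OF this, of c] show ?thesis
    unfolding straight_def
    by (intro exI[of _ "\<lambda>S. c * r S"]) (erule high_cong, simp add: algebra_simps sum_distrib_left)
qed

lemma straight_cong:
  assumes "straight \<nu> h" "\<And>x \<rho>. x \<in> wset \<Longrightarrow> \<rho> \<in> words_of \<nu> \<Longrightarrow> h' x \<rho> = h x \<rho>"
  shows "straight \<nu> h'"
proof -
  from assms(1) obtain r where "high \<nu> (\<lambda>x \<rho>. h x \<rho> - (\<Sum>S\<in>tableaux \<nu>. r S * ind S x \<rho>))"
    unfolding straight_def by blast
  then have "high \<nu> (\<lambda>x \<rho>. h' x \<rho> - (\<Sum>S\<in>tableaux \<nu>. r S * ind S x \<rho>))"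
    by (rule high_cong) (simp add: assms(2))
  then show ?thesis unfolding straight_def by blast
qed

lemma straight_sum:
  assumes "finite A" "\<And>a. a \<in> A \<Longrightarrow> straight \<nu> (h a)"
  shows "straight \<nu> (\<lambda>x \<rho>. \<Sum>a\<in>A. h a x \<rho>)"
  using assms
proof (induction A rule: finite_induct)
  case empty
  then show ?case using straight_high[OF high_zero] by simp
next
  case (insert a A)
  then show ?case using straight_add[of \<nu> "h a" "\<lambda>x \<rho>. \<Sum>a\<in>A. h a x \<rho>"] by simp
qed

lemma straight_ind_tableau:
  assumes "S \<in> tableaux \<nu>"
  shows "straight \<nu> (ind S)"
proof -
  have "(\<Sum>S'\<in>tableaux \<nu>. of_bool (S' = S) * ind S' x \<rho>) = ind S x \<rho>" for x \<rho>
  proof -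
    have "(\<Sum>S'\<in>tableaux \<nu>. of_bool (S' = S) * ind S' x \<rho>) = (\<Sum>S'\<in>tableaux \<nu>. if S' = S then ind S' x \<rho> else 0)"
      by (rule sum.cong) auto
    then show ?thesis using assms by simp
  qed
  then show ?thesis
    unfolding straight_def by (intro exI[of _ "\<lambda>S'. of_bool (S' = S)"]) (simp add: high_zero)
qed

text \<open>Induction towards greater moments: modulo heavier contents, a Garnir product replaces an
  orbit indicator that is not semistandard by indicators of greater moment. Only finitely many
  orbits meet \<open>wset\<close> and \<open>words_of \<nu>\<close>, so the moments are bounded by
  \<open>B\<close>.\<close>

lemma straight_ind:
  assumes anti: "\<And>j. count \<nu> (Suc j) \<le> count \<nu> j" and "x0 \<in> wset" "\<rho>0 \<in> words_of \<nu>"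
  shows "straight \<nu> (ind (joint x0 \<rho>0))"
proof -
  define Us where "Us = (\<lambda>(x, \<rho>). joint x \<rho>) ` (wset \<times> words_of \<nu>)"
  have fin: "finite Us" by (simp add: Us_def)
  define B where "B = Max (moment ` Us)"
  have B: "moment U \<le> B" if "U \<in> Us" for U using that fin by (simp add: B_def)
  have "straight \<nu> (ind U)" if "U \<in> Us" for U
    using that
  proof (induction "B - moment U" arbitrary: U rule: less_induct)
    case less
    then obtain x0 \<rho>0 where U: "U = joint x0 \<rho>0" and x0: "x0 \<in> wset" and \<rho>0: "\<rho>0 \<in> words_of \<nu>"
      by (auto simp: Us_def)
    show ?case
    proof (cases "semistandard U")
      case True
      then show ?thesis using U x0 \<rho>0 by (intro straight_ind_tableau) (auto simp: tableaux_def)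
    next
      case False
      have c\<rho>0: "content \<rho>0 = \<nu>" "\<rho>0 \<in> words" "x0 \<in> words" using \<rho>0 x0 by (auto simp: words_of_def wset_def)
      from False obtain j b where
        viol: "card {p \<in> P. \<rho>0 p = j \<and> x0 p < b} < card {p \<in> P. \<rho>0 p = Suc j \<and> x0 p \<le> b}"
        unfolding U semistandard_joint by (auto simp: not_le)
      from straightening_kernel[OF c\<rho>0(3,2) viol] anti c\<rho>0(1) obtain \<tau> where \<tau>: "\<tau> \<in> words"
        "weight \<nu> < weight (content \<tau>)"
        "kmult (content \<tau>) (ind (joint x0 \<tau>)) (ind (joint \<tau> \<rho>0)) x0 \<rho>0 = 1"
        "\<And>x \<rho>. x \<in> words \<Longrightarrow> \<rho> \<in> words \<Longrightarrow>
           kmult (content \<tau>) (ind (joint x0 \<tau>)) (ind (joint \<tau> \<rho>0)) x \<rho> \<noteq> 0 \<Longrightarrow>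
           joint x \<rho> = U \<or> moment U < moment (joint x \<rho>)"
        unfolding U by metis
      let ?pr = "kmult (content \<tau>) (ind (joint x0 \<tau>)) (ind (joint \<tau> \<rho>0))"
      have inv: "invariant ?pr" by (intro invariant_kmult invariant_ind)
      obtain r where r: "\<And>x y. x \<in> words \<Longrightarrow> y \<in> words \<Longrightarrow> ?pr x y = r (joint x y)"
        using invariant_factor[OF inv] by blast
      define V where "V = {Q \<in> Us. moment U < moment Q}"
      have eq: "ind U x \<rho> = ?pr x \<rho> + (\<Sum>Q\<in>V. (- r Q) * ind Q x \<rho>)"
        if x: "x \<in> wset" and \<rho>: "\<rho> \<in> words_of \<nu>" for x \<rho>
      proof -
        have w: "x \<in> words" "\<rho> \<in> words" using x \<rho> by (auto simp: words_of_def wset_def)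
        have inU: "joint x \<rho> \<in> Us" using x \<rho> by (auto simp: Us_def)
        have "(\<Sum>Q\<in>V. (- r Q) * ind Q x \<rho>) = (\<Sum>Q\<in>V. if Q = joint x \<rho> then - r Q else 0)"
          by (rule sum.cong) (auto simp: ind_def)
        also have "\<dots> = (if joint x \<rho> \<in> V then - r (joint x \<rho>) else 0)"
          using fin by (simp add: V_def)
        finally have s: "(\<Sum>Q\<in>V. (- r Q) * ind Q x \<rho>) = (if joint x \<rho> \<in> V then - ?pr x \<rho> else 0)"
          using r[OF w] by simp
        \<comment> \<open>The leading coefficient is a unit, which allows solving for
          \<open>ind U\<close> over the integers.\<close>
        have "r U = 1" using r[of x0 \<rho>0] \<tau>(3) c\<rho>0 U by simp
        then show ?thesis
          unfolding s using \<tau>(4)[OF w] r[OF w] inU by (cases "joint x \<rho> = U") (auto simp: V_def ind_def)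
      qed
      have "straight \<nu> (\<lambda>x \<rho>. ?pr x \<rho> + (\<Sum>Q\<in>V. (- r Q) * ind Q x \<rho>))"
      proof (intro straight_add straight_sum straight_scale)
        show "straight \<nu> ?pr" by (intro straight_high high_kmult \<tau>(2) invariant_ind)
        show "finite V" using fin by (simp add: V_def)
        fix Q assume "Q \<in> V"
        then have "Q \<in> Us" "moment U < moment Q" by (auto simp: V_def)
        then show "straight \<nu> (ind Q)" using less.hyps B[of Q] by auto
      qed
      then show ?thesis by (rule straight_cong) (rule eq)
    qed
  qed
  then show ?thesis using assms(2,3) by (auto simp: Us_def)
qed

lemma straight_invariant:
  assumes anti: "\<And>j. count \<nu> (Suc j) \<le> count \<nu> j" and inv: "invariant h"
  shows "straight \<nu> h"
proof -
  obtain r where r: "\<And>x y. x \<in> words \<Longrightarrow> y \<in> words \<Longrightarrow> h x y = r (joint x y)"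
    using invariant_factor[OF inv] by blast
  define Us where "Us = (\<lambda>(x, \<rho>). joint x \<rho>) ` (wset \<times> words_of \<nu>)"
  have fin: "finite Us" by (simp add: Us_def)
  have "straight \<nu> (\<lambda>x \<rho>. \<Sum>U\<in>Us. r U * ind U x \<rho>)"
    by (intro straight_sum straight_scale fin) (auto simp: Us_def intro: straight_ind[OF anti])
  then show ?thesis
  proof (rule straight_cong)
    fix x \<rho> assume x: "x \<in> wset" and \<rho>: "\<rho> \<in> words_of \<nu>"
    have "(\<Sum>U\<in>Us. r U * ind U x \<rho>) = (\<Sum>U\<in>Us. if U = joint x \<rho> then r U else 0)"
      by (rule sum.cong) (auto simp: ind_def)
    also have "\<dots> = r (joint x \<rho>)" using fin x \<rho> by (auto simp: Us_def)
    finally show "h x \<rho> = (\<Sum>U\<in>Us. r U * ind U x \<rho>)"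
      using r[of x \<rho>] x \<rho> by (simp add: wset_def words_of_def)
  qed
qed

end

section \<open>Spanning\<close>

context word_set
begin

definition shapes :: "nat multiset set" where
  "shapes = {\<nu>. tableaux \<nu> \<noteq> {}}"

definition cells :: "((nat \<times> nat) multiset \<times> (nat \<times> nat) multiset) set" where
  "cells = (\<Union>\<nu>\<in>shapes. tableaux \<nu> \<times> tableaux \<nu>)"

text \<open>The codeterminant of \<open>S\<close> and \<open>T\<close>. The content summed over is
  that of \<open>S\<close>; for pairs in \<open>cells\<close> both shapes agree.\<close>

definition cell :: "(nat \<times> nat) multiset \<Rightarrow> (nat \<times> nat) multiset \<Rightarrow> (nat \<Rightarrow> nat) \<Rightarrow> (nat \<Rightarrow> nat) \<Rightarrow> int" where
  "cell S T = kmult (shape S) (ind S) (\<lambda>\<rho> y. ind T y \<rho>)"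

lemma antitone_tableau: "S \<in> tableaux \<nu> \<Longrightarrow> count \<nu> (Suc j) \<le> count \<nu> j"
  using semistandard_antitone by (auto simp: tableaux_def words_of_def)

text \<open>Decreasing row lengths leave no gap below an occurring label, so a label
  \<open>i\<close> forces \<open>i + 1\<close> distinct labels. This confines partitions to finitely
  many labels.\<close>

lemma antitone_bound:
  fixes \<nu> :: "nat multiset"
  assumes anti: "\<And>j. count \<nu> (Suc j) \<le> count \<nu> j" and "i \<in># \<nu>"
  shows "i < size \<nu>"
proof -
  have "{..i} \<subseteq> set_mset \<nu>"
  proof
    fix j assume "j \<in> {..i}"
    then have "count \<nu> i \<le> count \<nu> j"
      using lift_Suc_antimono_le[of "count \<nu>" j i] anti by simp
    then show "j \<in># \<nu>" using assms(2) by (metis count_greater_zero_iff less_le_trans)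
  qed
  then have "card {..i} \<le> card (set_mset \<nu>)" by (intro card_mono) auto
  then show ?thesis using card_set_mset_le_size[of \<nu>] by simp
qed

lemma finite_shapes [simp, intro]: "finite shapes"
proof -
  define W where "W = {\<rho>. \<forall>p. (p \<in> P \<longrightarrow> \<rho> p \<in> {..<card P}) \<and> (p \<notin> P \<longrightarrow> \<rho> p = (0::nat))}"
  have "finite W" unfolding W_def by (rule finite_set_of_finite_funs) auto
  moreover have "shapes \<subseteq> content ` W"
  proof
    fix \<nu> assume "\<nu> \<in> shapes"
    then obtain S where S: "S \<in> tableaux \<nu>" by (auto simp: shapes_def)
    then obtain \<rho> where \<rho>: "\<rho> \<in> words_of \<nu>" by (auto simp: tableaux_def)
    then have "size \<nu> = card P" by (auto simp: words_of_def)
    then have "\<rho> \<in> W"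
      using antitone_bound[OF antitone_tableau[OF S]] words_of_letters[OF \<rho>] \<rho>
      by (auto simp: W_def words_of_def words_def)
    then show "\<nu> \<in> content ` W" using \<rho> by (auto simp: words_of_def)
  qed
  ultimately show ?thesis using finite_surj by blast
qed

lemma finite_cells [simp, intro]: "finite cells"
  by (simp add: cells_def)

lemma cells_iff: "(S, T) \<in> cells \<longleftrightarrow> S \<in> tableaux (shape S) \<and> T \<in> tableaux (shape S)"
  by (auto simp: cells_def shapes_def dest: shape_tableaux)

lemma cell_sym: "(S, T) \<in> cells \<Longrightarrow> cell S T x y = cell T S y x"
  using shape_tableaux[of T "shape S"] by (simp add: cell_def kmult_def cells_iff mult.commute)

lemma cells_sym: "(S, T) \<in> cells \<Longrightarrow> (T, S) \<in> cells"
  by (auto simp: cells_def)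

lemma invariant_transpose: "invariant h \<Longrightarrow> invariant (\<lambda>x y. h y x)"
  by (simp add: invariant_def)

lemma invariant_cell [simp]: "invariant (cell S T)"
  unfolding cell_def by (rule invariant_kmult[OF invariant_ind invariant_transpose[OF invariant_ind]])

text \<open>A filtration of the cells by weight. With bound \<open>Suc (weight \<nu>)\<close> it
  consists of the cells strictly above the shape \<open>\<nu>\<close>, the correction terms of
  (C3).\<close>

definition cells_ge :: "nat \<Rightarrow> ((nat \<times> nat) multiset \<times> (nat \<times> nat) multiset) set" where
  "cells_ge k = {c \<in> cells. k \<le> weight (shape (fst c))}"

lemma finite_cells_ge [simp, intro]: "finite (cells_ge k)"
  by (simp add: cells_ge_def)

definition in_span :: "nat \<Rightarrow> ((nat \<Rightarrow> nat) \<Rightarrow> (nat \<Rightarrow> nat) \<Rightarrow> int) \<Rightarrow> bool" where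
  "in_span k K \<longleftrightarrow> (\<exists>a. \<forall>x\<in>wset. \<forall>y\<in>wset. K x y = (\<Sum>c\<in>cells_ge k. a c * cell (fst c) (snd c) x y))"

lemma in_span_zero: "in_span k (\<lambda>x y. 0)"
  unfolding in_span_def by (rule exI[of _ "\<lambda>_. 0"]) simp

lemma in_span_add: "in_span k K \<Longrightarrow> in_span k L \<Longrightarrow> in_span k (\<lambda>x y. K x y + L x y)"
  unfolding in_span_def
  by (elim exE, rename_tac a b, rule_tac x = "\<lambda>c. a c + b c" in exI) (simp add: sum.distrib algebra_simps)

lemma in_span_scale: "in_span k K \<Longrightarrow> in_span k (\<lambda>x y. c * K x y)"
  unfolding in_span_def
  by (elim exE, rename_tac a, rule_tac x = "\<lambda>d. c * a d" in exI) (simp add: sum_distrib_left algebra_simps)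

lemma in_span_cong: "in_span k K \<Longrightarrow> (\<And>x y. x \<in> wset \<Longrightarrow> y \<in> wset \<Longrightarrow> L x y = K x y) \<Longrightarrow> in_span k L"
  unfolding in_span_def by simp

lemma in_span_sum:
  assumes "finite A" "\<And>a. a \<in> A \<Longrightarrow> in_span k (K a)"
  shows "in_span k (\<lambda>x y. \<Sum>a\<in>A. K a x y)"
  using assms
proof (induction A rule: finite_induct)
  case empty
  then show ?case using in_span_zero by simp
next
  case (insert a A)
  then show ?case using in_span_add[of k "K a" "\<lambda>x y. \<Sum>a\<in>A. K a x y"] by simp
qed

lemma in_span_mono:
  assumes "in_span k K" "l \<le> k"
  shows "in_span l K"
proof -
  obtain a where a: "K x y = (\<Sum>c\<in>cells_ge k. a c * cell (fst c) (snd c) x y)"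
    if "x \<in> wset" "y \<in> wset" for x y
    using assms(1) unfolding in_span_def by blast
  have "(\<Sum>c\<in>cells_ge k. a c * cell (fst c) (snd c) x y)
      = (\<Sum>c\<in>cells_ge l. (if c \<in> cells_ge k then a c else 0) * cell (fst c) (snd c) x y)" for x y
    using assms(2) by (intro sum.mono_neutral_cong_left) (auto simp: cells_ge_def)
  then show ?thesis
    unfolding in_span_def by (intro exI ballI) (simp only: a)
qed

text \<open>Straightening acts on left factors; this carries it over to right factors. Transposing
  exchanges \<open>cell S T\<close> and \<open>cell T S\<close>, which have the same weight.\<close>

lemma in_span_transpose:
  assumes "in_span k K"
  shows "in_span k (\<lambda>x y. K y x)"
proof -
  obtain a where a: "K x y = (\<Sum>c\<in>cells_ge k. a c * cell (fst c) (snd c) x y)"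
    if "x \<in> wset" "y \<in> wset" for x y
    using assms unfolding in_span_def by blast
  have sw: "prod.swap c \<in> cells_ge k" if "c \<in> cells_ge k" for c
  proof (cases c)
    case (Pair S T)
    then show ?thesis
      using that cells_sym[of S T] shape_tableaux[of T "shape S"] by (simp add: cells_ge_def cells_iff)
  qed
  have "(\<Sum>c\<in>cells_ge k. a c * cell (fst c) (snd c) y x)
      = (\<Sum>c\<in>cells_ge k. a (prod.swap c) * cell (fst c) (snd c) x y)" for x y
  proof (rule sum.reindex_bij_witness[where i = prod.swap and j = prod.swap])
    fix c assume c: "c \<in> cells_ge k"
    then have "cell (fst c) (snd c) y x = cell (snd c) (fst c) x y"
      by (intro cell_sym) (simp add: cells_ge_def)
    then show "a (prod.swap (prod.swap c)) * cell (fst (prod.swap c)) (snd (prod.swap c)) x y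
        = a c * cell (fst c) (snd c) y x" by simp
  qed (use sw in simp_all)
  then show ?thesis
    unfolding in_span_def by (intro exI[of _ "\<lambda>c. a (prod.swap c)"] ballI) (simp only: a)
qed

lemma in_span_cell: "(S, T) \<in> cells \<Longrightarrow> k \<le> weight (shape S) \<Longrightarrow> in_span k (cell S T)"
proof -
  assume c: "(S, T) \<in> cells" "k \<le> weight (shape S)"
  have "(\<Sum>c\<in>cells_ge k. of_bool (c = (S, T)) * cell (fst c) (snd c) x y) = cell S T x y" for x y
  proof -
    have "(\<Sum>c\<in>cells_ge k. of_bool (c = (S, T)) * cell (fst c) (snd c) x y)
       = (\<Sum>c\<in>cells_ge k. if c = (S, T) then cell (fst c) (snd c) x y else 0)"
      by (rule sum.cong) auto
    then show ?thesis using c by (simp add: cells_ge_def)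
  qed
  then show ?thesis
    unfolding in_span_def by (intro exI[of _ "\<lambda>c. of_bool (c = (S, T))"] ballI) (simp only:)
qed

text \<open>By associativity a factorisation of \<open>g\<close> through a heavier
  \<open>\<nu>'\<close> becomes one of the whole product, to which \<open>IH\<close> applies.
  \<open>IH\<close> is a premise so that the lemma serves inside the induction of
  \<open>in_span_kmult\<close> and also afterwards, with that lemma in its place.\<close>

lemma kmult_high:
  assumes "high \<nu> g" "invariant h"
    and IH: "\<And>\<nu>' g h. weight \<nu> < weight \<nu>' \<Longrightarrow> invariant g \<Longrightarrow> invariant h \<Longrightarrow> in_span (weight \<nu>') (kmult \<nu>' g h)"
  shows "in_span (Suc (weight \<nu>)) (kmult \<nu> g h)"
  using assms(1)
proof induction
  case (high_kmult \<nu>' g k)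
  have "in_span (weight \<nu>') (kmult \<nu>' g (kmult \<nu> k h))"
    by (intro IH invariant_kmult high_kmult assms(2))
  then have "in_span (weight \<nu>') (kmult \<nu> (kmult \<nu>' g k) h)"
    by (rule in_span_cong) (rule kmult_assoc)
  then show ?case by (rule in_span_mono) (use high_kmult in simp)
next
  case high_zero
  show ?case by (rule in_span_cong[OF in_span_zero]) (simp add: kmult_def)
next
  case (high_add g g')
  show ?case
    by (rule in_span_cong[OF in_span_add[OF high_add.IH]]) (simp add: kmult_def algebra_simps sum.distrib)
next
  case (high_scale g c)
  show ?case
    by (rule in_span_cong[OF in_span_scale[OF high_scale.IH, of c]])
      (simp add: kmult_def algebra_simps sum_distrib_left)
next
  case (high_cong g g')
  show ?case
    by (rule in_span_cong[OF high_cong.IH]) (simp add: kmult_def high_cong.hyps(2))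
qed

text \<open>Induction from heavy to light contents. Both factors are straightened; the tableau parts
  multiply to cells, and each remainder factors through a heavier content.\<close>

lemma in_span_kmult:
  assumes "invariant g" "invariant h"
  shows "in_span (weight \<nu>) (kmult \<nu> g h)"
  using assms
proof (induction "card P * 3 ^ card P - weight \<nu>" arbitrary: \<nu> g h rule: less_induct)
  case less
  have IH: "in_span (weight \<nu>') (kmult \<nu>' g h)"
    if "weight \<nu> < weight \<nu>'" "invariant g" "invariant h" for \<nu>' g h
  proof (cases "words_of \<nu>' = {}")
    \<comment> \<open>The weight is bounded only for contents of actual words. Without such words
      the product is an empty sum.\<close>
    case True
    then show ?thesis by (intro in_span_cong[OF in_span_zero]) (simp add: kmult_def)
  next
    case False
    then show ?thesis using less.hyps[of \<nu>' g h] weight_bound[OF False] that by simp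
  qed
  \<comment> \<open>Renaming the rows by decreasing length changes neither the product nor the
    weight.\<close>
  obtain f where f: "inj_on f (set_mset \<nu>)"
    and anti: "\<And>j. count (image_mset f \<nu>) (Suc j) \<le> count (image_mset f \<nu>) j"
    using sort_multiplicities by blast
  define \<nu>' where "\<nu>' = image_mset f \<nu>"
  have w: "weight \<nu>' = weight \<nu>" unfolding \<nu>'_def by (rule weight_image_mset[OF f])
  define g' where "g' = (\<lambda>x \<rho>. g x (relabel (inv_into (set_mset \<nu>) f) \<rho>))"
  define h' where "h' = (\<lambda>\<rho> y. h (relabel (inv_into (set_mset \<nu>) f) \<rho>) y)"
  have inv: "invariant g'" "invariant h'"
    using less.prems by (auto simp: g'_def h'_def invariant_def relabel_comp)
  have IH': "in_span (weight \<mu>) (kmult \<mu> g h)"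
    if "weight \<nu>' < weight \<mu>" "invariant g" "invariant h" for \<mu> g h
    using IH that w by simp
  obtain r where r: "high \<nu>' (\<lambda>x \<rho>. g' x \<rho> - (\<Sum>S\<in>tableaux \<nu>'. r S * ind S x \<rho>))"
    using straight_invariant[OF anti[folded \<nu>'_def] inv(1)] unfolding straight_def by blast
  obtain s where s: "high \<nu>' (\<lambda>y \<rho>. h' \<rho> y - (\<Sum>T\<in>tableaux \<nu>'. s T * ind T y \<rho>))"
    using straight_invariant[OF anti[folded \<nu>'_def] invariant_transpose[OF inv(2)]]
    unfolding straight_def by blast
  let ?g1 = "\<lambda>x \<rho>. \<Sum>S\<in>tableaux \<nu>'. r S * ind S x \<rho>" and ?h1 = "\<lambda>\<rho> y. \<Sum>T\<in>tableaux \<nu>'. s T * ind T y \<rho>"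
  have inv1: "invariant ?g1"
    unfolding invariant_def using invariantD[OF invariant_ind] by simp
  have 1: "in_span (weight \<nu>') (kmult \<nu>' (\<lambda>x \<rho>. g' x \<rho> - ?g1 x \<rho>) h')"
    by (rule in_span_mono[OF kmult_high[OF r inv(2) IH']]) auto
  \<comment> \<open>The remainder of the right factor is treated in the transposed product. Its
    partner is the tableau part \<open>?g1\<close> and not \<open>g'\<close>, so that the three
    terms add up to the product exactly.\<close>
  have "in_span (weight \<nu>') (kmult \<nu>' (\<lambda>y \<rho>. h' \<rho> y - ?h1 \<rho> y) (\<lambda>\<rho> x. ?g1 x \<rho>))"
    by (rule in_span_mono[OF kmult_high[OF s invariant_transpose[OF inv1] IH']]) auto
  then have 2: "in_span (weight \<nu>') (\<lambda>x y. kmult \<nu>' (\<lambda>y \<rho>. h' \<rho> y - ?h1 \<rho> y) (\<lambda>\<rho> x. ?g1 x \<rho>) y x)"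
    by (rule in_span_transpose)
  have 3: "in_span (weight \<nu>') (\<lambda>x y. \<Sum>S\<in>tableaux \<nu>'. \<Sum>T\<in>tableaux \<nu>'. (r S * s T) * cell S T x y)"
    by (intro in_span_sum in_span_scale in_span_cell finite_tableaux)
      (auto simp: cells_def shapes_def dest: shape_tableaux)
  have "kmult \<nu> g h x y = kmult \<nu>' (\<lambda>x \<rho>. g' x \<rho> - ?g1 x \<rho>) h' x y
      + (kmult \<nu>' (\<lambda>y \<rho>. h' \<rho> y - ?h1 \<rho> y) (\<lambda>\<rho> x. ?g1 x \<rho>) y x
      + (\<Sum>S\<in>tableaux \<nu>'. \<Sum>T\<in>tableaux \<nu>'. (r S * s T) * cell S T x y))" for x y
  proof -
    have "(\<Sum>S\<in>tableaux \<nu>'. \<Sum>T\<in>tableaux \<nu>'. (r S * s T) * cell S T x y)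
      = (\<Sum>S\<in>tableaux \<nu>'. \<Sum>T\<in>tableaux \<nu>'. \<Sum>\<rho>\<in>words_of \<nu>'. (r S * ind S x \<rho>) * (s T * ind T y \<rho>))"
      by (intro sum.cong refl)
        (simp add: shape_tableaux[where \<nu> = \<nu>'] cell_def kmult_def sum_distrib_left algebra_simps)
    also have "\<dots> = (\<Sum>S\<in>tableaux \<nu>'. \<Sum>\<rho>\<in>words_of \<nu>'. \<Sum>T\<in>tableaux \<nu>'. (r S * ind S x \<rho>) * (s T * ind T y \<rho>))"
      by (intro sum.cong refl sum.swap)
    also have "\<dots> = (\<Sum>\<rho>\<in>words_of \<nu>'. \<Sum>S\<in>tableaux \<nu>'. \<Sum>T\<in>tableaux \<nu>'. (r S * ind S x \<rho>) * (s T * ind T y \<rho>))"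
      by (rule sum.swap)
    also have "\<dots> = (\<Sum>\<rho>\<in>words_of \<nu>'. ?g1 x \<rho> * ?h1 \<rho> y)"
      by (simp add: sum_product)
    finally have "kmult \<nu>' (\<lambda>x \<rho>. g' x \<rho> - ?g1 x \<rho>) h' x y
      + (kmult \<nu>' (\<lambda>y \<rho>. h' \<rho> y - ?h1 \<rho> y) (\<lambda>\<rho> x. ?g1 x \<rho>) y x
      + (\<Sum>S\<in>tableaux \<nu>'. \<Sum>T\<in>tableaux \<nu>'. (r S * s T) * cell S T x y)) = kmult \<nu>' g' h' x y"
      unfolding kmult_def by (simp only: sum.distrib[symmetric]) (intro sum.cong refl, simp add: algebra_simps)
    then show ?thesis using kmult_relabel[OF f, of g h x y] by (simp add: g'_def h'_def \<nu>'_def)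
  qed
  then have "in_span (weight \<nu>') (kmult \<nu> g h)"
    by (intro in_span_cong[OF in_span_add[OF 1 in_span_add[OF 2 3]]])
  then show ?case by (simp add: w)
qed

text \<open>\<open>K\<close> is split by the content of its first argument: inserting the identity
  kernel at content \<open>\<mu>\<close> is a factorisation through \<open>\<mu>\<close>.\<close>

lemma cells_span:
  assumes "invariant K"
  obtains a where "\<And>x y. x \<in> wset \<Longrightarrow> y \<in> wset \<Longrightarrow> K x y = (\<Sum>c\<in>cells. a c * cell (fst c) (snd c) x y)"
proof -
  have "in_span 0 (\<lambda>x y. \<Sum>\<mu>\<in>\<C>. kmult \<mu> (\<lambda>x \<rho>. of_bool (x = \<rho>)) K x y)"
  proof (rule in_span_sum)
    fix \<mu> assume "\<mu> \<in> \<C>"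
    have "invariant (\<lambda>x \<rho>. of_bool (x = \<rho>) :: int)"
      unfolding invariant_def
    proof (intro allI impI)
      fix \<sigma> and x \<rho> :: "nat \<Rightarrow> nat" assume \<sigma>: "\<sigma> permutes P"
      have "x \<circ> \<sigma> = \<rho> \<circ> \<sigma> \<longleftrightarrow> x = \<rho>"
        using permutes_surj[OF \<sigma>] by (metis (no_types, lifting) comp_apply ext surjD)
      then show "of_bool (x \<circ> \<sigma> = \<rho> \<circ> \<sigma>) = (of_bool (x = \<rho>) :: int)" by simp
    qed
    from in_span_kmult[OF this assms, of \<mu>]
    show "in_span 0 (kmult \<mu> (\<lambda>x \<rho>. of_bool (x = \<rho>)) K)" by (rule in_span_mono) simp
  qed simp
  then have "in_span 0 K"
  proof (rule in_span_cong)
    fix x y assume x: "x \<in> wset"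
    have "kmult \<mu> (\<lambda>x \<rho>. of_bool (x = \<rho>)) K x y = (if content x = \<mu> then K x y else 0)" for \<mu>
    proof -
      have "kmult \<mu> (\<lambda>x \<rho>. of_bool (x = \<rho>)) K x y = (\<Sum>\<rho>\<in>words_of \<mu>. if x = \<rho> then K x y else 0)"
        unfolding kmult_def by (rule sum.cong) auto
      moreover have "x \<in> words_of \<mu> \<longleftrightarrow> content x = \<mu>" using x by (simp add: wset_def words_of_def)
      ultimately show ?thesis by simp
    qed
    then show "K x y = (\<Sum>\<mu>\<in>\<C>. kmult \<mu> (\<lambda>x \<rho>. of_bool (x = \<rho>)) K x y)"
      using x by (simp add: wset_def)
  qed
  then show ?thesis using that unfolding in_span_def by (auto simp: cells_ge_def)
qed

text \<open>Condition (C3) over the integers. Only the left factor of \<open>cell S T\<close> meets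
  \<open>K\<close>, so only \<open>?KS S\<close> is straightened, and the coefficients
  \<open>r\<close> cannot depend on \<open>T\<close>. The remainder is heavier by
  \<open>kmult_high\<close>.\<close>

lemma cell_mult:
  assumes "invariant K"
  obtains r a where "\<And>S T x y. \<lbrakk>S \<in> tableaux \<nu>; T \<in> tableaux \<nu>; x \<in> wset; y \<in> wset\<rbrakk> \<Longrightarrow>
    (\<Sum>z\<in>wset. K x z * cell S T z y) = (\<Sum>S'\<in>tableaux \<nu>. r S' S * cell S' T x y)
      + (\<Sum>c\<in>cells_ge (Suc (weight \<nu>)). a S T c * cell (fst c) (snd c) x y)"
proof (cases "tableaux \<nu> = {}")
  case False
  then obtain S0 where "S0 \<in> tableaux \<nu>" by blast
  note anti = antitone_tableau[OF this]
  let ?KS = "\<lambda>S x \<rho>. \<Sum>z\<in>wset. K x z * ind S z \<rho>"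
  have inv: "invariant (?KS S)" for S
    unfolding invariant_def
  proof (intro allI impI)
    fix \<sigma> x \<rho> assume \<sigma>: "\<sigma> permutes P"
    have "?KS S (x \<circ> \<sigma>) (\<rho> \<circ> \<sigma>) = (\<Sum>z\<in>wset. K (x \<circ> \<sigma>) (z \<circ> \<sigma>) * ind S (z \<circ> \<sigma>) (\<rho> \<circ> \<sigma>))"
    proof (rule sum.reindex_bij_witness[where j = "\<lambda>z. z \<circ> inv_into UNIV \<sigma>" and i = "\<lambda>z. z \<circ> \<sigma>"])
      fix z assume z: "z \<in> wset"
      show 1: "z \<circ> inv_into UNIV \<sigma> \<circ> \<sigma> = z" "z \<circ> \<sigma> \<circ> inv_into UNIV \<sigma> = z"
        using permutes_inv_o[OF \<sigma>] by (simp_all add: o_assoc[symmetric])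
      show "z \<circ> inv_into UNIV \<sigma> \<in> wset" "z \<circ> \<sigma> \<in> wset" using z wset_comp \<sigma> permutes_inv[OF \<sigma>] by auto
      show "K (x \<circ> \<sigma>) (z \<circ> inv_into UNIV \<sigma> \<circ> \<sigma>) * ind S (z \<circ> inv_into UNIV \<sigma> \<circ> \<sigma>) (\<rho> \<circ> \<sigma>) = K (x \<circ> \<sigma>) z * ind S z (\<rho> \<circ> \<sigma>)"
        unfolding 1 ..
    qed
    then show "?KS S (x \<circ> \<sigma>) (\<rho> \<circ> \<sigma>) = ?KS S x \<rho>"
      using invariantD[OF assms \<sigma>] invariantD[OF invariant_ind \<sigma>] by simp
  qed
  define r where "r S = (SOME r. high \<nu> (\<lambda>x \<rho>. ?KS S x \<rho> - (\<Sum>S'\<in>tableaux \<nu>. r S' * ind S' x \<rho>)))" for S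
  have r: "high \<nu> (\<lambda>x \<rho>. ?KS S x \<rho> - (\<Sum>S'\<in>tableaux \<nu>. r S S' * ind S' x \<rho>))" for S
    using someI_ex[OF straight_invariant[OF anti inv, unfolded straight_def], of S] unfolding r_def .
  let ?L = "\<lambda>S T. kmult \<nu> (\<lambda>x \<rho>. ?KS S x \<rho> - (\<Sum>S'\<in>tableaux \<nu>. r S S' * ind S' x \<rho>)) (\<lambda>\<rho> y. ind T y \<rho>)"
  have L: "in_span (Suc (weight \<nu>)) (?L S T)" for S T
    by (rule kmult_high[OF r invariant_transpose[OF invariant_ind]]) (rule in_span_kmult)
  define a where "a S T = (SOME a. \<forall>x\<in>wset. \<forall>y\<in>wset.
      ?L S T x y = (\<Sum>c\<in>cells_ge (Suc (weight \<nu>)). a c * cell (fst c) (snd c) x y))" for S T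
  have a: "?L S T x y = (\<Sum>c\<in>cells_ge (Suc (weight \<nu>)). a S T c * cell (fst c) (snd c) x y)"
    if "x \<in> wset" "y \<in> wset" for S T x y
    using someI_ex[OF L[unfolded in_span_def], of S T] that unfolding a_def by blast
  show ?thesis
  proof (rule that[of "\<lambda>S' S. r S S'" a])
    fix S T x y assume ST: "S \<in> tableaux \<nu>" "T \<in> tableaux \<nu>" and xy: "x \<in> wset" "y \<in> wset"
    have "(\<Sum>z\<in>wset. K x z * cell S T z y) = (\<Sum>\<rho>\<in>words_of \<nu>. ?KS S x \<rho> * ind T y \<rho>)"
      unfolding cell_def kmult_def shape_tableaux[OF ST(1)] sum_distrib_left sum_distrib_right mult.assoc
      by (rule sum.swap)
    moreover have "(\<Sum>S'\<in>tableaux \<nu>. r S S' * cell S' T x y)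
        = (\<Sum>\<rho>\<in>words_of \<nu>. (\<Sum>S'\<in>tableaux \<nu>. r S S' * ind S' x \<rho>) * ind T y \<rho>)"
    proof -
      have "(\<Sum>S'\<in>tableaux \<nu>. r S S' * cell S' T x y)
        = (\<Sum>S'\<in>tableaux \<nu>. \<Sum>\<rho>\<in>words_of \<nu>. r S S' * ind S' x \<rho> * ind T y \<rho>)"
        by (intro sum.cong refl) (simp add: shape_tableaux[where \<nu> = \<nu>] cell_def kmult_def sum_distrib_left mult.assoc)
      also have "\<dots> = (\<Sum>\<rho>\<in>words_of \<nu>. \<Sum>S'\<in>tableaux \<nu>. r S S' * ind S' x \<rho> * ind T y \<rho>)"
        by (rule sum.swap)
      finally show ?thesis by (simp add: sum_distrib_right)
    qed
    ultimately show "(\<Sum>z\<in>wset. K x z * cell S T z y) = (\<Sum>S'\<in>tableaux \<nu>. r S S' * cell S' T x y)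
      + (\<Sum>c\<in>cells_ge (Suc (weight \<nu>)). a S T c * cell (fst c) (snd c) x y)"
      unfolding a[OF xy, symmetric] kmult_def by (simp add: algebra_simps sum_subtractf)
  qed
qed (use that in auto)

end

section \<open>Linear independence\<close>

text \<open>The elements of \<open>A\<close> outside \<open>{..<card A}\<close> are at least
  \<open>card A\<close>, the numbers missing from \<open>A\<close> are smaller, and there are
  equally many of both.\<close>

lemma sum_nat_set_ge:
  fixes A :: "nat set"
  assumes "finite A"
  shows "\<Sum>{..<card A} \<le> \<Sum>A" and "\<Sum>{..<card A} = \<Sum>A \<Longrightarrow> A = {..<card A}"
proof -
  define k where "k = card A"
  let ?I = "{..<k}"
  have c: "card (A - ?I) = card (?I - A)"
    using assms card_Int_Diff[of A ?I] card_Int_Diff[of ?I A] by (simp add: k_def Int_commute)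
  have A: "\<Sum>A = \<Sum>(A \<inter> ?I) + \<Sum>(A - ?I)" using assms by (rule sum.Int_Diff)
  have I: "\<Sum>?I = \<Sum>(A \<inter> ?I) + \<Sum>(?I - A)" using sum.Int_Diff[of ?I "\<lambda>i. i" A] by (simp add: Int_commute)
  have ge: "card (A - ?I) * k \<le> \<Sum>(A - ?I)" using sum_bounded_below[of "A - ?I" k "\<lambda>i. i"] by auto
  have le: "\<Sum>(?I - A) \<le> card (?I - A) * k" using sum_bounded_above[of "?I - A" "\<lambda>i. i" k] by auto
  show "\<Sum>{..<card A} \<le> \<Sum>A" using ge le A I c unfolding k_def[symmetric] by simp
  assume eq: "\<Sum>{..<card A} = \<Sum>A"
  have "?I - A = {}"
  proof (rule ccontr)
    assume ne: "?I - A \<noteq> {}"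
    have "\<Sum>(?I - A) < (\<Sum>i\<in>?I - A. k)" by (rule sum_strict_mono) (use ne in auto)
    then show False using eq ge A I c unfolding k_def[symmetric] by simp
  qed
  then have "card (A - ?I) = 0" unfolding c by (simp only: card.empty)
  then have "A - ?I = {}" using assms by (simp only: card_0_eq[OF finite_Diff])
  then show "A = {..<card A}" using \<open>?I - A = {}\<close> unfolding k_def[symmetric] by blast
qed

lemma downward_closed_nat_set:
  fixes A :: "nat set"
  assumes "finite A" "\<And>i j. i \<in> A \<Longrightarrow> j < i \<Longrightarrow> j \<in> A"
  shows "A = {..<card A}"
proof (rule card_subset_eq)
  show "A \<subseteq> {..<card A}"
  proof
    fix i assume "i \<in> A"
    then have "{..i} \<subseteq> A" using assms(2) by (auto simp: le_less)
    then have "card {..i} \<le> card A" by (rule card_mono[OF assms(1)])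
    then show "i \<in> {..<card A}" by simp
  qed
qed simp_all

section \<open>The column group of a diagram and its antisymmetriser\<close>

locale diagram = position_set +
  fixes row col :: "nat \<Rightarrow> nat"
  assumes inj_box: "\<lbrakk>p \<in> P; q \<in> P; row p = row q; col p = col q\<rbrakk> \<Longrightarrow> p = q"
    and above_box: "\<lbrakk>p \<in> P; j < row p\<rbrakk> \<Longrightarrow> \<exists>q\<in>P. row q = j \<and> col q = col p"
begin

text \<open>The boxes are the places \<open>P\<close> themselves, so column permutations act on
  words as place permutations and the invariance of kernels applies to them.\<close>

definition Col :: "(nat \<Rightarrow> nat) set" where
  "Col = {\<sigma>. \<sigma> permutes P \<and> col \<circ> \<sigma> = col}"

lemma finite_Col [simp, intro]: "finite Col"
  by (rule finite_subset[OF _ finite_permutations[OF finite_P]]) (auto simp: Col_def)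

lemma Col_permutes: "\<sigma> \<in> Col \<Longrightarrow> \<sigma> permutes P"
  by (simp add: Col_def)

lemma Col_col: "\<sigma> \<in> Col \<Longrightarrow> col (\<sigma> p) = col p"
  by (auto simp: Col_def fun_eq_iff)

lemma id_Col: "id \<in> Col"
  by (simp add: Col_def permutes_id)

lemma Col_comp: "\<sigma> \<in> Col \<Longrightarrow> \<tau> \<in> Col \<Longrightarrow> \<sigma> \<circ> \<tau> \<in> Col"
  by (auto simp: Col_def permutes_compose fun_eq_iff)

lemma Col_inv: "\<sigma> \<in> Col \<Longrightarrow> inv_into UNIV \<sigma> \<in> Col"
proof -
  assume s: "\<sigma> \<in> Col"
  have "col (inv_into UNIV \<sigma> p) = col p" for p
    using Col_col[OF s, of "inv_into UNIV \<sigma> p"] permutes_inverses(1)[OF Col_permutes[OF s]] by simp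
  then show ?thesis using permutes_inv[OF Col_permutes[OF s]] by (simp add: Col_def fun_eq_iff)
qed

lemma Col_transpose: "\<lbrakk>p \<in> P; q \<in> P; col p = col q\<rbrakk> \<Longrightarrow> Transposition.transpose p q \<in> Col"
  by (simp add: Col_def permutes_swap_id fun_eq_iff transpose_def)

definition column_strict :: "(nat \<Rightarrow> nat) \<Rightarrow> bool" where
  "column_strict x \<longleftrightarrow> (\<forall>p\<in>P. \<forall>q\<in>P. col p = col q \<longrightarrow> row p < row q \<longrightarrow> x p < x q)"

text \<open>Among the moved boxes, let \<open>p\<close> have the least row number, and let
  \<open>q\<close> be the box that is sent to \<open>p\<close>. Then \<open>q\<close> and the image
  of \<open>p\<close> lie in the column of \<open>p\<close>, both in rows of greater number.\<close>

lemma Col_inversion: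
  assumes "\<sigma> \<in> Col" "\<sigma> \<noteq> id"
  obtains p q where "p \<in> P" "q \<in> P" "col p = col q" "row p < row q" "row (\<sigma> q) < row (\<sigma> p)"
proof -
  note perm = Col_permutes[OF assms(1)]
  obtain p0 where "p0 \<in> P \<and> \<sigma> p0 \<noteq> p0" using assms(2) perm by (metis eq_id_iff permutes_not_in)
  from ex_has_least_nat[of "\<lambda>p. p \<in> P \<and> \<sigma> p \<noteq> p", OF this, of row]
  obtain p where p: "p \<in> P" "\<sigma> p \<noteq> p" and min: "\<And>q. q \<in> P \<Longrightarrow> \<sigma> q \<noteq> q \<Longrightarrow> row p \<le> row q"
    by blast
  define q where "q = inv_into UNIV \<sigma> p"
  have q: "q \<in> P" "\<sigma> q = p"
    using perm p permutes_inverses[OF perm] permutes_in_image[OF permutes_inv[OF perm]] by (auto simp: q_def)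
  have qp: "q \<noteq> p" using q(2) p(2) by auto
  have colq: "col p = col q" using Col_col[OF assms(1), of q] q by simp
  have "row p \<le> row q" using min[OF q(1)] q qp by auto
  moreover have "row p \<noteq> row q" using inj_box[OF p(1) q(1)] colq qp by auto
  ultimately have pq: "row p < row q" by simp
  have sp: "\<sigma> p \<in> P" using perm p by (simp add: permutes_in_image)
  have "\<sigma> (\<sigma> p) \<noteq> \<sigma> p" using p(2) permutes_inj[OF perm] by (auto dest: injD)
  then have "row p \<le> row (\<sigma> p)" using min[OF sp] by blast
  moreover have "row p \<noteq> row (\<sigma> p)" using inj_box[OF p(1) sp] Col_col[OF assms(1), of p] p by auto
  ultimately show ?thesis using that[OF p(1) q(1) colq pq] q by simp
qed

text \<open>Undoing an inversion strictly increases the sum, so the identity is its only maximum.\<close>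

lemma column_strict_rearrange:
  assumes "column_strict x" "\<sigma> \<in> Col"
  shows "(\<Sum>p\<in>P. x (\<sigma> p) * row p) \<le> (\<Sum>p\<in>P. x p * row p)"
    and "(\<Sum>p\<in>P. x (\<sigma> p) * row p) = (\<Sum>p\<in>P. x p * row p) \<Longrightarrow> \<sigma> = id"
proof -
  define g where "g \<sigma> = (\<Sum>p\<in>P. x (\<sigma> p) * row p)" for \<sigma>
  have better: "\<exists>\<tau>\<in>Col. g \<sigma> < g \<tau>" if \<sigma>: "\<sigma> \<in> Col" "\<sigma> \<noteq> id" for \<sigma>
  proof -
    obtain p q where pq: "p \<in> P" "q \<in> P" "col p = col q" "row p < row q" "row (\<sigma> q) < row (\<sigma> p)"
      using Col_inversion[OF \<sigma>] by blast
    let ?t = "Transposition.transpose p q"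
    have "p \<noteq> q" using pq by auto
    have sP: "\<sigma> p \<in> P" "\<sigma> q \<in> P" using pq Col_permutes[OF \<sigma>(1)] by (simp_all add: permutes_in_image)
    have lt: "x (\<sigma> q) < x (\<sigma> p)"
      using assms(1) sP pq Col_col[OF \<sigma>(1)] unfolding column_strict_def by metis
    have split: "g \<tau> = x (\<tau> p) * row p + x (\<tau> q) * row q + (\<Sum>p\<in>P - {p, q}. x (\<tau> p) * row p)" for \<tau>
      unfolding g_def using pq \<open>p \<noteq> q\<close> by (simp add: sum.remove[of P p] sum.remove[of "P - {p}" q] Diff_insert2[symmetric] insert_commute)
    have rest: "(\<Sum>r\<in>P - {p, q}. x ((\<sigma> \<circ> ?t) r) * row r) = (\<Sum>r\<in>P - {p, q}. x (\<sigma> r) * row r)"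
      by (rule sum.cong) (auto simp: transpose_def)
    \<comment> \<open>The rearrangement inequality for two terms; the additive difference
      \<open>d\<close> avoids truncated subtraction.\<close>
    obtain d where d: "d > 0" "x (\<sigma> q) + d = x (\<sigma> p)" using less_imp_add_positive[OF lt] by blast
    have "d * row p < d * row q" using pq(4) d(1) by simp
    then have "x (\<sigma> p) * row p + x (\<sigma> q) * row q < x (\<sigma> q) * row p + x (\<sigma> p) * row q"
      unfolding d(2)[symmetric] by (simp add: algebra_simps)
    then have "g \<sigma> < g (\<sigma> \<circ> ?t)"
      unfolding split[of \<sigma>] split[of "\<sigma> \<circ> ?t"] rest by simp
    then show ?thesis using Col_comp[OF \<sigma>(1) Col_transpose[OF pq(1-3)]] by blast
  qed
  have "Col \<noteq> {}" using id_Col by blast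
  then have "Max (g ` Col) \<in> g ` Col" by (intro Max_in) auto
  then obtain \<sigma>0 where \<sigma>0: "\<sigma>0 \<in> Col" "Max (g ` Col) = g \<sigma>0" by blast
  then have max: "g \<tau> \<le> g \<sigma>0" if "\<tau> \<in> Col" for \<tau> using Max_ge[of "g ` Col" "g \<tau>"] that by simp
  then have "\<sigma>0 = id" using better[OF \<sigma>0(1)] leD by blast
  then have max': "g \<tau> \<le> g id" if "\<tau> \<in> Col" for \<tau> using max that by simp
  then show "(\<Sum>p\<in>P. x (\<sigma> p) * row p) \<le> (\<Sum>p\<in>P. x p * row p)"
    using assms(2) by (simp add: g_def)
  assume eq: "(\<Sum>p\<in>P. x (\<sigma> p) * row p) = (\<Sum>p\<in>P. x p * row p)"
  show "\<sigma> = id"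
  proof (rule ccontr)
    assume "\<sigma> \<noteq> id"
    then obtain \<tau> where "\<tau> \<in> Col" "g \<sigma> < g \<tau>" using better assms(2) by blast
    then show False using max' eq by (fastforce simp: g_def)
  qed
qed

text \<open>In a column of length \<open>l\<close> the row numbers are \<open>0\<close> to
  \<open>l - 1\<close>, which is the least possible sum of \<open>l\<close> distinct labels.
  Equality of the totals forces equality in every column, and there \<open>\<rho>\<close> is a
  rearrangement of \<open>row\<close>.\<close>

lemma column_injective_sum:
  assumes inj: "\<And>p q. \<lbrakk>p \<in> P; q \<in> P; \<rho> p = \<rho> q; col p = col q\<rbrakk> \<Longrightarrow> p = q"
  shows "(\<Sum>p\<in>P. row p) \<le> (\<Sum>p\<in>P. \<rho> p)"
    and "(\<Sum>p\<in>P. row p) = (\<Sum>p\<in>P. \<rho> p) \<Longrightarrow> \<exists>\<sigma>\<in>Col. \<forall>p\<in>P. \<rho> p = row (\<sigma> p)"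
proof -
  define Q where "Q c = {p \<in> P. col p = c}" for c
  have group: "(\<Sum>p\<in>P. f p) = (\<Sum>c\<in>col ` P. \<Sum>p\<in>Q c. f p)" for f :: "nat \<Rightarrow> nat"
    unfolding Q_def by (rule sum.image_gen[OF finite_P])
  have finQ: "finite (Q c)" for c by (simp add: Q_def)
  have injr: "inj_on row (Q c)" and inj\<rho>: "inj_on \<rho> (Q c)" for c
    using inj_box inj by (auto simp: Q_def intro!: inj_onI)
  have rowQ: "row ` Q c = {..<card (Q c)}" for c
  proof -
    have "row ` Q c = {..<card (row ` Q c)}"
    proof (rule downward_closed_nat_set)
      fix i j assume "i \<in> row ` Q c" "j < i"
      then obtain p where p: "p \<in> P" "col p = c" "j < row p" by (auto simp: Q_def)
      from above_box[OF p(1,3)] show "j \<in> row ` Q c" using p(2) by (auto simp: Q_def)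
    qed (simp add: finQ)
    then show ?thesis using card_image[OF injr] by simp
  qed
  have srow: "(\<Sum>p\<in>Q c. row p) = \<Sum>{..<card (\<rho> ` Q c)}" for c
    using sum.reindex[OF injr, of "\<lambda>i. i" c] card_image[OF inj\<rho>, of c] by (simp add: rowQ)
  have s\<rho>: "(\<Sum>p\<in>Q c. \<rho> p) = \<Sum>(\<rho> ` Q c)" for c
    using sum.reindex[OF inj\<rho>, of "\<lambda>i. i" c] by simp
  have le: "(\<Sum>p\<in>Q c. row p) \<le> (\<Sum>p\<in>Q c. \<rho> p)" for c
    unfolding srow s\<rho> by (rule sum_nat_set_ge(1)) (simp add: finQ)
  then show "(\<Sum>p\<in>P. row p) \<le> (\<Sum>p\<in>P. \<rho> p)" unfolding group by (rule sum_mono)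
  assume eq: "(\<Sum>p\<in>P. row p) = (\<Sum>p\<in>P. \<rho> p)"
  have img: "\<rho> ` Q c = row ` Q c" if "c \<in> col ` P" for c
  proof -
    have "(\<Sum>p\<in>Q c. row p) = (\<Sum>p\<in>Q c. \<rho> p)"
      using sum_mono_inv[OF eq[unfolded group], of c] le that by simp
    then have "\<rho> ` Q c = {..<card (\<rho> ` Q c)}"
      unfolding srow s\<rho> by (intro sum_nat_set_ge(2)) (simp_all add: finQ)
    then show ?thesis by (simp add: rowQ card_image[OF inj\<rho>])
  qed
  have "\<exists>q. q \<in> P \<and> col q = col p \<and> row q = \<rho> p" if "p \<in> P" for p
  proof -
    have "\<rho> p \<in> row ` Q (col p)" using img[of "col p"] that by (auto simp: Q_def)
    then show ?thesis by (auto simp: Q_def)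
  qed
  then obtain s where s: "s p \<in> P" "col (s p) = col p" "row (s p) = \<rho> p" if "p \<in> P" for p
    by metis
  define \<sigma> where "\<sigma> p = (if p \<in> P then s p else p)" for p
  have inj\<sigma>: "inj_on \<sigma> P"
  proof (rule inj_onI)
    fix p q assume pq: "p \<in> P" "q \<in> P" "\<sigma> p = \<sigma> q"
    then have "s p = s q" by (simp add: \<sigma>_def)
    then show "p = q" using inj[OF pq(1,2)] s[OF pq(1)] s[OF pq(2)] by simp
  qed
  have "\<sigma> ` P \<subseteq> P" using s by (auto simp: \<sigma>_def)
  then have "bij_betw \<sigma> P P" using inj\<sigma> endo_inj_surj[OF finite_P] by (blast intro: bij_betw_imageI)
  then have "\<sigma> permutes P" by (rule bij_imp_permutes) (simp add: \<sigma>_def)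
  then have "\<sigma> \<in> Col" using s by (auto simp: Col_def \<sigma>_def fun_eq_iff)
  then show "\<exists>\<sigma>\<in>Col. \<forall>p\<in>P. \<rho> p = row (\<sigma> p)"
    by (intro bexI[of _ \<sigma>] ballI) (simp_all add: \<sigma>_def s)
qed

text \<open>The column antisymmetriser, acting on the first argument, turned into a linear
  functional on kernels by evaluation at a fixed pair of words.\<close>

definition alternate :: "(nat \<Rightarrow> nat) \<Rightarrow> (nat \<Rightarrow> nat) \<Rightarrow> ((nat \<Rightarrow> nat) \<Rightarrow> (nat \<Rightarrow> nat) \<Rightarrow> int) \<Rightarrow> int" where
  "alternate x y K = (\<Sum>\<sigma>\<in>Col. sign \<sigma> * K (x \<circ> \<sigma>) y)"

text \<open>The transposition of two boxes with equal labels fixes \<open>\<rho>\<close>, hence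
  preserves the indicator, but reverses the sign. The sum equals its own negative, which over the
  integers makes it vanish.\<close>

lemma alternate_ind_eq_0:
  assumes p: "p \<in> P" "q \<in> P" "p \<noteq> q" "col p = col q" "\<rho> p = \<rho> q"
  shows "(\<Sum>\<sigma>\<in>Col. sign \<sigma> * ind S (x \<circ> \<sigma>) \<rho>) = 0"
proof -
  let ?t = "Transposition.transpose p q"
  have tC: "?t \<in> Col" using p by (intro Col_transpose)
  have tt: "\<sigma> \<circ> ?t \<circ> ?t = \<sigma>" for \<sigma> :: "nat \<Rightarrow> nat" by (simp add: fun_eq_iff)
  have \<rho>t: "\<rho> \<circ> ?t = \<rho>" using p(5) by (auto simp: fun_eq_iff transpose_def)
  have "(\<Sum>\<sigma>\<in>Col. sign \<sigma> * ind S (x \<circ> \<sigma>) \<rho>) = (\<Sum>\<sigma>\<in>Col. - (sign \<sigma> * ind S (x \<circ> \<sigma>) \<rho>))"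
  proof (rule sum.reindex_bij_witness[where i = "\<lambda>\<sigma>. \<sigma> \<circ> ?t" and j = "\<lambda>\<sigma>. \<sigma> \<circ> ?t"])
    fix \<sigma> assume \<sigma>: "\<sigma> \<in> Col"
    have "permutation \<sigma>" using Col_permutes[OF \<sigma>] finite_P permutation_permutes by blast
    then have "sign (\<sigma> \<circ> ?t) = - sign \<sigma>"
      using p(3) by (simp add: sign_compose permutation_swap_id sign_swap_id)
    moreover have "ind S (x \<circ> (\<sigma> \<circ> ?t)) \<rho> = ind S (x \<circ> \<sigma>) \<rho>"
      using invariantD[OF invariant_ind Col_permutes[OF tC], of S "x \<circ> \<sigma>" \<rho>] \<rho>t by (simp add: o_assoc)
    ultimately show "- (sign (\<sigma> \<circ> ?t) * ind S (x \<circ> (\<sigma> \<circ> ?t)) \<rho>) = sign \<sigma> * ind S (x \<circ> \<sigma>) \<rho>" by simp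
  qed (use tt Col_comp tC in auto)
  then show ?thesis by (simp add: sum_negf)
qed

text \<open>The fillings with a repeated label in some column cancel. Among the others the sum of the labels is
  minimal exactly for the column permutations of \<open>row\<close>, and of these the bound on the moments leaves
  only \<open>row\<close> itself.\<close>

lemma alternate_product:
  assumes x: "x \<in> words" "column_strict x" and y: "y \<in> words" "column_strict y" and row: "row \<in> words"
    and shape: "sum_mset (shape S) \<le> sum_mset (content row)"
    and small: "shape S = content row \<Longrightarrow>
      moment (joint x row) + moment (joint y row) \<le> moment S + moment T"
  shows "alternate x y (kmult (shape S) (ind S) (\<lambda>\<rho> y. ind T y \<rho>)) = of_bool (S = joint x row \<and> T = joint y row)"
proof -
  have sm: "sum_mset (content \<rho>) = (\<Sum>p\<in>P. \<rho> p)" for \<rho>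
    by (simp add: content_def sum_unfold_sum_mset)
  have "alternate x y (kmult (shape S) (ind S) (\<lambda>\<rho> y. ind T y \<rho>))
      = (\<Sum>\<sigma>\<in>Col. \<Sum>\<rho>\<in>words_of (shape S). sign \<sigma> * ind S (x \<circ> \<sigma>) \<rho> * ind T y \<rho>)"
    by (simp add: alternate_def kmult_def sum_distrib_left mult.assoc)
  also have "\<dots> = (\<Sum>\<rho>\<in>words_of (shape S). \<Sum>\<sigma>\<in>Col. sign \<sigma> * ind S (x \<circ> \<sigma>) \<rho> * ind T y \<rho>)"
    by (rule sum.swap)
  also have "\<dots> = (\<Sum>\<rho>\<in>words_of (shape S). if \<rho> = row then of_bool (S = joint x row \<and> T = joint y row) else 0)"
  proof (rule sum.cong[OF refl])
    fix \<rho> assume \<rho>: "\<rho> \<in> words_of (shape S)"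
    have key: "\<rho> = row \<and> \<sigma> = id \<and> S = joint x row \<and> T = joint y row"
      if inj: "\<And>p q. \<lbrakk>p \<in> P; q \<in> P; \<rho> p = \<rho> q; col p = col q\<rbrakk> \<Longrightarrow> p = q"
        and \<sigma>: "\<sigma> \<in> Col" and ST: "joint (x \<circ> \<sigma>) \<rho> = S" "joint y \<rho> = T" for \<sigma>
    proof -
      have "(\<Sum>p\<in>P. \<rho> p) \<le> (\<Sum>p\<in>P. row p)" using shape \<rho> by (simp add: sm[symmetric] words_of_def)
      moreover have "(\<Sum>p\<in>P. row p) \<le> (\<Sum>p\<in>P. \<rho> p)" by (rule column_injective_sum(1)) (rule inj)
      ultimately have eq: "(\<Sum>p\<in>P. row p) = (\<Sum>p\<in>P. \<rho> p)" by simp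
      have "\<exists>\<tau>\<in>Col. \<forall>p\<in>P. \<rho> p = row (\<tau> p)" by (rule column_injective_sum(2)[OF _ eq]) (rule inj)
      then obtain \<tau> where \<tau>: "\<tau> \<in> Col" "\<forall>p\<in>P. \<rho> p = row (\<tau> p)" by blast
      note p\<tau> = Col_permutes[OF \<tau>(1)] and p\<sigma> = Col_permutes[OF \<sigma>]
      have \<rho>\<tau>: "\<rho> = row \<circ> \<tau>"
        by (rule words_eqI) (use \<tau> \<rho> row p\<tau> words_comp in \<open>auto simp: words_of_def\<close>)
      have "shape S = content row" using \<rho> \<rho>\<tau> p\<tau> by (simp add: words_of_def)
      from small[OF this] have small': "moment (joint x row) + moment (joint y row) \<le> moment S + moment T" .
      have tinv: "\<tau> \<circ> inv_into UNIV \<tau> = id" using permutes_inv_o[OF p\<tau>] by simp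
      \<comment> \<open>Shifting all words by the inverse of \<open>\<tau>\<close> turns the filling
        into \<open>row\<close>. Then \<open>x\<close> and \<open>y\<close> are both rearranged by
        column permutations, which cannot increase their moments, and \<open>small'\<close> forces
        equality in both.\<close>
      have e1: "S = joint (x \<circ> (\<sigma> \<circ> inv_into UNIV \<tau>)) row"
        using joint_comp[OF permutes_inv[OF p\<tau>], of "x \<circ> \<sigma>" "row \<circ> \<tau>"] ST \<rho>\<tau> tinv
        by (simp add: o_assoc) (simp add: o_assoc[symmetric])
      have e2: "T = joint (y \<circ> inv_into UNIV \<tau>) row"
        using joint_comp[OF permutes_inv[OF p\<tau>], of y "row \<circ> \<tau>"] ST \<rho>\<tau> tinv by (simp add: o_assoc[symmetric])
      note c1 = Col_comp[OF \<sigma> Col_inv[OF \<tau>(1)]] and c2 = Col_inv[OF \<tau>(1)]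
      have m1: "moment S \<le> moment (joint x row)" "moment S = moment (joint x row) \<Longrightarrow> \<sigma> \<circ> inv_into UNIV \<tau> = id"
        using column_strict_rearrange[OF x(2) c1] by (simp_all add: e1 moment_joint)
      have m2: "moment T \<le> moment (joint y row)" "moment T = moment (joint y row) \<Longrightarrow> inv_into UNIV \<tau> = id"
        using column_strict_rearrange[OF y(2) c2] by (simp_all add: e2 moment_joint)
      have "inv_into UNIV \<tau> = id" "\<sigma> \<circ> inv_into UNIV \<tau> = id" using m1 m2 small' by auto
      then have "\<sigma> = id" "\<tau> = id" using tinv by simp_all
      then show ?thesis using \<rho>\<tau> ST by simp
    qed
    show "(\<Sum>\<sigma>\<in>Col. sign \<sigma> * ind S (x \<circ> \<sigma>) \<rho> * ind T y \<rho>)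
        = (if \<rho> = row then of_bool (S = joint x row \<and> T = joint y row) else 0)"
    proof (cases "\<exists>p\<in>P. \<exists>q\<in>P. p \<noteq> q \<and> \<rho> p = \<rho> q \<and> col p = col q")
      case True
      then obtain p q where "p \<in> P" "q \<in> P" "p \<noteq> q" "col p = col q" "\<rho> p = \<rho> q" by blast
      moreover from this have "\<rho> \<noteq> row" using inj_box by blast
      ultimately show ?thesis
        using alternate_ind_eq_0[of p q \<rho> S x] by (simp add: sum_distrib_right[symmetric])
    next
      case False
      then have inj: "\<And>p q. \<lbrakk>p \<in> P; q \<in> P; \<rho> p = \<rho> q; col p = col q\<rbrakk> \<Longrightarrow> p = q" by blast
      have "(\<Sum>\<sigma>\<in>Col. sign \<sigma> * ind S (x \<circ> \<sigma>) \<rho> * ind T y \<rho>)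
        = (\<Sum>\<sigma>\<in>Col. if \<sigma> = id then of_bool (\<rho> = row \<and> S = joint x row \<and> T = joint y row) else 0)"
      proof (rule sum.cong[OF refl])
        fix \<sigma> assume \<sigma>: "\<sigma> \<in> Col"
        show "sign \<sigma> * ind S (x \<circ> \<sigma>) \<rho> * ind T y \<rho>
          = (if \<sigma> = id then of_bool (\<rho> = row \<and> S = joint x row \<and> T = joint y row) else 0)"
        proof (cases "joint (x \<circ> \<sigma>) \<rho> = S \<and> joint y \<rho> = T")
          case True
          have "\<rho> = row \<and> \<sigma> = id \<and> S = joint x row \<and> T = joint y row"
            by (rule key[OF _ \<sigma>]) (erule (3) inj, use True in simp_all)
          then show ?thesis by (simp add: ind_def)
        next
          case False
          then show ?thesis by (auto simp: ind_def)
        qed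
      qed
      then show ?thesis using id_Col by simp
    qed
  qed
  also have "\<dots> = of_bool (S = joint x row \<and> T = joint y row)"
  proof -
    have "row \<in> words_of (shape S) \<longleftrightarrow> content row = shape S" using row by (simp add: words_of_def)
    then show ?thesis by auto
  qed
  finally show ?thesis .
qed

end

section \<open>Laying out tableaux on diagrams, and independence of the cells\<close>

context word_set
begin

text \<open>Each row is sorted by letters, ties being broken by the place, and \<open>col\<close> is
  the rank. The box coordinates are then a Young diagram, and semistandardness says that adjacent
  boxes of a column increase.\<close>

lemma tableau_filling:
  assumes "S \<in> tableaux \<nu>"
  obtains x row col where "x \<in> wset" "row \<in> words_of \<nu>" "joint x row = S"
    "inj_on (\<lambda>p. (row p, col p)) P" "(\<lambda>p. (row p, col p)) ` P = {(j, c). c < count \<nu> j}"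
    "\<And>p q. \<lbrakk>p \<in> P; q \<in> P; row q = Suc (row p); col p = col q\<rbrakk> \<Longrightarrow> x p < x q"
proof -
  obtain x row where x: "x \<in> wset" and row: "row \<in> words_of \<nu>" and S: "joint x row = S"
    and sst: "semistandard (joint x row)"
    using assms by (auto simp: tableaux_def)
  define prec where "prec q p \<longleftrightarrow> row q = row p \<and> (x q < x p \<or> x q = x p \<and> q < p)" for q p
  define col where "col p = card {q \<in> P. prec q p}" for p
  have lt: "col q < col p" if "prec q p" "q \<in> P" for p q
    unfolding col_def
  proof (rule psubset_card_mono)
    have "q \<in> {q \<in> P. prec q p}" "q \<notin> {r \<in> P. prec r q}" using that by (auto simp: prec_def)
    moreover have "{r \<in> P. prec r q} \<subseteq> {q \<in> P. prec q p}" using that by (auto simp: prec_def)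
    ultimately show "{r \<in> P. prec r q} \<subset> {q \<in> P. prec q p}" by blast
  qed simp
  have inj: "inj_on (\<lambda>p. (row p, col p)) P"
  proof (rule inj_onI, rule ccontr)
    fix p q assume pq: "p \<in> P" "q \<in> P" "(row p, col p) = (row q, col q)" "p \<noteq> q"
    then have "prec p q \<or> prec q p" by (auto simp: prec_def)
    then show False using lt[of p q] lt[of q p] pq by auto
  qed
  have c\<nu>: "content row = \<nu>" using row by (simp add: words_of_def)
  have bound: "col p < count \<nu> (row p)" if "p \<in> P" for p
    unfolding col_def c\<nu>[symmetric] count_content
  proof (rule psubset_card_mono)
    have "p \<in> {q \<in> P. row q = row p}" "p \<notin> {q \<in> P. prec q p}" using that by (auto simp: prec_def)
    moreover have "{q \<in> P. prec q p} \<subseteq> {q \<in> P. row q = row p}" by (auto simp: prec_def)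
    ultimately show "{q \<in> P. prec q p} \<subset> {q \<in> P. row q = row p}" by blast
  qed simp
  have sig: "{(j, c). c < count \<nu> j} = (SIGMA j:set_mset \<nu>. {..<count \<nu> j})"
    by (auto simp: count_greater_zero_iff[symmetric] simp del: count_greater_zero_iff)
  have "size \<nu> = card P" using c\<nu> by auto
  then have card: "card {(j, c). c < count \<nu> j} = card P" and fin: "finite {(j, c). c < count \<nu> j}"
    unfolding sig by (simp_all add: size_multiset_overloaded_eq)
  have img: "(\<lambda>p. (row p, col p)) ` P = {(j, c). c < count \<nu> j}"
    by (rule card_subset_eq[OF fin]) (use bound card card_image[OF inj] in auto)
  show ?thesis
  proof (rule that[OF x row S inj img])
    fix p q assume pq: "p \<in> P" "q \<in> P" "row q = Suc (row p)" "col p = col q"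
    show "x p < x q"
    proof (rule ccontr)
      assume n: "\<not> x p < x q"
      \<comment> \<open>If \<open>x q \<le> x p\<close>, then the \<open>Suc (col q)\<close> letters
        up to \<open>x q\<close> in the row of \<open>q\<close> require as many letters below
        \<open>x q\<close> in the row of \<open>p\<close>. All of these precede \<open>p\<close>, so
        there are at most \<open>col p = col q\<close> of them.\<close>
      have "insert q {r \<in> P. prec r q} \<subseteq> {r \<in> P. row r = Suc (row p) \<and> x r \<le> x q}"
        using pq by (auto simp: prec_def)
      then have "card (insert q {r \<in> P. prec r q}) \<le> card {r \<in> P. row r = Suc (row p) \<and> x r \<le> x q}"
        by (intro card_mono) auto
      moreover have "card (insert q {r \<in> P. prec r q}) = Suc (col q)"
        unfolding col_def by (rule card_insert_disjoint) (auto simp: prec_def)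
      moreover have "card {r \<in> P. row r = Suc (row p) \<and> x r \<le> x q} \<le> card {r \<in> P. row r = row p \<and> x r < x q}"
        using sst unfolding semistandard_joint by blast
      moreover have "card {r \<in> P. row r = row p \<and> x r < x q} \<le> col p"
        unfolding col_def by (rule card_mono) (use n in \<open>auto simp: prec_def\<close>)
      ultimately show False using pq(4) by simp
    qed
  qed
qed

text \<open>The two layouts fill the same set of coordinates, so a place permutation carries the
  second onto the first and both tableaux share one diagram.\<close>

lemma tableau_pair_filling:
  assumes "S \<in> tableaux \<nu>" "T \<in> tableaux \<nu>"
  obtains x y row col where "x \<in> wset" "y \<in> wset" "row \<in> words_of \<nu>" "joint x row = S" "joint y row = T"
    "diagram P row col" "diagram.column_strict P row col x" "diagram.column_strict P row col y"
proof -
  obtain x row col where x: "x \<in> wset" "row \<in> words_of \<nu>" "joint x row = S"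
    "inj_on (\<lambda>p. (row p, col p)) P" "(\<lambda>p. (row p, col p)) ` P = {(j, c). c < count \<nu> j}"
    "\<And>p q. \<lbrakk>p \<in> P; q \<in> P; row q = Suc (row p); col p = col q\<rbrakk> \<Longrightarrow> x p < x q"
    by (rule tableau_filling[OF assms(1)]) blast
  obtain y0 row' col' where y: "y0 \<in> wset" "row' \<in> words_of \<nu>" "joint y0 row' = T"
    "inj_on (\<lambda>p. (row' p, col' p)) P" "(\<lambda>p. (row' p, col' p)) ` P = {(j, c). c < count \<nu> j}"
    "\<And>p q. \<lbrakk>p \<in> P; q \<in> P; row' q = Suc (row' p); col' p = col' q\<rbrakk> \<Longrightarrow> y0 p < y0 q"
    by (rule tableau_filling[OF assms(2)]) blast
  have "image_mset (\<lambda>p. (row p, col p)) (mset_set P) = image_mset (\<lambda>p. (row' p, col' p)) (mset_set P)"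
    using x(4,5) y(4,5) by (simp add: image_mset_mset_set)
  then obtain \<pi> where \<pi>: "\<pi> permutes P" "\<forall>p\<in>P. (row p, col p) = (row' (\<pi> p), col' (\<pi> p))"
    using image_mset_eq_implies_permutes[OF finite_P] by blast
  have row: "row = row' \<circ> \<pi>"
    by (rule words_eqI) (use x(2) y(2) \<pi> words_comp in \<open>auto simp: words_of_def\<close>)
  have \<pi>P: "\<pi> p \<in> P" if "p \<in> P" for p using \<pi>(1) that by (simp add: permutes_in_image)
  define y1 where "y1 = y0 \<circ> \<pi>"
  have y1: "y1 \<in> wset" "joint y1 row = T" using y \<pi>(1) by (simp_all add: y1_def row wset_comp)
  have y1s: "y1 p < y1 q" if "p \<in> P" "q \<in> P" "row q = Suc (row p)" "col p = col q" for p q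
    using y(6)[of "\<pi> p" "\<pi> q"] \<pi>P that \<pi>(2) by (simp add: y1_def)
  interpret diagram P row col
  proof
    fix p q assume "p \<in> P" "q \<in> P" "row p = row q" "col p = col q"
    then show "p = q" using x(4) by (auto dest: inj_onD)
  next
    fix p j assume p: "p \<in> P" "j < row p"
    then have "(row p, col p) \<in> {(j, c). c < count \<nu> j}" using x(5) by blast
    then have "col p < count \<nu> (row p)" by simp
    also have "\<dots> \<le> count \<nu> j"
      using lift_Suc_antimono_le[of "count \<nu>" j "row p"] antitone_tableau[OF assms(1)] p(2) by simp
    finally have "(j, col p) \<in> (\<lambda>p. (row p, col p)) ` P" unfolding x(5) by simp
    then show "\<exists>q\<in>P. row q = j \<and> col q = col p" by auto
  qed
  \<comment> \<open>Strictness is known for adjacent rows; \<open>above_box\<close> supplies the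
    boxes in between.\<close>
  have strict: "column_strict z"
    if z: "\<And>p q. \<lbrakk>p \<in> P; q \<in> P; row q = Suc (row p); col p = col q\<rbrakk> \<Longrightarrow> z p < z q" for z
  proof -
    have "z p < z q" if "p \<in> P" "q \<in> P" "col p = col q" "row q = row p + Suc k" for p q k
      using that
    proof (induction k arbitrary: q)
      case 0
      then show ?case using z by simp
    next
      case (Suc k)
      then obtain r where r: "r \<in> P" "row r = row p + Suc k" "col r = col q"
        using above_box[of q "row p + Suc k"] by auto
      then have "z p < z r" using Suc by simp
      also have "z r < z q" using z[OF r(1)] Suc.prems r by simp
      finally show ?case .
    qed
    then show ?thesis
      unfolding column_strict_def by (metis add_Suc_right less_imp_Suc_add)
  qed
  show ?thesis
    by (rule that[OF x(1) y1(1) x(2,3) y1(2) diagram_axioms]) (intro strict x(6) y1s; assumption)+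
qed

text \<open>Among the cells with nonzero coefficient, one is chosen whose shape has the largest sum
  of row labels and then with the least total moment. On the diagram of this cell the functional
  \<open>alternate\<close> takes the value \<open>1\<close> there and vanishes on all other cells
  with nonzero coefficient.\<close>

lemma cells_independent:
  assumes zero: "\<And>x y. x \<in> wset \<Longrightarrow> y \<in> wset \<Longrightarrow> (\<Sum>c\<in>cells. a c * cell (fst c) (snd c) x y) = 0"
    and "c \<in> cells"
  shows "a c = 0"
proof (rule ccontr)
  assume nz: "a c \<noteq> 0"
  define A where "A = {c \<in> cells. a c \<noteq> 0}"
  \<comment> \<open>For a partition this is the statistic usually written
    \<open>n(\<lambda>)\<close>, the row lengths weighted by the row numbers counted from
    \<open>0\<close>.\<close>
  define h where "h c = sum_mset (shape (fst c))" for c :: "(nat \<times> nat) multiset \<times> (nat \<times> nat) multiset"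
  define f where "f c = moment (fst c) + moment (snd c)" for c
  have finA: "finite A" by (simp add: A_def)
  have neA: "A \<noteq> {}" using assms(2) nz A_def by blast
  define A' where "A' = {c \<in> A. h c = Max (h ` A)}"
  have "Max (h ` A) \<in> h ` A" using finA neA by (intro Max_in) auto
  then obtain c1 where "c1 \<in> A" "Max (h ` A) = h c1" by blast
  then have "c1 \<in> A'" by (simp add: A'_def)
  from ex_has_least_nat[of "\<lambda>c. c \<in> A'", OF this, of f]
  obtain c0 where c0: "c0 \<in> A'" and min: "\<And>c. c \<in> A' \<Longrightarrow> f c0 \<le> f c"
    by blast
  have max: "h c \<le> h c0" if "c \<in> A" for c
    using c0 that finA by (auto simp: A'_def)
  obtain S T where ST: "c0 = (S, T)" by force
  have c0A: "(S, T) \<in> A" using c0 ST by (auto simp: A'_def)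
  then have "S \<in> tableaux (shape S)" "T \<in> tableaux (shape S)" by (auto simp: A_def cells_iff)
  then obtain x y row col where x: "x \<in> wset" and y: "y \<in> wset" and row: "row \<in> words_of (shape S)"
    and j: "joint x row = S" "joint y row = T" and d: "diagram P row col"
    and s: "diagram.column_strict P row col x" "diagram.column_strict P row col y"
    using tableau_pair_filling by metis
  interpret diagram P row col by (rule d)
  have cr: "content row = shape S" "row \<in> words" using row by (simp_all add: words_of_def)
  have "alternate x y (\<lambda>x y. \<Sum>c\<in>cells. a c * cell (fst c) (snd c) x y) = 0"
    unfolding alternate_def using zero wset_comp[OF x] y Col_permutes by (intro sum.neutral) simp
  moreover have "alternate x y (\<lambda>x y. \<Sum>c\<in>cells. a c * cell (fst c) (snd c) x y)
      = (\<Sum>c\<in>cells. a c * alternate x y (cell (fst c) (snd c)))"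
    unfolding alternate_def sum_distrib_left by (subst sum.swap) (simp add: mult.left_commute)
  also have "\<dots> = (\<Sum>c\<in>cells. if c = (S, T) then a c else 0)"
  proof (rule sum.cong[OF refl])
    fix c assume c: "c \<in> cells"
    show "a c * alternate x y (cell (fst c) (snd c)) = (if c = (S, T) then a c else 0)"
    proof (cases "a c = 0")
      case False
      then have cA: "c \<in> A" using c by (simp add: A_def)
      have "alternate x y (cell (fst c) (snd c)) = of_bool (fst c = joint x row \<and> snd c = joint y row)"
        unfolding cell_def
      proof (rule alternate_product[OF wset_words[OF x] s(1) wset_words[OF y] s(2) cr(2)])
        show "sum_mset (shape (fst c)) \<le> sum_mset (content row)"
          using max[OF cA] by (simp add: h_def ST cr)
        assume "shape (fst c) = content row"
        then have "h c = h c0" by (simp add: h_def ST cr)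
        then have "c \<in> A'" using cA c0 by (simp add: A'_def)
        from min[OF this] show "moment (joint x row) + moment (joint y row) \<le> moment (fst c) + moment (snd c)"
          by (simp add: f_def ST j)
      qed
      then show ?thesis by (simp add: j prod_eq_iff)
    qed auto
  qed
  also have "\<dots> = a (S, T)" using c0A by (simp add: A_def)
  finally show False using c0A by (simp add: A_def)
qed

end

section \<open>Integral combinations and free bases\<close>

text \<open>The unique ring homomorphism from the integers.\<close>

definition ring_int :: "('a, 'm) ring_scheme \<Rightarrow> int \<Rightarrow> 'a" where
  "ring_int R k = add_pow R k \<one>\<^bsub>R\<^esub>"

text \<open>An \<open>R\<close>-combination of integral data. Identities between the data pass
  through it, which is how the integral results reach \<open>R\<close>.\<close>

definition int_comb :: "('a, 'm) ring_scheme \<Rightarrow> 'j set \<Rightarrow> ('j \<Rightarrow> 'a) \<Rightarrow> ('j \<Rightarrow> int) \<Rightarrow> 'a" where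
  "int_comb R J \<kappa> g = (\<Oplus>\<^bsub>R\<^esub>j\<in>J. \<kappa> j \<otimes>\<^bsub>R\<^esub> ring_int R (g j))"

context cring
begin

lemma ring_int_closed [simp, intro]: "ring_int R k \<in> carrier R"
  by (simp add: ring_int_def add.int_pow_closed)

lemma ring_int_add: "ring_int R (k + l) = ring_int R k \<oplus> ring_int R l"
  unfolding ring_int_def by (rule add.int_pow_mult) simp

lemma ring_int_mult: "ring_int R (k * l) = ring_int R k \<otimes> ring_int R l"
proof -
  have "ring_int R k \<otimes> ring_int R l = add_pow R k (ring_int R l)"
    by (simp add: ring_int_def[of R k] add_pow_ldistr_int)
  then show ?thesis by (simp add: ring_int_def add.int_pow_pow mult.commute)
qed

lemma ring_int_0 [simp]: "ring_int R 0 = \<zero>"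
  by (simp add: ring_int_def add_pow_int_ge)

lemma ring_int_1 [simp]: "ring_int R 1 = \<one>"
  by (simp add: ring_int_def add_pow_int_ge)

lemma int_comb_closed [simp, intro]: "\<kappa> \<in> J \<rightarrow> carrier R \<Longrightarrow> int_comb R J \<kappa> g \<in> carrier R"
  unfolding int_comb_def by (rule finsum_closed) auto

lemma int_comb_cong: "\<kappa> \<in> J \<rightarrow> carrier R \<Longrightarrow> (\<And>j. j \<in> J \<Longrightarrow> g j = h j) \<Longrightarrow> int_comb R J \<kappa> g = int_comb R J \<kappa> h"
  unfolding int_comb_def by (rule finsum_cong') auto

lemma int_comb_add:
  assumes "\<kappa> \<in> J \<rightarrow> carrier R"
  shows "int_comb R J \<kappa> (\<lambda>j. g j + h j) = int_comb R J \<kappa> g \<oplus> int_comb R J \<kappa> h"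
proof -
  have "int_comb R J \<kappa> (\<lambda>j. g j + h j)
      = (\<Oplus>j\<in>J. \<kappa> j \<otimes> ring_int R (g j) \<oplus> \<kappa> j \<otimes> ring_int R (h j))"
    unfolding int_comb_def by (rule finsum_cong') (use assms in \<open>auto simp: ring_int_add r_distr Pi_def\<close>)
  also have "\<dots> = int_comb R J \<kappa> g \<oplus> int_comb R J \<kappa> h"
    unfolding int_comb_def by (rule finsum_addf) (use assms in auto)
  finally show ?thesis .
qed

lemma int_comb_scale:
  assumes "finite J" "\<kappa> \<in> J \<rightarrow> carrier R"
  shows "int_comb R J \<kappa> (\<lambda>j. g j * n) = int_comb R J \<kappa> g \<otimes> ring_int R n"
proof -
  have "int_comb R J \<kappa> g \<otimes> ring_int R n = (\<Oplus>j\<in>J. \<kappa> j \<otimes> ring_int R (g j) \<otimes> ring_int R n)"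
    unfolding int_comb_def by (rule finsum_ldistr) (use assms in auto)
  also have "\<dots> = int_comb R J \<kappa> (\<lambda>j. g j * n)"
    unfolding int_comb_def by (rule finsum_cong') (use assms in \<open>auto simp: ring_int_mult m_assoc Pi_def\<close>)
  finally show ?thesis by simp
qed

lemma int_comb_zero: "\<kappa> \<in> J \<rightarrow> carrier R \<Longrightarrow> int_comb R J \<kappa> (\<lambda>j. 0) = \<zero>"
  unfolding int_comb_def by (rule finsum_all0) (auto simp: Pi_def)

text \<open>Moves an integral expansion from the data to the coefficients: if the data are rewritten
  in a new basis, the new coefficients are again values of \<open>int_comb\<close>.\<close>

lemma int_comb_sum:
  assumes "finite J" "\<kappa> \<in> J \<rightarrow> carrier R" "finite A"
  shows "int_comb R J \<kappa> (\<lambda>j. \<Sum>c\<in>A. g c j * n c) = (\<Oplus>c\<in>A. int_comb R J \<kappa> (g c) \<otimes> ring_int R (n c))"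
  using assms(3)
proof (induction A rule: finite_induct)
  case empty
  then show ?case using int_comb_zero[OF assms(2)] by simp
next
  case (insert c A)
  then have "int_comb R J \<kappa> (\<lambda>j. \<Sum>c\<in>insert c A. g c j * n c)
      = int_comb R J \<kappa> (\<lambda>j. g c j * n c + (\<Sum>c\<in>A. g c j * n c))"
    by simp
  also have "\<dots> = int_comb R J \<kappa> (g c) \<otimes> ring_int R (n c) \<oplus> (\<Oplus>c\<in>A. int_comb R J \<kappa> (g c) \<otimes> ring_int R (n c))"
    using insert.IH by (simp add: int_comb_add[OF assms(2)] int_comb_scale[OF assms(1,2)])
  also have "\<dots> = (\<Oplus>c\<in>insert c A. int_comb R J \<kappa> (g c) \<otimes> ring_int R (n c))"
    using insert.hyps assms(2) by (subst finsum_insert) auto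
  finally show ?case .
qed

lemma int_comb_single:
  assumes "finite J" "\<kappa> \<in> J \<rightarrow> carrier R" "i \<in> J"
  shows "int_comb R J \<kappa> (\<lambda>j. of_bool (j = i)) = \<kappa> i"
proof -
  have "int_comb R J \<kappa> (\<lambda>j. of_bool (j = i)) = (\<Oplus>j\<in>J. if i = j then \<kappa> j else \<zero>)"
    unfolding int_comb_def by (rule finsum_cong') (use assms in \<open>auto simp: Pi_def\<close>)
  also have "\<dots> = \<kappa> i" by (rule finsum_singleton) (use assms in auto)
  finally show ?thesis .
qed

end

section \<open>Coordinates and linear extension for a finite basis\<close>

locale free_basis = module R M for R (structure) and M (structure) +
  fixes I :: "'i set" and b :: "'i \<Rightarrow> 'c"
  assumes basis: "basis_family R M I b"
begin

lemma finite_index [simp, intro]: "finite I"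
  using basis by (simp add: basis_family_def)

lemma basis_closed [simp, intro]: "i \<in> I \<Longrightarrow> b i \<in> carrier M"
  using basis by (auto simp: basis_family_def)

definition coord :: "'c \<Rightarrow> 'i \<Rightarrow> 'a" where
  "coord v = (THE c. c \<in> I \<rightarrow>\<^sub>E carrier R \<and> v = (\<Oplus>\<^bsub>M\<^esub>i\<in>I. c i \<odot>\<^bsub>M\<^esub> b i))"

lemma ex1_coord: "v \<in> carrier M \<Longrightarrow> \<exists>!c. c \<in> I \<rightarrow>\<^sub>E carrier R \<and> v = (\<Oplus>\<^bsub>M\<^esub>i\<in>I. c i \<odot>\<^bsub>M\<^esub> b i)"
  using basis by (simp add: basis_family_def)

lemma coord_closed [simp, intro]: "v \<in> carrier M \<Longrightarrow> i \<in> I \<Longrightarrow> coord v i \<in> carrier R"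
  using theI'[OF ex1_coord, of v] unfolding coord_def by blast

lemma coord_expand: "v \<in> carrier M \<Longrightarrow> v = (\<Oplus>\<^bsub>M\<^esub>i\<in>I. coord v i \<odot>\<^bsub>M\<^esub> b i)"
  using theI'[OF ex1_coord, of v] unfolding coord_def by blast

lemma sum_closed [simp, intro]: "c \<in> I \<rightarrow> carrier R \<Longrightarrow> (\<Oplus>\<^bsub>M\<^esub>i\<in>I. c i \<odot>\<^bsub>M\<^esub> b i) \<in> carrier M"
  by (rule M.finsum_closed) (auto simp: Pi_def)

lemma coord_sum:
  assumes c: "c \<in> I \<rightarrow> carrier R" and i: "i \<in> I"
  shows "coord (\<Oplus>\<^bsub>M\<^esub>i\<in>I. c i \<odot>\<^bsub>M\<^esub> b i) i = c i"
proof -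
  let ?v = "\<Oplus>\<^bsub>M\<^esub>i\<in>I. c i \<odot>\<^bsub>M\<^esub> b i"
  have v: "?v \<in> carrier M" using c by simp
  have "restrict c I \<in> I \<rightarrow>\<^sub>E carrier R \<and> ?v = (\<Oplus>\<^bsub>M\<^esub>i\<in>I. restrict c I i \<odot>\<^bsub>M\<^esub> b i)"
    using c by (auto simp: Pi_def intro!: M.finsum_cong')
  moreover have "coord ?v \<in> I \<rightarrow>\<^sub>E carrier R \<and> ?v = (\<Oplus>\<^bsub>M\<^esub>i\<in>I. coord ?v i \<odot>\<^bsub>M\<^esub> b i)"
    using theI'[OF ex1_coord[OF v]] unfolding coord_def .
  ultimately have "coord ?v = restrict c I" using ex1_coord[OF v] by blast
  then show ?thesis using i by simp
qed

lemma coord_eqI: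
  assumes "c \<in> I \<rightarrow> carrier R" "v = (\<Oplus>\<^bsub>M\<^esub>i\<in>I. c i \<odot>\<^bsub>M\<^esub> b i)" "i \<in> I"
  shows "coord v i = c i"
  using coord_sum[OF assms(1,3)] assms(2) by simp

lemma vector_eqI:
  assumes "v \<in> carrier M" "w \<in> carrier M" "\<And>i. i \<in> I \<Longrightarrow> coord v i = coord w i"
  shows "v = w"
proof -
  have "v = (\<Oplus>\<^bsub>M\<^esub>i\<in>I. coord v i \<odot>\<^bsub>M\<^esub> b i)" by (rule coord_expand) fact
  also have "\<dots> = (\<Oplus>\<^bsub>M\<^esub>i\<in>I. coord w i \<odot>\<^bsub>M\<^esub> b i)" by (rule M.finsum_cong') (use assms in auto)
  also have "\<dots> = w" by (rule coord_expand[symmetric]) fact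
  finally show ?thesis .
qed

lemma coord_add:
  assumes "v \<in> carrier M" "w \<in> carrier M" "i \<in> I"
  shows "coord (v \<oplus>\<^bsub>M\<^esub> w) i = coord v i \<oplus> coord w i"
proof (rule coord_eqI)
  have "(\<Oplus>\<^bsub>M\<^esub>i\<in>I. (coord v i \<oplus> coord w i) \<odot>\<^bsub>M\<^esub> b i)
      = (\<Oplus>\<^bsub>M\<^esub>i\<in>I. coord v i \<odot>\<^bsub>M\<^esub> b i \<oplus>\<^bsub>M\<^esub> coord w i \<odot>\<^bsub>M\<^esub> b i)"
    by (rule M.finsum_cong') (use assms in \<open>auto simp: smult_l_distr\<close>)
  also have "\<dots> = (\<Oplus>\<^bsub>M\<^esub>i\<in>I. coord v i \<odot>\<^bsub>M\<^esub> b i) \<oplus>\<^bsub>M\<^esub> (\<Oplus>\<^bsub>M\<^esub>i\<in>I. coord w i \<odot>\<^bsub>M\<^esub> b i)"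
    by (rule M.finsum_addf) (use assms in auto)
  finally show "v \<oplus>\<^bsub>M\<^esub> w = (\<Oplus>\<^bsub>M\<^esub>i\<in>I. (coord v i \<oplus> coord w i) \<odot>\<^bsub>M\<^esub> b i)"
    using coord_expand assms by simp
qed (use assms in auto)

lemma coord_smult:
  assumes "c \<in> carrier R" "v \<in> carrier M" "i \<in> I"
  shows "coord (c \<odot>\<^bsub>M\<^esub> v) i = c \<otimes> coord v i"
proof (rule coord_eqI)
  have "c \<odot>\<^bsub>M\<^esub> v = c \<odot>\<^bsub>M\<^esub> (\<Oplus>\<^bsub>M\<^esub>i\<in>I. coord v i \<odot>\<^bsub>M\<^esub> b i)" using coord_expand assms by simp
  also have "\<dots> = (\<Oplus>\<^bsub>M\<^esub>i\<in>I. c \<odot>\<^bsub>M\<^esub> (coord v i \<odot>\<^bsub>M\<^esub> b i))"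
    by (rule finsum_smult) (use assms in auto)
  also have "\<dots> = (\<Oplus>\<^bsub>M\<^esub>i\<in>I. (c \<otimes> coord v i) \<odot>\<^bsub>M\<^esub> b i)"
    by (rule M.finsum_cong') (use assms in \<open>auto simp: smult_assoc1\<close>)
  finally show "c \<odot>\<^bsub>M\<^esub> v = (\<Oplus>\<^bsub>M\<^esub>i\<in>I. (c \<otimes> coord v i) \<odot>\<^bsub>M\<^esub> b i)" .
qed (use assms in auto)

lemma coord_finsum:
  assumes "finite J" "f \<in> J \<rightarrow> carrier M" "i \<in> I"
  shows "coord (\<Oplus>\<^bsub>M\<^esub>j\<in>J. f j) i = (\<Oplus>j\<in>J. coord (f j) i)"
  using assms(1,2)
proof (induction J rule: finite_induct)
  case empty
  have "coord (\<zero> \<odot>\<^bsub>M\<^esub> \<zero>\<^bsub>M\<^esub>) i = \<zero> \<otimes> coord \<zero>\<^bsub>M\<^esub> i" by (rule coord_smult) (use assms in auto)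
  then show ?case using assms(3) by simp
next
  case (insert j J)
  then show ?case using assms(3) by (simp add: M.finsum_insert R.finsum_insert coord_add Pi_def)
qed

end

lemma (in module) module_hom_finsum:
  assumes "module R N" and "f \<in> module_hom R M N" and "finite J" "g \<in> J \<rightarrow> carrier M"
  shows "f (\<Oplus>\<^bsub>M\<^esub>j\<in>J. g j) = (\<Oplus>\<^bsub>N\<^esub>j\<in>J. f (g j))"
  using assms(3,4)
proof (induction J rule: finite_induct)
  interpret N: module R N by fact
  case empty
  have "f (\<zero> \<odot>\<^bsub>M\<^esub> \<zero>\<^bsub>M\<^esub>) = \<zero> \<odot>\<^bsub>N\<^esub> f \<zero>\<^bsub>M\<^esub>" by (rule module_hom_smult[OF assms(2)]) auto
  then show ?case using module_hom_closed[OF assms(2)] by (simp add: Pi_def)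
next
  interpret N: module R N by fact
  case (insert j J)
  then show ?case using module_hom_closed[OF assms(2)]
    by (simp add: M.finsum_insert N.finsum_insert module_hom_add[OF assms(2)] Pi_def)
qed

context free_basis
begin

lemma hom_expand:
  assumes "module R N" and f: "f \<in> module_hom R M N" and v: "v \<in> carrier M"
  shows "f v = (\<Oplus>\<^bsub>N\<^esub>i\<in>I. coord v i \<odot>\<^bsub>N\<^esub> f (b i))"
proof -
  interpret N: module R N by fact
  have "f v = f (\<Oplus>\<^bsub>M\<^esub>i\<in>I. coord v i \<odot>\<^bsub>M\<^esub> b i)" using coord_expand[OF v] by simp
  also have "\<dots> = (\<Oplus>\<^bsub>N\<^esub>i\<in>I. f (coord v i \<odot>\<^bsub>M\<^esub> b i))"
    by (rule module_hom_finsum[OF assms(1) f]) (use v in auto)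
  also have "\<dots> = (\<Oplus>\<^bsub>N\<^esub>i\<in>I. coord v i \<odot>\<^bsub>N\<^esub> f (b i))"
    by (rule N.finsum_cong') (use v module_hom_closed[OF f] module_hom_smult[OF f] in \<open>auto simp: Pi_def\<close>)
  finally show ?thesis .
qed

lemma hom_eqI:
  assumes "module R N" "f \<in> module_hom R M N" "g \<in> module_hom R M N"
    and eq: "\<And>i. i \<in> I \<Longrightarrow> f (b i) = g (b i)" and v: "v \<in> carrier M"
  shows "f v = g v"
proof -
  interpret N: module R N by fact
  show ?thesis
    unfolding hom_expand[OF assms(1,2) v] hom_expand[OF assms(1,3) v]
    by (rule N.finsum_cong') (use v module_hom_closed[OF assms(3)] eq in \<open>auto simp: Pi_def\<close>)
qed

definition lin_ext :: "('a, 'n, 'k) module_scheme \<Rightarrow> ('i \<Rightarrow> 'n) \<Rightarrow> 'c \<Rightarrow> 'n" where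
  "lin_ext N t v = (\<Oplus>\<^bsub>N\<^esub>i\<in>I. coord v i \<odot>\<^bsub>N\<^esub> t i)"

lemma lin_ext_hom:
  assumes "module R N" and t: "t \<in> I \<rightarrow> carrier N"
  shows "lin_ext N t \<in> module_hom R M N"
proof -
  interpret N: module R N by fact
  have cl: "t i \<in> carrier N" if "i \<in> I" for i using t that by auto
  show ?thesis
    unfolding module_hom_def mem_Collect_eq
  proof (intro conjI allI impI funcsetI)
    fix v assume "v \<in> carrier M"
    then show "lin_ext N t v \<in> carrier N"
      unfolding lin_ext_def by (intro N.finsum_closed) (use cl in auto)
  next
    fix v w assume "v \<in> carrier M \<and> w \<in> carrier M"
    then have vw: "v \<in> carrier M" "w \<in> carrier M" by auto
    have "lin_ext N t (v \<oplus>\<^bsub>M\<^esub> w) = (\<Oplus>\<^bsub>N\<^esub>i\<in>I. coord v i \<odot>\<^bsub>N\<^esub> t i \<oplus>\<^bsub>N\<^esub> coord w i \<odot>\<^bsub>N\<^esub> t i)"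
      unfolding lin_ext_def by (rule N.finsum_cong') (use vw cl in \<open>auto simp: coord_add N.smult_l_distr\<close>)
    also have "\<dots> = lin_ext N t v \<oplus>\<^bsub>N\<^esub> lin_ext N t w"
      unfolding lin_ext_def by (rule N.finsum_addf) (use vw cl in auto)
    finally show "lin_ext N t (v \<oplus>\<^bsub>M\<^esub> w) = lin_ext N t v \<oplus>\<^bsub>N\<^esub> lin_ext N t w" .
  next
    fix c v assume "c \<in> carrier R \<and> v \<in> carrier M"
    then have cv: "c \<in> carrier R" "v \<in> carrier M" by auto
    have "c \<odot>\<^bsub>N\<^esub> lin_ext N t v = (\<Oplus>\<^bsub>N\<^esub>i\<in>I. c \<odot>\<^bsub>N\<^esub> (coord v i \<odot>\<^bsub>N\<^esub> t i))"
      unfolding lin_ext_def by (rule N.finsum_smult) (use cv cl in auto)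
    also have "\<dots> = lin_ext N t (c \<odot>\<^bsub>M\<^esub> v)"
      unfolding lin_ext_def by (rule N.finsum_cong') (use cv cl in \<open>auto simp: coord_smult N.smult_assoc1\<close>)
    finally show "lin_ext N t (c \<odot>\<^bsub>M\<^esub> v) = c \<odot>\<^bsub>N\<^esub> lin_ext N t v" by simp
  qed
qed

lemma coord_basis:
  assumes "i \<in> I" "j \<in> I"
  shows "coord (b j) i = (if i = j then \<one> else \<zero>)"
proof (rule coord_eqI[where c = "\<lambda>i. if i = j then \<one> else \<zero>"])
  have "(\<Oplus>\<^bsub>M\<^esub>i\<in>I. (if i = j then \<one> else \<zero>) \<odot>\<^bsub>M\<^esub> b i) = (\<Oplus>\<^bsub>M\<^esub>i\<in>I. if j = i then b i else \<zero>\<^bsub>M\<^esub>)"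
    by (rule M.finsum_cong') auto
  also have "\<dots> = b j" by (rule M.finsum_singleton) (use assms in auto)
  finally show "b j = (\<Oplus>\<^bsub>M\<^esub>i\<in>I. (if i = j then \<one> else \<zero>) \<odot>\<^bsub>M\<^esub> b i)" by simp
qed (use assms in auto)

lemma lin_ext_basis:
  assumes "module R N" and t: "t \<in> I \<rightarrow> carrier N" and j: "j \<in> I"
  shows "lin_ext N t (b j) = t j"
proof -
  interpret N: module R N by fact
  have "lin_ext N t (b j) = (\<Oplus>\<^bsub>N\<^esub>i\<in>I. if j = i then t i else \<zero>\<^bsub>N\<^esub>)"
    unfolding lin_ext_def by (rule N.finsum_cong') (use t j in \<open>auto simp: coord_basis Pi_def\<close>)
  also have "\<dots> = t j" by (rule N.finsum_singleton) (use t j in auto)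
  finally show ?thesis .
qed

end

section \<open>Equivariant endomorphisms\<close>

locale equivariant = module R M for R (structure) and M (structure) +
  fixes G :: "('g, 'h) monoid_scheme" and \<phi> :: "'g \<Rightarrow> 'c \<Rightarrow> 'c"
  assumes act_hom: "g \<in> carrier G \<Longrightarrow> \<phi> g \<in> module_hom R M M"
begin

abbreviation "End \<equiv> endo_algebra G R M \<phi>"

lemma End_simps:
  "\<one>\<^bsub>End\<^esub> = (\<lambda>x\<in>carrier M. x)" "\<zero>\<^bsub>End\<^esub> = (\<lambda>x\<in>carrier M. \<zero>\<^bsub>M\<^esub>)"
  "f \<otimes>\<^bsub>End\<^esub> h = compose (carrier M) f h"
  "f \<oplus>\<^bsub>End\<^esub> h = (\<lambda>x\<in>carrier M. f x \<oplus>\<^bsub>M\<^esub> h x)"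
  "c \<odot>\<^bsub>End\<^esub> f = (\<lambda>x\<in>carrier M. c \<odot>\<^bsub>M\<^esub> f x)"
  by (simp_all add: endo_algebra_def)

lemma End_memI:
  assumes "f \<in> extensional (carrier M)" "f \<in> module_hom R M M"
    "\<And>g x. g \<in> carrier G \<Longrightarrow> x \<in> carrier M \<Longrightarrow> f (\<phi> g x) = \<phi> g (f x)"
  shows "f \<in> carrier End"
  using assms by (simp add: endo_algebra_def)

lemma End_memD:
  assumes "f \<in> carrier End"
  shows "f \<in> extensional (carrier M)" "f \<in> module_hom R M M"
    "\<And>g x. g \<in> carrier G \<Longrightarrow> x \<in> carrier M \<Longrightarrow> f (\<phi> g x) = \<phi> g (f x)"
    "\<And>x. x \<in> carrier M \<Longrightarrow> f x \<in> carrier M"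
    "\<And>x y. x \<in> carrier M \<Longrightarrow> y \<in> carrier M \<Longrightarrow> f (x \<oplus>\<^bsub>M\<^esub> y) = f x \<oplus>\<^bsub>M\<^esub> f y"
    "\<And>c x. c \<in> carrier R \<Longrightarrow> x \<in> carrier M \<Longrightarrow> f (c \<odot>\<^bsub>M\<^esub> x) = c \<odot>\<^bsub>M\<^esub> f x"
  using assms by (auto simp: endo_algebra_def module_hom_def)

lemma act_closed [simp]: "g \<in> carrier G \<Longrightarrow> x \<in> carrier M \<Longrightarrow> \<phi> g x \<in> carrier M"
  using module_hom_closed[OF act_hom] by auto

lemma act_zero [simp]: "g \<in> carrier G \<Longrightarrow> \<phi> g \<zero>\<^bsub>M\<^esub> = \<zero>\<^bsub>M\<^esub>"
  using module_hom_smult[OF act_hom, of g \<zero> "\<zero>\<^bsub>M\<^esub>"] by simp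

lemma End_mult_closed:
  assumes "f \<in> carrier End" "h \<in> carrier End"
  shows "f \<otimes>\<^bsub>End\<^esub> h \<in> carrier End"
  unfolding End_simps
  by (rule End_memI) (use End_memD[OF assms(1)] End_memD[OF assms(2)] in \<open>auto simp: module_hom_def compose_def\<close>)

lemma End_add_closed:
  assumes "f \<in> carrier End" "h \<in> carrier End"
  shows "f \<oplus>\<^bsub>End\<^esub> h \<in> carrier End"
  unfolding End_simps
  by (rule End_memI)
    (use End_memD(3-)[OF assms(1)] End_memD(3-)[OF assms(2)] in
      \<open>auto simp: module_hom_def smult_r_distr M.a_ac module_hom_add[OF act_hom]\<close>)

lemma End_smult_closed:
  assumes "c \<in> carrier R" "f \<in> carrier End"
  shows "c \<odot>\<^bsub>End\<^esub> f \<in> carrier End"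
  unfolding End_simps
  by (rule End_memI)
    (use assms End_memD(3-)[OF assms(2)] in
      \<open>auto simp: module_hom_def smult_r_distr smult_assoc1[symmetric] R.m_comm module_hom_smult[OF act_hom]\<close>)

lemma End_zero_closed: "\<zero>\<^bsub>End\<^esub> \<in> carrier End"
  unfolding End_simps by (rule End_memI) (auto simp: module_hom_def)

lemma End_one_closed: "\<one>\<^bsub>End\<^esub> \<in> carrier End"
  unfolding End_simps by (rule End_memI) (auto simp: module_hom_def)

lemma End_eqI:
  assumes "f \<in> carrier End" "h \<in> carrier End" "\<And>x. x \<in> carrier M \<Longrightarrow> f x = h x"
  shows "f = h"
  using End_memD(1)[OF assms(1)] End_memD(1)[OF assms(2)] assms(3) by (rule extensionalityI)

lemma module_End: "module R End"
proof (rule module_criteria)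
  show "cring R" by (rule R.is_cring)
  show "\<forall>v\<in>carrier End. \<exists>w\<in>carrier End. v \<oplus>\<^bsub>End\<^esub> w = \<zero>\<^bsub>End\<^esub>"
  proof
    fix f assume f: "f \<in> carrier End"
    have "(\<ominus> \<one>) \<odot>\<^bsub>End\<^esub> f \<in> carrier End" by (rule End_smult_closed) (use f in auto)
    moreover have "f \<oplus>\<^bsub>End\<^esub> (\<ominus> \<one>) \<odot>\<^bsub>End\<^esub> f = \<zero>\<^bsub>End\<^esub>"
      unfolding End_simps
      by (rule restrict_ext) (simp add: End_memD(4)[OF f] smult_l_minus M.r_neg)
    ultimately show "\<exists>w\<in>carrier End. f \<oplus>\<^bsub>End\<^esub> w = \<zero>\<^bsub>End\<^esub>" by blast
  qed
  show "\<forall>v w. v \<in> carrier End \<and> w \<in> carrier End \<longrightarrow> v \<oplus>\<^bsub>End\<^esub> w = w \<oplus>\<^bsub>End\<^esub> v"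
    unfolding End_simps by (intro allI impI restrict_ext, elim conjE) (simp add: End_memD(4) M.a_comm)
  show "\<forall>v w x. v \<in> carrier End \<and> w \<in> carrier End \<and> x \<in> carrier End \<longrightarrow>
      v \<oplus>\<^bsub>End\<^esub> w \<oplus>\<^bsub>End\<^esub> x = v \<oplus>\<^bsub>End\<^esub> (w \<oplus>\<^bsub>End\<^esub> x)"
    unfolding End_simps by (intro allI impI restrict_ext, elim conjE) (simp add: End_memD(4) M.a_assoc)
  show "\<forall>v\<in>carrier End. v \<oplus>\<^bsub>End\<^esub> \<zero>\<^bsub>End\<^esub> = v"
    using End_memD(4) by (auto intro!: End_eqI End_add_closed End_zero_closed) (simp add: End_simps)
  show "\<forall>a b v. a \<in> carrier R \<and> b \<in> carrier R \<and> v \<in> carrier End \<longrightarrow>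
      (a \<otimes> b) \<odot>\<^bsub>End\<^esub> v = a \<odot>\<^bsub>End\<^esub> (b \<odot>\<^bsub>End\<^esub> v)"
    unfolding End_simps by (intro allI impI restrict_ext, elim conjE) (simp add: End_memD(4) smult_assoc1)
  show "\<forall>v\<in>carrier End. \<one> \<odot>\<^bsub>End\<^esub> v = v"
    using End_memD(4) by (auto intro!: End_eqI End_smult_closed) (simp add: End_simps)
  show "\<forall>a b v. a \<in> carrier R \<and> b \<in> carrier R \<and> v \<in> carrier End \<longrightarrow>
      (a \<oplus> b) \<odot>\<^bsub>End\<^esub> v = a \<odot>\<^bsub>End\<^esub> v \<oplus>\<^bsub>End\<^esub> b \<odot>\<^bsub>End\<^esub> v"
    unfolding End_simps by (intro allI impI restrict_ext, elim conjE) (simp add: End_memD(4) smult_l_distr)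
  show "\<forall>a v w. a \<in> carrier R \<and> v \<in> carrier End \<and> w \<in> carrier End \<longrightarrow>
      a \<odot>\<^bsub>End\<^esub> (v \<oplus>\<^bsub>End\<^esub> w) = a \<odot>\<^bsub>End\<^esub> v \<oplus>\<^bsub>End\<^esub> a \<odot>\<^bsub>End\<^esub> w"
    unfolding End_simps by (intro allI impI restrict_ext, elim conjE) (simp add: End_memD(4) smult_r_distr)
qed (use End_zero_closed End_add_closed End_smult_closed in auto)

lemma assoc_algebra_End: "assoc_algebra R End"
proof -
  interpret A: module R End by (rule module_End)
  have "ring End"
  proof (rule ringI)
    show "abelian_group End" by (rule A.M.abelian_group_axioms)
    show "Group.monoid End"
    proof (rule monoidI)
      fix f h k assume fhk: "f \<in> carrier End" "h \<in> carrier End" "k \<in> carrier End"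
      show "f \<otimes>\<^bsub>End\<^esub> h \<otimes>\<^bsub>End\<^esub> k = f \<otimes>\<^bsub>End\<^esub> (h \<otimes>\<^bsub>End\<^esub> k)"
        unfolding End_simps compose_def by (rule restrict_ext) (simp add: End_memD(4)[OF fhk(3)])
    next
      fix f assume f: "f \<in> carrier End"
      show "\<one>\<^bsub>End\<^esub> \<otimes>\<^bsub>End\<^esub> f = f" "f \<otimes>\<^bsub>End\<^esub> \<one>\<^bsub>End\<^esub> = f"
        by (rule End_eqI[OF End_mult_closed]; (use f End_one_closed End_memD(4)[OF f] in \<open>simp add: End_simps compose_def\<close>)?)+
    qed (use End_mult_closed End_one_closed in auto)
  next
    fix f h k assume fhk: "f \<in> carrier End" "h \<in> carrier End" "k \<in> carrier End"
    show "(f \<oplus>\<^bsub>End\<^esub> h) \<otimes>\<^bsub>End\<^esub> k = f \<otimes>\<^bsub>End\<^esub> k \<oplus>\<^bsub>End\<^esub> h \<otimes>\<^bsub>End\<^esub> k"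
      unfolding End_simps compose_def by (rule restrict_ext) (simp add: End_memD(4)[OF fhk(3)])
    show "k \<otimes>\<^bsub>End\<^esub> (f \<oplus>\<^bsub>End\<^esub> h) = k \<otimes>\<^bsub>End\<^esub> f \<oplus>\<^bsub>End\<^esub> k \<otimes>\<^bsub>End\<^esub> h"
      unfolding End_simps compose_def by (rule restrict_ext) (simp add: End_memD(4)[OF fhk(1)] End_memD(4)[OF fhk(2)] End_memD(5)[OF fhk(3)])
  qed
  moreover have "assoc_algebra_axioms R End"
  proof
    fix c f h assume cfh: "c \<in> carrier R" "f \<in> carrier End" "h \<in> carrier End"
    show "c \<odot>\<^bsub>End\<^esub> f \<otimes>\<^bsub>End\<^esub> h = c \<odot>\<^bsub>End\<^esub> (f \<otimes>\<^bsub>End\<^esub> h)"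
      unfolding End_simps compose_def by (rule restrict_ext) (simp add: End_memD(4)[OF cfh(3)])
    show "f \<otimes>\<^bsub>End\<^esub> (c \<odot>\<^bsub>End\<^esub> h) = c \<odot>\<^bsub>End\<^esub> (f \<otimes>\<^bsub>End\<^esub> h)"
      unfolding End_simps compose_def by (rule restrict_ext) (simp add: End_memD(4)[OF cfh(3)] End_memD(6)[OF cfh(2)] cfh(1))
  qed
  ultimately show ?thesis by (simp add: assoc_algebra_def module_End)
qed

end

lemma module_hom_comp: "f \<in> module_hom R N L \<Longrightarrow> g \<in> module_hom R M N \<Longrightarrow> (\<lambda>v. f (g v)) \<in> module_hom R M L"
  by (auto simp: module_hom_def Pi_def)

lemma (in module) module_hom_restrict: "f \<in> module_hom R M N \<Longrightarrow> restrict f (carrier M) \<in> module_hom R M N"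
  by (auto simp: module_hom_def Pi_def)

section \<open>Matrices with respect to a permuted basis\<close>

locale permutation_module =
  word_set P \<C> + free_basis R M "word_set.wset P \<C>" b + equivariant R M G \<phi>
  for P :: "nat set" and \<C> :: "nat multiset set"
    and R :: "('a, 'm) ring_scheme" (structure) and M :: "('a, 'c, 'k) module_scheme" (structure)
    and b :: "(nat \<Rightarrow> nat) \<Rightarrow> 'c" and G :: "('g, 'h) monoid_scheme" and \<phi> :: "'g \<Rightarrow> 'c \<Rightarrow> 'c" +
  assumes act_permutes: "g \<in> carrier G \<Longrightarrow> \<exists>\<sigma>. \<sigma> permutes P \<and> (\<forall>x\<in>wset. \<phi> g (b x) = b (x \<circ> \<sigma>))"
    and permutes_act: "\<sigma> permutes P \<Longrightarrow> \<exists>g\<in>carrier G. \<forall>x\<in>wset. \<phi> g (b x) = b (x \<circ> \<sigma>)"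
begin

text \<open>Images of basis vectors are columns, so composition becomes the matrix product in the
  same order.\<close>

definition mat :: "('c \<Rightarrow> 'c) \<Rightarrow> (nat \<Rightarrow> nat) \<Rightarrow> (nat \<Rightarrow> nat) \<Rightarrow> 'a" where
  "mat f x y = coord (f (b y)) x"

definition of_mat :: "((nat \<Rightarrow> nat) \<Rightarrow> (nat \<Rightarrow> nat) \<Rightarrow> 'a) \<Rightarrow> 'c \<Rightarrow> 'c" where
  "of_mat \<kappa> = restrict (lin_ext M (\<lambda>y. \<Oplus>\<^bsub>M\<^esub>x\<in>wset. \<kappa> x y \<odot>\<^bsub>M\<^esub> b x)) (carrier M)"

lemma module_M: "module R M" ..

lemma mat_closed [simp, intro]: "f \<in> carrier End \<Longrightarrow> x \<in> wset \<Longrightarrow> y \<in> wset \<Longrightarrow> mat f x y \<in> carrier R"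
  by (simp add: mat_def End_memD(4))

lemma mat_add:
  "\<lbrakk>f \<in> carrier End; h \<in> carrier End; x \<in> wset; y \<in> wset\<rbrakk> \<Longrightarrow> mat (f \<oplus>\<^bsub>End\<^esub> h) x y = mat f x y \<oplus> mat h x y"
  by (simp add: mat_def End_simps coord_add End_memD(4))

lemma mat_smult:
  "\<lbrakk>c \<in> carrier R; f \<in> carrier End; x \<in> wset; y \<in> wset\<rbrakk> \<Longrightarrow> mat (c \<odot>\<^bsub>End\<^esub> f) x y = c \<otimes> mat f x y"
  by (simp add: mat_def End_simps coord_smult End_memD(4))

lemma coord_zero [simp]: "x \<in> wset \<Longrightarrow> coord \<zero>\<^bsub>M\<^esub> x = \<zero>"
  using coord_finsum[of "{}" _ x] by simp

lemma mat_zero: "x \<in> wset \<Longrightarrow> y \<in> wset \<Longrightarrow> mat \<zero>\<^bsub>End\<^esub> x y = \<zero>"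
  by (simp add: mat_def End_simps)

lemma mat_mult:
  assumes f: "f \<in> carrier End" and h: "h \<in> carrier End" and xy: "x \<in> wset" "y \<in> wset"
  shows "mat (f \<otimes>\<^bsub>End\<^esub> h) x y = (\<Oplus>z\<in>wset. mat f x z \<otimes> mat h z y)"
proof -
  have hy: "h (b y) \<in> carrier M" using End_memD(4)[OF h] xy by simp
  have "mat (f \<otimes>\<^bsub>End\<^esub> h) x y = coord (f (h (b y))) x"
    using xy by (simp add: mat_def End_simps compose_def)
  also have "\<dots> = coord (\<Oplus>\<^bsub>M\<^esub>z\<in>wset. coord (h (b y)) z \<odot>\<^bsub>M\<^esub> f (b z)) x"
    using hom_expand[OF module_M End_memD(2)[OF f] hy] by simp
  also have "\<dots> = (\<Oplus>z\<in>wset. coord (coord (h (b y)) z \<odot>\<^bsub>M\<^esub> f (b z)) x)"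
    by (rule coord_finsum) (use hy xy End_memD(4)[OF f] in \<open>auto simp: Pi_def\<close>)
  also have "\<dots> = (\<Oplus>z\<in>wset. mat f x z \<otimes> mat h z y)"
  proof (rule R.finsum_cong')
    fix z assume z: "z \<in> wset"
    show "coord (coord (h (b y)) z \<odot>\<^bsub>M\<^esub> f (b z)) x = mat f x z \<otimes> mat h z y"
      using hy xy z End_memD(4)[OF f] by (simp add: coord_smult mat_def R.m_comm)
  qed (use f h xy in auto)
  finally show ?thesis .
qed

lemma mat_eqI:
  assumes f: "f \<in> carrier End" and h: "h \<in> carrier End"
    and eq: "\<And>x y. x \<in> wset \<Longrightarrow> y \<in> wset \<Longrightarrow> mat f x y = mat h x y"
  shows "f = h"
proof (rule End_eqI[OF f h])
  fix v assume v: "v \<in> carrier M"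
  show "f v = h v"
  proof (rule hom_eqI[OF module_M End_memD(2)[OF f] End_memD(2)[OF h] _ v])
    fix y assume y: "y \<in> wset"
    show "f (b y) = h (b y)"
      by (rule vector_eqI) (use y eq End_memD(4)[OF f] End_memD(4)[OF h] in \<open>auto simp: mat_def\<close>)
  qed
qed

lemma mat_finsum:
  assumes "finite J" "f \<in> J \<rightarrow> carrier End" "x \<in> wset" "y \<in> wset"
  shows "mat (\<Oplus>\<^bsub>End\<^esub>j\<in>J. f j) x y = (\<Oplus>j\<in>J. mat (f j) x y)"
  using assms(1,2)
proof (induction J rule: finite_induct)
  interpret A: module R End by (rule module_End)
  case empty
  then show ?case using assms(3,4) by (simp add: mat_zero)
next
  interpret A: module R End by (rule module_End)
  case (insert j J)
  then show ?case using assms(3,4) by (simp add: A.M.finsum_insert R.finsum_insert mat_add Pi_def)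
qed

lemma comp_eq_iff:
  assumes "\<sigma> permutes P"
  shows "x \<circ> \<sigma> = y \<circ> \<sigma> \<longleftrightarrow> x = y"
  using permutes_surj[OF assms] by (metis (no_types, lifting) comp_apply ext surjD)

lemma act_coord:
  assumes "\<sigma> permutes P" and g: "g \<in> carrier G" "\<forall>x\<in>wset. \<phi> g (b x) = b (x \<circ> \<sigma>)"
    and v: "v \<in> carrier M" and x: "x \<in> wset"
  shows "coord (\<phi> g v) (x \<circ> \<sigma>) = coord v x"
proof -
  have "\<phi> g v = (\<Oplus>\<^bsub>M\<^esub>z\<in>wset. coord v z \<odot>\<^bsub>M\<^esub> \<phi> g (b z))"
    by (rule hom_expand[OF module_M act_hom[OF g(1)] v])
  then have "coord (\<phi> g v) (x \<circ> \<sigma>) = (\<Oplus>z\<in>wset. coord (coord v z \<odot>\<^bsub>M\<^esub> \<phi> g (b z)) (x \<circ> \<sigma>))"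
    using coord_finsum[of wset "\<lambda>z. coord v z \<odot>\<^bsub>M\<^esub> \<phi> g (b z)" "x \<circ> \<sigma>"] v x g(1) wset_comp[OF x assms(1)]
    by (simp add: Pi_def)
  also have "\<dots> = (\<Oplus>z\<in>wset. if x = z then coord v z else \<zero>)"
  proof (rule R.finsum_cong')
    fix z assume z: "z \<in> wset"
    show "coord (coord v z \<odot>\<^bsub>M\<^esub> \<phi> g (b z)) (x \<circ> \<sigma>) = (if x = z then coord v z else \<zero>)"
      using v x z g(2) wset_comp[OF x assms(1)] wset_comp[OF z assms(1)] comp_eq_iff[OF assms(1), of x z]
      by (simp add: coord_smult coord_basis)
  qed (use v in auto)
  also have "\<dots> = coord v x" by (rule R.finsum_singleton) (use v x in auto)
  finally show ?thesis .
qed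

text \<open>This direction uses that every place permutation is induced by a group element. That
  every group element acts by a place permutation serves the converse,
  \<open>of_mat_closed\<close>.\<close>

lemma mat_invariant:
  assumes f: "f \<in> carrier End" and \<sigma>: "\<sigma> permutes P" and xy: "x \<in> wset" "y \<in> wset"
  shows "mat f (x \<circ> \<sigma>) (y \<circ> \<sigma>) = mat f x y"
proof -
  obtain g where g: "g \<in> carrier G" "\<forall>x\<in>wset. \<phi> g (b x) = b (x \<circ> \<sigma>)" using permutes_act[OF \<sigma>] by blast
  have "f (b (y \<circ> \<sigma>)) = f (\<phi> g (b y))" using g(2) xy by simp
  also have "\<dots> = \<phi> g (f (b y))" using End_memD(3)[OF f g(1)] xy by simp
  finally show ?thesis
    using act_coord[OF \<sigma> g _ xy(1), of "f (b y)"] End_memD(4)[OF f] xy by (simp add: mat_def)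
qed

lemma of_mat_basis:
  assumes "\<And>x y. x \<in> wset \<Longrightarrow> y \<in> wset \<Longrightarrow> \<kappa> x y \<in> carrier R" "y \<in> wset"
  shows "of_mat \<kappa> (b y) = (\<Oplus>\<^bsub>M\<^esub>x\<in>wset. \<kappa> x y \<odot>\<^bsub>M\<^esub> b x)"
  unfolding of_mat_def using lin_ext_basis[OF module_M _ assms(2)] assms by (simp add: Pi_def)

lemma mat_of_mat:
  assumes "\<And>x y. x \<in> wset \<Longrightarrow> y \<in> wset \<Longrightarrow> \<kappa> x y \<in> carrier R" "x \<in> wset" "y \<in> wset"
  shows "mat (of_mat \<kappa>) x y = \<kappa> x y"
  unfolding mat_def by (subst of_mat_basis) (use assms in \<open>auto intro!: coord_sum\<close>)

lemma of_mat_closed: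
  assumes \<kappa>: "\<And>x y. x \<in> wset \<Longrightarrow> y \<in> wset \<Longrightarrow> \<kappa> x y \<in> carrier R"
    and inv: "\<And>\<sigma> x y. \<lbrakk>\<sigma> permutes P; x \<in> wset; y \<in> wset\<rbrakk> \<Longrightarrow> \<kappa> (x \<circ> \<sigma>) (y \<circ> \<sigma>) = \<kappa> x y"
  shows "of_mat \<kappa> \<in> carrier End"
proof (rule End_memI)
  show hom: "of_mat \<kappa> \<in> module_hom R M M"
    unfolding of_mat_def by (intro module_hom_restrict lin_ext_hom module_M) (use \<kappa> in \<open>auto simp: Pi_def\<close>)
  show "of_mat \<kappa> \<in> extensional (carrier M)" by (simp add: of_mat_def)
  fix g v assume g: "g \<in> carrier G" and v: "v \<in> carrier M"
  obtain \<sigma> where \<sigma>: "\<sigma> permutes P" and act: "\<forall>x\<in>wset. \<phi> g (b x) = b (x \<circ> \<sigma>)" using act_permutes[OF g] by blast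
  show "of_mat \<kappa> (\<phi> g v) = \<phi> g (of_mat \<kappa> v)"
  proof (rule hom_eqI[OF module_M module_hom_comp[OF hom act_hom[OF g]] module_hom_comp[OF act_hom[OF g] hom] _ v])
    fix y assume y: "y \<in> wset"
    show "of_mat \<kappa> (\<phi> g (b y)) = \<phi> g (of_mat \<kappa> (b y))"
    proof (rule vector_eqI)
      have ob: "of_mat \<kappa> (b z) \<in> carrier M" if "z \<in> wset" for z
        using module_hom_closed[OF hom] that by auto
      show "of_mat \<kappa> (\<phi> g (b y)) \<in> carrier M" "\<phi> g (of_mat \<kappa> (b y)) \<in> carrier M"
        using funcset_mem[OF module_hom_closed[OF hom] act_closed[OF g basis_closed[OF y]]]
          act_closed[OF g ob[OF y]] by simp_all
      fix w assume w: "w \<in> wset"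
      define x where "x = w \<circ> inv_into UNIV \<sigma>"
      have wx: "w = x \<circ> \<sigma>" using permutes_inv_o(2)[OF \<sigma>] by (simp add: x_def o_assoc[symmetric])
      have x: "x \<in> wset" unfolding x_def by (rule wset_comp[OF w permutes_inv[OF \<sigma>]])
      have "coord (of_mat \<kappa> (\<phi> g (b y))) w = mat (of_mat \<kappa>) w (y \<circ> \<sigma>)" using act y by (simp add: mat_def)
      also have "\<dots> = \<kappa> w (y \<circ> \<sigma>)" by (rule mat_of_mat) (use \<kappa> w y wset_comp[OF _ \<sigma>] in auto)
      also have "\<dots> = \<kappa> x y" unfolding wx by (rule inv[OF \<sigma> x y])
      also have "\<dots> = coord (of_mat \<kappa> (b y)) x" using mat_of_mat[of \<kappa> x y] \<kappa> x y by (simp add: mat_def)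
      also have "\<dots> = coord (\<phi> g (of_mat \<kappa> (b y))) w"
        unfolding wx by (rule act_coord[OF \<sigma> g act ob[OF y] x, symmetric])
      finally show "coord (of_mat \<kappa> (\<phi> g (b y))) w = coord (\<phi> g (of_mat \<kappa> (b y))) w" .
    qed
  qed
qed

end

section \<open>Base change of the cell basis from the integers to \<open>R\<close>\<close>

context word_set
begin

definition orbitals :: "(nat \<times> nat) multiset set" where
  "orbitals = (\<lambda>(x, y). joint x y) ` (wset \<times> wset)"

lemma finite_orbitals [simp, intro]: "finite orbitals"
  by (simp add: orbitals_def)

lemma joint_orbitals [simp, intro]: "x \<in> wset \<Longrightarrow> y \<in> wset \<Longrightarrow> joint x y \<in> orbitals"
  by (auto simp: orbitals_def)

lemma invariant_orbital_sum:
  assumes r: "\<And>x y. x \<in> words \<Longrightarrow> y \<in> words \<Longrightarrow> h x y = r (joint x y)" and xy: "x \<in> wset" "y \<in> wset"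
  shows "h x y = (\<Sum>U\<in>orbitals. r U * ind U x y)"
proof -
  have "(\<Sum>U\<in>orbitals. r U * ind U x y) = (\<Sum>U\<in>orbitals. if U = joint x y then r U else 0)"
    by (rule sum.cong) (auto simp: ind_def)
  then show ?thesis using r[of x y] xy wset_words by simp
qed

text \<open>Mutually inverse integer matrices remain so over \<open>R\<close>, which carries spanning and independence over.\<close>

lemma cells_inverse:
  obtains N v where
    "\<And>U x y. x \<in> wset \<Longrightarrow> y \<in> wset \<Longrightarrow> ind U x y = (\<Sum>c\<in>cells. N U c * cell (fst c) (snd c) x y)"
    "\<And>c x y. x \<in> wset \<Longrightarrow> y \<in> wset \<Longrightarrow> cell (fst c) (snd c) x y = v c (joint x y)"
    "\<And>c d. c \<in> cells \<Longrightarrow> d \<in> cells \<Longrightarrow> (\<Sum>U\<in>orbitals. v c U * N U d) = of_bool (c = d)"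
proof -
  have "\<exists>a. \<forall>x\<in>wset. \<forall>y\<in>wset. ind U x y = (\<Sum>c\<in>cells. a c * cell (fst c) (snd c) x y)" for U
    by (rule cells_span[OF invariant_ind[of U]]) blast
  then have "\<exists>N. \<forall>U. \<forall>x\<in>wset. \<forall>y\<in>wset. ind U x y = (\<Sum>c\<in>cells. N U c * cell (fst c) (snd c) x y)"
    by (intro choice allI)
  then obtain N where N: "ind U x y = (\<Sum>c\<in>cells. N U c * cell (fst c) (snd c) x y)"
    if "x \<in> wset" "y \<in> wset" for U x y by blast
  have "\<exists>r. \<forall>x\<in>words. \<forall>y\<in>words. cell (fst c) (snd c) x y = r (joint x y)" for c
    by (rule invariant_factor[OF invariant_cell[of "fst c" "snd c"]]) blast
  then have "\<exists>v. \<forall>c. \<forall>x\<in>words. \<forall>y\<in>words. cell (fst c) (snd c) x y = v c (joint x y)"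
    by (intro choice allI)
  then obtain v where v: "cell (fst c) (snd c) x y = v c (joint x y)" if "x \<in> words" "y \<in> words" for c x y
    by blast
  have "(\<Sum>U\<in>orbitals. v c U * N U d) = of_bool (c = d)" if c: "c \<in> cells" and d: "d \<in> cells" for c d
  proof -
    \<comment> \<open>Expanding a cell into orbitals and back into cells gives a linear relation
      between cells, whose coefficients vanish by independence.\<close>
    have "(\<Sum>U\<in>orbitals. v c U * N U d) - of_bool (c = d) = 0"
    proof (rule cells_independent[OF _ d])
      fix x y assume xy: "x \<in> wset" "y \<in> wset"
      have "(\<Sum>e\<in>cells. (\<Sum>U\<in>orbitals. v c U * N U e) * cell (fst e) (snd e) x y)
          = (\<Sum>U\<in>orbitals. v c U * ind U x y)"
        unfolding N[OF xy] sum_distrib_left sum_distrib_right mult.assoc by (rule sum.swap)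
      also have "\<dots> = cell (fst c) (snd c) x y"
        by (rule invariant_orbital_sum[of "cell (fst c) (snd c)" "v c", OF _ xy, symmetric]) (rule v)
      also have "\<dots> = (\<Sum>e\<in>cells. of_bool (c = e) * cell (fst e) (snd e) x y)"
      proof -
        have "(\<Sum>e\<in>cells. of_bool (c = e) * cell (fst e) (snd e) x y)
            = (\<Sum>e\<in>cells. if c = e then cell (fst e) (snd e) x y else 0)"
          by (rule sum.cong) auto
        then show ?thesis using c by simp
      qed
      finally show "(\<Sum>e\<in>cells. ((\<Sum>U\<in>orbitals. v c U * N U e) - of_bool (c = e)) * cell (fst e) (snd e) x y) = 0"
        by (simp add: left_diff_distrib sum_subtractf)
    qed
    then show ?thesis by simp
  qed
  then show ?thesis using that N v wset_words by blast
qed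

end

lemma (in cring) int_comb_delta:
  assumes "finite J" "i \<in> J"
  shows "int_comb R J (\<lambda>j. if j = i then \<one> else \<zero>) g = ring_int R (g i)"
proof -
  have "int_comb R J (\<lambda>j. if j = i then \<one> else \<zero>) g = (\<Oplus>j\<in>J. if i = j then ring_int R (g j) else \<zero>)"
    unfolding int_comb_def by (rule finsum_cong') (use assms in auto)
  also have "\<dots> = ring_int R (g i)" by (rule finsum_singleton) (use assms in auto)
  finally show ?thesis .
qed

lemma (in module) finsum_in_span:
  assumes "finite J" "f \<in> J \<rightarrow> X" "a \<in> J \<rightarrow> carrier R" "X \<subseteq> carrier M"
  shows "(\<Oplus>\<^bsub>M\<^esub>j\<in>J. a j \<odot>\<^bsub>M\<^esub> f j) \<in> span X"
  using assms(1-3)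
proof (induction J rule: finite_induct)
  interpret S: LinearCombinations.submodule R "span X" M by (rule span_is_submodule) fact
  case empty
  show ?case by simp
next
  interpret S: LinearCombinations.submodule R "span X" M by (rule span_is_submodule) fact
  case (insert j J)
  have cl: "f i \<in> carrier M" "a i \<in> carrier R" if "i \<in> insert j J" for i
    using insert.prems assms(4) that by auto
  have "f j \<in> span X" using insert.prems in_own_span[OF assms(4)] by auto
  then have "a j \<odot>\<^bsub>M\<^esub> f j \<oplus>\<^bsub>M\<^esub> (\<Oplus>\<^bsub>M\<^esub>j\<in>J. a j \<odot>\<^bsub>M\<^esub> f j) \<in> span X"
    using insert by (intro S.m_closed S.smult_closed) auto
  then show ?case using insert.hyps cl by (simp add: M.finsum_insert Pi_def)
qed

text \<open>Over the zero ring \<open>C\<close> could not be injective if there were two cells, so the empty cell datum is used.\<close>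

lemma cellular_zero_ring:
  assumes A: "assoc_algebra R A" and triv: "\<one>\<^bsub>R\<^esub> = \<zero>\<^bsub>R\<^esub>"
  shows "cellular R A"
proof -
  interpret module R A using A by (simp add: assoc_algebra_def)
  interpret ring A using A by (simp add: assoc_algebra_def)
  have zero: "x = \<zero>\<^bsub>A\<^esub>" if "x \<in> carrier A" for x
    using smult_one[OF that] smult_l_null[OF that] triv by simp
  have "cell_datum R A ({} :: nat set) {} (\<lambda>_. {} :: nat set) (\<lambda>_ _ _. \<zero>\<^bsub>A\<^esub>) (\<lambda>x. x)"
    unfolding cell_datum_def is_basis_def
  proof (intro conjI)
    show "partial_order_on ({} :: nat set) {}" by simp
    show "span ((\<lambda>(l, t, u). \<zero>\<^bsub>A\<^esub>) ` (SIGMA l:({} :: nat set). ({} :: nat set) \<times> {})) = carrier A"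
      using zero by (auto simp: span_def lincomb_def)
    show "\<forall>x\<in>carrier A. \<forall>y\<in>carrier A. x \<otimes>\<^bsub>A\<^esub> y = y \<otimes>\<^bsub>A\<^esub> x"
      using zero by metis
  qed (auto simp: lin_dep_def module_hom_def)
  then show ?thesis by (rule cell_datum_imp_cellular[OF A])
qed

context permutation_module
begin

definition cell_map :: "(nat \<times> nat) multiset \<Rightarrow> (nat \<times> nat) multiset \<Rightarrow> 'c \<Rightarrow> 'c" where
  "cell_map S T = of_mat (\<lambda>x y. ring_int R (cell S T x y))"

abbreviation "cmap c \<equiv> cell_map (fst c) (snd c)"

lemma cell_map_closed [simp, intro]: "cell_map S T \<in> carrier End"
  unfolding cell_map_def by (rule of_mat_closed) (simp_all add: invariantD[OF invariant_cell])

lemma mat_cell_map: "x \<in> wset \<Longrightarrow> y \<in> wset \<Longrightarrow> mat (cell_map S T) x y = ring_int R (cell S T x y)"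
  unfolding cell_map_def by (rule mat_of_mat) auto

lemma mat_cell_sum:
  assumes J: "finite J" and a: "a \<in> J \<rightarrow> carrier R" and xy: "x \<in> wset" "y \<in> wset"
  shows "mat (\<Oplus>\<^bsub>End\<^esub>c\<in>J. a c \<odot>\<^bsub>End\<^esub> cmap c) x y = int_comb R J a (\<lambda>c. cell (fst c) (snd c) x y)"
proof -
  have "mat (\<Oplus>\<^bsub>End\<^esub>c\<in>J. a c \<odot>\<^bsub>End\<^esub> cmap c) x y = (\<Oplus>c\<in>J. mat (a c \<odot>\<^bsub>End\<^esub> cmap c) x y)"
    by (rule mat_finsum[OF J _ xy]) (use a in \<open>auto intro!: End_smult_closed simp: Pi_def\<close>)
  also have "\<dots> = int_comb R J a (\<lambda>c. cell (fst c) (snd c) x y)"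
    unfolding int_comb_def
    by (rule R.finsum_cong') (use a xy in \<open>auto simp: mat_smult mat_cell_map Pi_def\<close>)
  finally show ?thesis .
qed

text \<open>The matrix is constant on orbitals, so its value at any representative of an orbital is
  the coefficient.\<close>

lemma End_orbital_coeffs:
  assumes f: "f \<in> carrier End"
  obtains \<kappa> where "\<kappa> \<in> orbitals \<rightarrow> carrier R"
    "\<And>x y. x \<in> wset \<Longrightarrow> y \<in> wset \<Longrightarrow> mat f x y = int_comb R orbitals \<kappa> (\<lambda>U. ind U x y)"
proof -
  define rep where "rep U = (SOME p. fst p \<in> wset \<and> snd p \<in> wset \<and> joint (fst p) (snd p) = U)" for U
  define \<kappa> where "\<kappa> U = mat f (fst (rep U)) (snd (rep U))" for U
  have rep: "fst (rep U) \<in> wset \<and> snd (rep U) \<in> wset \<and> joint (fst (rep U)) (snd (rep U)) = U"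
    if "U \<in> orbitals" for U
  proof -
    from that obtain x y where "x \<in> wset" "y \<in> wset" "joint x y = U" by (auto simp: orbitals_def)
    then show ?thesis
      using someI[of "\<lambda>p. fst p \<in> wset \<and> snd p \<in> wset \<and> joint (fst p) (snd p) = U" "(x, y)"]
      unfolding rep_def by simp
  qed
  have \<kappa>: "\<kappa> \<in> orbitals \<rightarrow> carrier R" using rep f by (auto simp: \<kappa>_def)
  show ?thesis
  proof (rule that[OF \<kappa>])
    fix x y assume xy: "x \<in> wset" "y \<in> wset"
    note r = rep[OF joint_orbitals[OF xy]]
    obtain \<sigma> where \<sigma>: "\<sigma> permutes P" "x = fst (rep (joint x y)) \<circ> \<sigma>" "y = snd (rep (joint x y)) \<circ> \<sigma>"
      using joint_eqE[of x y "fst (rep (joint x y))" "snd (rep (joint x y))"] r xy wset_words by metis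
    have "mat f x y = \<kappa> (joint x y)"
      using mat_invariant[OF f \<sigma>(1), of "fst (rep (joint x y))" "snd (rep (joint x y))"] r \<sigma>(2,3)
      by (simp add: \<kappa>_def)
    also have "\<dots> = int_comb R orbitals \<kappa> (\<lambda>U. of_bool (U = joint x y))"
      by (rule R.int_comb_single[symmetric]) (use \<kappa> xy in auto)
    also have "\<dots> = int_comb R orbitals \<kappa> (\<lambda>U. ind U x y)"
      by (rule R.int_comb_cong[OF \<kappa>]) (auto simp: ind_def)
    finally show "mat f x y = int_comb R orbitals \<kappa> (\<lambda>U. ind U x y)" .
  qed
qed

text \<open>The integral expansion \<open>N\<close> of the orbital indicators converts the orbital
  coefficients of \<open>f\<close> into cell coefficients.\<close>

lemma cell_map_span:
  assumes f: "f \<in> carrier End"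
  obtains a where "a \<in> cells \<rightarrow> carrier R" "f = (\<Oplus>\<^bsub>End\<^esub>c\<in>cells. a c \<odot>\<^bsub>End\<^esub> cmap c)"
proof -
  interpret A: module R End by (rule module_End)
  obtain \<kappa> where \<kappa>: "\<kappa> \<in> orbitals \<rightarrow> carrier R"
    and matf: "\<And>x y. x \<in> wset \<Longrightarrow> y \<in> wset \<Longrightarrow> mat f x y = int_comb R orbitals \<kappa> (\<lambda>U. ind U x y)"
    using End_orbital_coeffs[OF f] by blast
  obtain N where N: "\<And>U x y. x \<in> wset \<Longrightarrow> y \<in> wset \<Longrightarrow> ind U x y = (\<Sum>c\<in>cells. N U c * cell (fst c) (snd c) x y)"
    by (rule cells_inverse) blast
  define a where "a c = int_comb R orbitals \<kappa> (\<lambda>U. N U c)" for c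
  have a: "a \<in> cells \<rightarrow> carrier R" using \<kappa> by (auto simp: a_def)
  show ?thesis
  proof (rule that[OF a], rule mat_eqI[OF f])
    show "(\<Oplus>\<^bsub>End\<^esub>c\<in>cells. a c \<odot>\<^bsub>End\<^esub> cmap c) \<in> carrier End"
      by (rule A.M.finsum_closed) (use a in \<open>auto intro!: End_smult_closed simp: Pi_def\<close>)
    fix x y assume xy: "x \<in> wset" "y \<in> wset"
    have "mat f x y = int_comb R orbitals \<kappa> (\<lambda>U. \<Sum>c\<in>cells. N U c * cell (fst c) (snd c) x y)"
      unfolding matf[OF xy] by (rule R.int_comb_cong[OF \<kappa>]) (rule N[OF xy])
    also have "\<dots> = int_comb R cells a (\<lambda>c. cell (fst c) (snd c) x y)"
      using R.int_comb_sum[OF finite_orbitals \<kappa> finite_cells, of "\<lambda>c U. N U c" "\<lambda>c. cell (fst c) (snd c) x y"]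
      by (simp add: int_comb_def[of R cells] a_def)
    finally show "mat f x y = mat (\<Oplus>\<^bsub>End\<^esub>c\<in>cells. a c \<odot>\<^bsub>End\<^esub> cmap c) x y"
      by (simp add: mat_cell_sum[OF finite_cells a xy])
  qed
qed

text \<open>The matrix entry on an orbital \<open>U\<close> is the combination of the numbers
  \<open>v c U\<close> with coefficients \<open>a c\<close>, and multiplying by \<open>N\<close>
  inverts \<open>v\<close>. No division takes place, so zero divisors and torsion in
  \<open>R\<close> do no harm.\<close>

lemma cell_map_unique:
  assumes a: "a \<in> cells \<rightarrow> carrier R" and a': "a' \<in> cells \<rightarrow> carrier R"
    and eq: "\<And>x y. x \<in> wset \<Longrightarrow> y \<in> wset \<Longrightarrow>
      int_comb R cells a (\<lambda>c. cell (fst c) (snd c) x y) = int_comb R cells a' (\<lambda>c. cell (fst c) (snd c) x y)"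
    and d: "d \<in> cells"
  shows "a d = a' d"
proof -
  obtain N v where v: "\<And>c x y. x \<in> wset \<Longrightarrow> y \<in> wset \<Longrightarrow> cell (fst c) (snd c) x y = v c (joint x y)"
    and inv: "\<And>c d. c \<in> cells \<Longrightarrow> d \<in> cells \<Longrightarrow> (\<Sum>U\<in>orbitals. v c U * N U d) = of_bool (c = d)"
    by (rule cells_inverse) blast
  have expand: "h d = (\<Oplus>U\<in>orbitals. int_comb R cells h (\<lambda>c. v c U) \<otimes> ring_int R (N U d))"
    if h: "h \<in> cells \<rightarrow> carrier R" for h
  proof -
    have "h d = int_comb R cells h (\<lambda>c. of_bool (c = d))"
      by (rule R.int_comb_single[symmetric]) (use h d in auto)
    also have "\<dots> = int_comb R cells h (\<lambda>c. \<Sum>U\<in>orbitals. v c U * N U d)"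
      by (rule R.int_comb_cong[OF h]) (simp add: inv d)
    also have "\<dots> = (\<Oplus>U\<in>orbitals. int_comb R cells h (\<lambda>c. v c U) \<otimes> ring_int R (N U d))"
      by (rule R.int_comb_sum) (use h in auto)
    finally show ?thesis .
  qed
  show ?thesis
    unfolding expand[OF a] expand[OF a']
  proof (rule R.finsum_cong')
    fix U assume "U \<in> orbitals"
    then obtain x y where "x \<in> wset" "y \<in> wset" "U = joint x y" by (auto simp: orbitals_def)
    then show "int_comb R cells a (\<lambda>c. v c U) \<otimes> ring_int R (N U d)
        = int_comb R cells a' (\<lambda>c. v c U) \<otimes> ring_int R (N U d)"
      using eq[of x y] v by simp
  qed (use a' in auto)
qed

text \<open>Two cells with the same map would give two unit vectors of coefficients for one matrix;
  these differ at \<open>d\<close> because \<open>\<one> \<noteq> \<zero>\<close>.\<close>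

lemma cell_map_inj:
  assumes "\<one> \<noteq> \<zero>"
  shows "inj_on (\<lambda>c. cmap c) cells"
proof (rule inj_onI, rule ccontr)
  fix c d assume cd: "c \<in> cells" "d \<in> cells" "cmap c = cmap d" "c \<noteq> d"
  have "(\<lambda>e. if e = c then \<one> else \<zero>) d = (\<lambda>e. if e = d then \<one> else \<zero>) d"
  proof (rule cell_map_unique[of "\<lambda>e. if e = c then \<one> else \<zero>" "\<lambda>e. if e = d then \<one> else \<zero>"])
    fix x y assume xy: "x \<in> wset" "y \<in> wset"
    have "ring_int R (cell (fst c) (snd c) x y) = ring_int R (cell (fst d) (snd d) x y)"
      using mat_cell_map[OF xy, of "fst c" "snd c"] mat_cell_map[OF xy, of "fst d" "snd d"] cd(3) by simp
    then show "int_comb R cells (\<lambda>e. if e = c then \<one> else \<zero>) (\<lambda>c. cell (fst c) (snd c) x y)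
        = int_comb R cells (\<lambda>e. if e = d then \<one> else \<zero>) (\<lambda>c. cell (fst c) (snd c) x y)"
      by (simp add: R.int_comb_delta cd(1,2))
  qed (use cd in auto)
  then show False using cd(4) assms by simp
qed

lemma cell_map_basis:
  assumes nz: "\<one> \<noteq> \<zero>"
  shows "is_basis R End ((\<lambda>c. cmap c) ` cells)"
proof -
  interpret A: module R End by (rule module_End)
  let ?B = "(\<lambda>c. cmap c) ` cells"
  have B: "?B \<subseteq> carrier End" by auto
  have lc: "A.lincomb a ?B = (\<Oplus>\<^bsub>End\<^esub>c\<in>cells. a (cmap c) \<odot>\<^bsub>End\<^esub> cmap c)" if "a \<in> ?B \<rightarrow> carrier R" for a
    unfolding A.lincomb_def
    by (rule A.M.finsum_reindex) (use that cell_map_inj[OF nz] in \<open>auto intro!: End_smult_closed simp: Pi_def\<close>)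
  have "\<not> A.lin_dep ?B"
  proof (rule A.finite_lin_indpt2[OF _ B])
    fix a assume a: "a \<in> ?B \<rightarrow> carrier R" and zero: "A.lincomb a ?B = \<zero>\<^bsub>End\<^esub>"
    show "\<forall>v\<in>?B. a v = \<zero>"
    proof
      fix v assume "v \<in> ?B"
      then obtain d where d: "d \<in> cells" "v = cmap d" by blast
      have ac: "(\<lambda>c. a (cmap c)) \<in> cells \<rightarrow> carrier R" using a by auto
      have "(\<lambda>c. a (cmap c)) d = (\<lambda>_. \<zero>) d"
      proof (rule cell_map_unique[of "\<lambda>c. a (cmap c)" "\<lambda>_. \<zero>", OF ac _ _ d(1)])
        fix x y assume xy: "x \<in> wset" "y \<in> wset"
        have "int_comb R cells (\<lambda>c. a (cmap c)) (\<lambda>c. cell (fst c) (snd c) x y) = mat \<zero>\<^bsub>End\<^esub> x y"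
          using mat_cell_sum[OF finite_cells ac xy] lc[OF a] zero by simp
        then show "int_comb R cells (\<lambda>c. a (cmap c)) (\<lambda>c. cell (fst c) (snd c) x y)
          = int_comb R cells (\<lambda>_. \<zero>) (\<lambda>c. cell (fst c) (snd c) x y)"
          by (simp add: mat_zero xy int_comb_def)
      qed simp
      then show "a v = \<zero>" by (simp add: d)
    qed
  qed simp
  moreover have "A.span ?B = carrier End"
  proof
    show "A.span ?B \<subseteq> carrier End" by (rule A.span_is_subset2[OF B])
    show "carrier End \<subseteq> A.span ?B"
    proof
      fix f assume "f \<in> carrier End"
      then obtain a where a: "a \<in> cells \<rightarrow> carrier R" "f = (\<Oplus>\<^bsub>End\<^esub>c\<in>cells. a c \<odot>\<^bsub>End\<^esub> cmap c)"
        by (rule cell_map_span)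
      show "f \<in> A.span ?B"
        unfolding a(2) by (rule A.finsum_in_span) (use a(1) in auto)
    qed
  qed
  ultimately show ?thesis using B by (simp add: is_basis_def)
qed

end

section \<open>The order on shapes, the anti-involution and the cell datum\<close>

context word_set
begin

text \<open>Heavier shapes are greater, and distinct shapes of equal weight are incomparable. (C3)
  holds for this order because straightening leaves remainders of larger weight.\<close>

definition shape_order :: "(nat multiset \<times> nat multiset) set" where
  "shape_order = {(\<mu>, \<nu>). \<mu> \<in> shapes \<and> \<nu> \<in> shapes \<and> (\<mu> = \<nu> \<or> weight \<mu> < weight \<nu>)}"

lemma shape_order: "partial_order_on shapes shape_order"
  by (auto simp: shape_order_def partial_order_on_def preorder_on_def refl_on_def trans_def antisym_def)

lemma aboveS_shape_order: "\<mu> \<in> shapes \<Longrightarrow> aboveS shape_order \<mu> = {\<nu> \<in> shapes. weight \<mu> < weight \<nu>}"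
  by (auto simp: aboveS_def shape_order_def)

lemma cells_ge_shape: "c \<in> cells_ge k \<longleftrightarrow> (\<exists>\<nu>\<in>shapes. k \<le> weight \<nu> \<and> fst c \<in> tableaux \<nu> \<and> snd c \<in> tableaux \<nu>)"
proof
  assume "c \<in> cells_ge k"
  then obtain \<nu> where "\<nu> \<in> shapes" "c \<in> tableaux \<nu> \<times> tableaux \<nu>" "k \<le> weight (shape (fst c))"
    by (auto simp: cells_ge_def cells_def)
  then show "\<exists>\<nu>\<in>shapes. k \<le> weight \<nu> \<and> fst c \<in> tableaux \<nu> \<and> snd c \<in> tableaux \<nu>"
    using shape_tableaux[of "fst c" \<nu>] by (auto simp: mem_Times_iff)
next
  assume "\<exists>\<nu>\<in>shapes. k \<le> weight \<nu> \<and> fst c \<in> tableaux \<nu> \<and> snd c \<in> tableaux \<nu>"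
  then obtain \<nu> where "\<nu> \<in> shapes" "k \<le> weight \<nu>" "fst c \<in> tableaux \<nu>" "snd c \<in> tableaux \<nu>" by blast
  then show "c \<in> cells_ge k"
    using shape_tableaux[of "fst c" \<nu>] by (auto simp: cells_ge_def cells_def mem_Times_iff)
qed

end

context permutation_module
begin

definition transpose_map :: "('c \<Rightarrow> 'c) \<Rightarrow> 'c \<Rightarrow> 'c" where
  "transpose_map f = of_mat (\<lambda>x y. mat f y x)"

lemma transpose_map_closed [simp, intro]: "f \<in> carrier End \<Longrightarrow> transpose_map f \<in> carrier End"
  unfolding transpose_map_def by (rule of_mat_closed) (auto simp: mat_invariant)

lemma mat_transpose_map: "f \<in> carrier End \<Longrightarrow> x \<in> wset \<Longrightarrow> y \<in> wset \<Longrightarrow> mat (transpose_map f) x y = mat f y x"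
  unfolding transpose_map_def by (rule mat_of_mat) auto

lemma transpose_map_hom: "transpose_map \<in> module_hom R End End"
  unfolding module_hom_def mem_Collect_eq
proof (intro conjI allI impI funcsetI)
  fix f h assume "f \<in> carrier End \<and> h \<in> carrier End"
  then have fh: "f \<in> carrier End" "h \<in> carrier End" by auto
  show "transpose_map (f \<oplus>\<^bsub>End\<^esub> h) = transpose_map f \<oplus>\<^bsub>End\<^esub> transpose_map h"
    by (rule mat_eqI) (auto simp: fh End_add_closed mat_transpose_map mat_add)
next
  fix c f assume "c \<in> carrier R \<and> f \<in> carrier End"
  then have cf: "c \<in> carrier R" "f \<in> carrier End" by auto
  show "transpose_map (c \<odot>\<^bsub>End\<^esub> f) = c \<odot>\<^bsub>End\<^esub> transpose_map f"
    by (rule mat_eqI) (auto simp: cf End_smult_closed mat_transpose_map mat_smult)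
qed auto

lemma transpose_map_involution: "f \<in> carrier End \<Longrightarrow> transpose_map (transpose_map f) = f"
  by (rule mat_eqI) (auto simp: mat_transpose_map)

lemma transpose_map_mult:
  assumes f: "f \<in> carrier End" and h: "h \<in> carrier End"
  shows "transpose_map (f \<otimes>\<^bsub>End\<^esub> h) = transpose_map h \<otimes>\<^bsub>End\<^esub> transpose_map f"
proof (rule mat_eqI)
  fix x y assume xy: "x \<in> wset" "y \<in> wset"
  have "mat (transpose_map (f \<otimes>\<^bsub>End\<^esub> h)) x y = (\<Oplus>z\<in>wset. mat f y z \<otimes> mat h z x)"
    using xy f h by (simp add: mat_transpose_map End_mult_closed mat_mult)
  also have "\<dots> = (\<Oplus>z\<in>wset. mat (transpose_map h) x z \<otimes> mat (transpose_map f) z y)"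
    by (rule R.finsum_cong') (use f h xy in \<open>auto simp: mat_transpose_map R.m_comm\<close>)
  also have "\<dots> = mat (transpose_map h \<otimes>\<^bsub>End\<^esub> transpose_map f) x y"
    using xy f h by (simp add: mat_mult)
  finally show "mat (transpose_map (f \<otimes>\<^bsub>End\<^esub> h)) x y = mat (transpose_map h \<otimes>\<^bsub>End\<^esub> transpose_map f) x y" .
qed (use f h in \<open>auto intro: End_mult_closed\<close>)

lemma transpose_cell_map:
  assumes "(S, T) \<in> cells"
  shows "transpose_map (cell_map S T) = cell_map T S"
proof (rule mat_eqI)
  fix x y assume xy: "x \<in> wset" "y \<in> wset"
  show "mat (transpose_map (cell_map S T)) x y = mat (cell_map T S) x y"
    using xy cell_sym[OF assms, of y x] by (simp add: mat_transpose_map mat_cell_map)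
qed auto

text \<open>\<open>f\<close> is a combination of orbital indicators with coefficients in
  \<open>R\<close>, and \<open>cell_mult\<close> applies to each indicator. Combining its integral
  coefficients over \<open>R\<close> keeps \<open>\<rho>\<close> independent of
  \<open>T\<close>.\<close>

lemma cell_map_mult:
  assumes f: "f \<in> carrier End"
  obtains \<rho> \<beta> where "\<And>S' S. \<rho> S' S \<in> carrier R" "\<And>S T c. \<beta> S T c \<in> carrier R"
    "\<And>S T. \<lbrakk>S \<in> tableaux \<nu>; T \<in> tableaux \<nu>\<rbrakk> \<Longrightarrow> f \<otimes>\<^bsub>End\<^esub> cell_map S T
      = (\<Oplus>\<^bsub>End\<^esub>S'\<in>tableaux \<nu>. \<rho> S' S \<odot>\<^bsub>End\<^esub> cell_map S' T)
        \<oplus>\<^bsub>End\<^esub> (\<Oplus>\<^bsub>End\<^esub>c\<in>cells_ge (Suc (weight \<nu>)). \<beta> S T c \<odot>\<^bsub>End\<^esub> cmap c)"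
proof -
  interpret A: module R End by (rule module_End)
  let ?H = "cells_ge (Suc (weight \<nu>))"
  obtain \<kappa> where \<kappa>: "\<kappa> \<in> orbitals \<rightarrow> carrier R"
    and matf: "\<And>x y. x \<in> wset \<Longrightarrow> y \<in> wset \<Longrightarrow> mat f x y = int_comb R orbitals \<kappa> (\<lambda>U. ind U x y)"
    using End_orbital_coeffs[OF f] by blast
  \<comment> \<open>The pair \<open>p\<close> bundles both families of coefficients, so that a
    single choice serves all orbitals.\<close>
  have "\<exists>p. \<forall>S\<in>tableaux \<nu>. \<forall>T\<in>tableaux \<nu>. \<forall>x\<in>wset. \<forall>y\<in>wset.
      (\<Sum>z\<in>wset. ind U x z * cell S T z y) = (\<Sum>S'\<in>tableaux \<nu>. fst p S' S * cell S' T x y)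
      + (\<Sum>c\<in>?H. snd p S T c * cell (fst c) (snd c) x y)" for U
  proof (rule cell_mult[OF invariant_ind[of U], of \<nu>])
    fix r a
    assume *: "\<And>S T x y. \<lbrakk>S \<in> tableaux \<nu>; T \<in> tableaux \<nu>; x \<in> wset; y \<in> wset\<rbrakk> \<Longrightarrow>
      (\<Sum>z\<in>wset. ind U x z * cell S T z y) = (\<Sum>S'\<in>tableaux \<nu>. r S' S * cell S' T x y)
      + (\<Sum>c\<in>?H. a S T c * cell (fst c) (snd c) x y)"
    show ?thesis by (rule exI[of _ "(r, a)"]) (simp add: *)
  qed
  then have "\<exists>p. \<forall>U. \<forall>S\<in>tableaux \<nu>. \<forall>T\<in>tableaux \<nu>. \<forall>x\<in>wset. \<forall>y\<in>wset.
      (\<Sum>z\<in>wset. ind U x z * cell S T z y) = (\<Sum>S'\<in>tableaux \<nu>. fst (p U) S' S * cell S' T x y)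
      + (\<Sum>c\<in>?H. snd (p U) S T c * cell (fst c) (snd c) x y)"
    by (intro choice allI)
  then obtain p where p: "(\<Sum>z\<in>wset. ind U x z * cell S T z y) = (\<Sum>S'\<in>tableaux \<nu>. fst (p U) S' S * cell S' T x y)
      + (\<Sum>c\<in>?H. snd (p U) S T c * cell (fst c) (snd c) x y)"
    if "S \<in> tableaux \<nu>" "T \<in> tableaux \<nu>" "x \<in> wset" "y \<in> wset" for U S T x y
    by blast
  define \<rho> where "\<rho> S' S = int_comb R orbitals \<kappa> (\<lambda>U. fst (p U) S' S)" for S' S
  define \<beta> where "\<beta> S T c = int_comb R orbitals \<kappa> (\<lambda>U. snd (p U) S T c)" for S T c
  have \<rho>: "\<rho> S' S \<in> carrier R" for S' S using \<kappa> by (simp add: \<rho>_def)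
  have \<beta>: "\<beta> S T c \<in> carrier R" for S T c using \<kappa> by (simp add: \<beta>_def)
  show ?thesis
  proof (rule that[OF \<rho> \<beta>], rule mat_eqI)
    fix S T assume ST: "S \<in> tableaux \<nu>" "T \<in> tableaux \<nu>"
    let ?A = "\<Oplus>\<^bsub>End\<^esub>S'\<in>tableaux \<nu>. \<rho> S' S \<odot>\<^bsub>End\<^esub> cell_map S' T"
    let ?B = "\<Oplus>\<^bsub>End\<^esub>c\<in>?H. \<beta> S T c \<odot>\<^bsub>End\<^esub> cmap c"
    have cl: "?A \<in> carrier End" "?B \<in> carrier End"
      using \<rho> \<beta> by (auto intro!: A.M.finsum_closed End_smult_closed)
    show "f \<otimes>\<^bsub>End\<^esub> cell_map S T \<in> carrier End" by (rule End_mult_closed[OF f cell_map_closed])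
    show "?A \<oplus>\<^bsub>End\<^esub> ?B \<in> carrier End" by (rule End_add_closed[OF cl])
    fix x y assume xy: "x \<in> wset" "y \<in> wset"
    have "mat (f \<otimes>\<^bsub>End\<^esub> cell_map S T) x y = (\<Oplus>z\<in>wset. mat f x z \<otimes> mat (cell_map S T) z y)"
      by (rule mat_mult[OF f cell_map_closed xy])
    also have "\<dots> = (\<Oplus>z\<in>wset. int_comb R orbitals \<kappa> (\<lambda>U. ind U x z) \<otimes> ring_int R (cell S T z y))"
      by (rule R.finsum_cong') (use xy \<kappa> in \<open>auto simp: matf mat_cell_map\<close>)
    also have "\<dots> = int_comb R orbitals \<kappa> (\<lambda>U. \<Sum>z\<in>wset. ind U x z * cell S T z y)"
      by (rule R.int_comb_sum[symmetric]) (use \<kappa> in auto)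
    also have "\<dots> = int_comb R orbitals \<kappa> (\<lambda>U. \<Sum>S'\<in>tableaux \<nu>. fst (p U) S' S * cell S' T x y)
        \<oplus> int_comb R orbitals \<kappa> (\<lambda>U. \<Sum>c\<in>?H. snd (p U) S T c * cell (fst c) (snd c) x y)"
      unfolding p[OF ST xy] by (rule R.int_comb_add[OF \<kappa>])
    also have "int_comb R orbitals \<kappa> (\<lambda>U. \<Sum>S'\<in>tableaux \<nu>. fst (p U) S' S * cell S' T x y)
        = (\<Oplus>S'\<in>tableaux \<nu>. \<rho> S' S \<otimes> ring_int R (cell S' T x y))"
      unfolding \<rho>_def by (rule R.int_comb_sum) (use \<kappa> in auto)
    also have "int_comb R orbitals \<kappa> (\<lambda>U. \<Sum>c\<in>?H. snd (p U) S T c * cell (fst c) (snd c) x y)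
        = (\<Oplus>c\<in>?H. \<beta> S T c \<otimes> ring_int R (cell (fst c) (snd c) x y))"
      unfolding \<beta>_def by (rule R.int_comb_sum) (use \<kappa> in auto)
    also have "(\<Oplus>c\<in>?H. \<beta> S T c \<otimes> ring_int R (cell (fst c) (snd c) x y)) = mat ?B x y"
      using mat_cell_sum[OF _ _ xy, of ?H "\<beta> S T"] \<beta> by (simp add: int_comb_def Pi_def)
    also have "(\<Oplus>S'\<in>tableaux \<nu>. \<rho> S' S \<otimes> ring_int R (cell S' T x y)) = mat ?A x y"
    proof -
      have "mat ?A x y = (\<Oplus>S'\<in>tableaux \<nu>. mat (\<rho> S' S \<odot>\<^bsub>End\<^esub> cell_map S' T) x y)"
        by (rule mat_finsum[OF _ _ xy]) (use \<rho> in \<open>auto intro!: End_smult_closed\<close>)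
      also have "\<dots> = (\<Oplus>S'\<in>tableaux \<nu>. \<rho> S' S \<otimes> ring_int R (cell S' T x y))"
        by (rule R.finsum_cong') (use \<rho> xy in \<open>auto simp: mat_smult mat_cell_map\<close>)
      finally show ?thesis by simp
    qed
    finally show "mat (f \<otimes>\<^bsub>End\<^esub> cell_map S T) x y = mat (?A \<oplus>\<^bsub>End\<^esub> ?B) x y"
      by (simp add: mat_add[OF cl xy])
  qed
qed

theorem cellular_End: "cellular R End"
proof (cases "\<one> = \<zero>")
  case True
  then show ?thesis by (rule cellular_zero_ring[OF assoc_algebra_End])
next
  case nz: False
  interpret A: module R End by (rule module_End)
  let ?Cell = "SIGMA \<nu>:shapes. tableaux \<nu> \<times> tableaux \<nu>"
  have snd_Cell: "snd ` ?Cell = cells" by (force simp: cells_def)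
  \<comment> \<open>A tableau determines its shape, so forgetting \<open>\<nu>\<close> in the index
    of a cell loses nothing.\<close>
  have inj_snd: "inj_on snd ?Cell" by (rule inj_onI) (auto dest!: shape_tableaux)
  have split: "(\<lambda>(\<nu>, S, T). cell_map S T) = (\<lambda>c. cmap c) \<circ> snd" by auto
  have "cell_datum R End shapes shape_order tableaux (\<lambda>_. cell_map) transpose_map"
    unfolding cell_datum_def
  proof (intro conjI ballI)
    show "partial_order_on shapes shape_order" by (rule shape_order)
    show "inj_on (\<lambda>(\<nu>, S, T). cell_map S T) ?Cell"
      unfolding split by (rule comp_inj_on[OF inj_snd]) (simp add: snd_Cell cell_map_inj nz)
    show "is_basis R End ((\<lambda>(\<nu>, S, T). cell_map S T) ` ?Cell)"
      unfolding split image_comp[symmetric] snd_Cell by (rule cell_map_basis[OF nz])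
    show "transpose_map \<in> module_hom R End End" by (rule transpose_map_hom)
  next
    fix \<nu> S T assume "\<nu> \<in> shapes" "S \<in> tableaux \<nu>" "T \<in> tableaux \<nu>"
    then show "transpose_map (cell_map S T) = cell_map T S"
      by (intro transpose_cell_map) (auto simp: cells_def)
  next
    fix \<nu> f assume \<nu>: "\<nu> \<in> shapes" and f: "f \<in> carrier End"
    have higher: "{cell_map S T |\<mu> S T. \<mu> \<in> aboveS shape_order \<nu> \<and> S \<in> tableaux \<mu> \<and> T \<in> tableaux \<mu>}
        = (\<lambda>c. cmap c) ` cells_ge (Suc (weight \<nu>))" (is "?Y = ?X")
    proof
      show "?Y \<subseteq> ?X"
      proof
        fix z assume "z \<in> ?Y"
        then obtain \<mu> S T where *: "z = cell_map S T" "\<mu> \<in> shapes" "weight \<nu> < weight \<mu>"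
          "S \<in> tableaux \<mu>" "T \<in> tableaux \<mu>"
          unfolding aboveS_shape_order[OF \<nu>] by blast
        then have "(S, T) \<in> cells_ge (Suc (weight \<nu>))" by (auto simp: cells_ge_shape Suc_le_eq)
        then show "z \<in> ?X" using *(1) by (intro image_eqI[of _ _ "(S, T)"]) simp_all
      qed
      show "?X \<subseteq> ?Y"
        unfolding aboveS_shape_order[OF \<nu>] by (clarsimp simp: cells_ge_shape Suc_le_eq) blast
    qed
    show "\<exists>\<rho>. (\<forall>S'\<in>tableaux \<nu>. \<forall>S\<in>tableaux \<nu>. \<rho> S' S \<in> carrier R) \<and>
        (\<forall>S\<in>tableaux \<nu>. \<forall>T\<in>tableaux \<nu>.
           f \<otimes>\<^bsub>End\<^esub> cell_map S T \<ominus>\<^bsub>End\<^esub> (\<Oplus>\<^bsub>End\<^esub>S'\<in>tableaux \<nu>. \<rho> S' S \<odot>\<^bsub>End\<^esub> cell_map S' T)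
             \<in> A.span {cell_map S T |\<mu> S T. \<mu> \<in> aboveS shape_order \<nu> \<and> S \<in> tableaux \<mu> \<and> T \<in> tableaux \<mu>})"
      unfolding higher
    proof (rule cell_map_mult[OF f, of \<nu>], rule exI, intro conjI ballI)
      fix \<rho> \<beta> S T
      assume \<rho>: "\<And>S' S. \<rho> S' S \<in> carrier R" and \<beta>: "\<And>S T c. \<beta> S T c \<in> carrier R"
        and eq: "\<And>S T. \<lbrakk>S \<in> tableaux \<nu>; T \<in> tableaux \<nu>\<rbrakk> \<Longrightarrow> f \<otimes>\<^bsub>End\<^esub> cell_map S T
          = (\<Oplus>\<^bsub>End\<^esub>S'\<in>tableaux \<nu>. \<rho> S' S \<odot>\<^bsub>End\<^esub> cell_map S' T)
            \<oplus>\<^bsub>End\<^esub> (\<Oplus>\<^bsub>End\<^esub>c\<in>cells_ge (Suc (weight \<nu>)). \<beta> S T c \<odot>\<^bsub>End\<^esub> cmap c)"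
        and ST: "S \<in> tableaux \<nu>" "T \<in> tableaux \<nu>"
      let ?A = "\<Oplus>\<^bsub>End\<^esub>S'\<in>tableaux \<nu>. \<rho> S' S \<odot>\<^bsub>End\<^esub> cell_map S' T"
      let ?B = "\<Oplus>\<^bsub>End\<^esub>c\<in>cells_ge (Suc (weight \<nu>)). \<beta> S T c \<odot>\<^bsub>End\<^esub> cmap c"
      have A: "?A \<in> carrier End" and B: "?B \<in> carrier End"
        using \<rho> \<beta> by (auto intro!: A.M.finsum_closed End_smult_closed)
      have "f \<otimes>\<^bsub>End\<^esub> cell_map S T \<ominus>\<^bsub>End\<^esub> ?A = ?B"
        unfolding eq[OF ST] A.M.a_comm[OF A B] using A B by (simp add: A.M.minus_eq A.M.a_assoc A.M.r_neg)
      moreover have "?B \<in> A.span ?X"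
        by (rule A.finsum_in_span) (use \<beta> in auto)
      ultimately show "f \<otimes>\<^bsub>End\<^esub> cell_map S T \<ominus>\<^bsub>End\<^esub> ?A \<in> A.span ?X" by simp
    qed
  qed (auto simp: transpose_map_involution transpose_map_mult)
  then show ?thesis by (rule cell_datum_imp_cellular[OF assoc_algebra_End])
qed

end

section \<open>Quotients and free modules\<close>

locale quotient_by = module R M for R (structure) and M (structure) and H +
  assumes H: "LinearCombinations.submodule R H M"
begin

abbreviation "Q \<equiv> quotient_module M H"

lemma H_subset: "H \<subseteq> carrier M"
  using H by (simp add: LinearCombinations.submodule_def)

lemma H_closed:
  "\<zero>\<^bsub>M\<^esub> \<in> H" "\<And>x y. x \<in> H \<Longrightarrow> y \<in> H \<Longrightarrow> x \<oplus>\<^bsub>M\<^esub> y \<in> H" "\<And>c x. c \<in> carrier R \<Longrightarrow> x \<in> H \<Longrightarrow> c \<odot>\<^bsub>M\<^esub> x \<in> H"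
  using H by (auto simp: LinearCombinations.submodule_def)

lemma H_minus: "x \<in> H \<Longrightarrow> \<ominus>\<^bsub>M\<^esub> x \<in> H"
  using H_closed(3)[of "\<ominus> \<one>" x] H_subset by (auto simp: smult_l_minus)

lemma abelian_subgroup_H: "abelian_subgroup H M"
proof (rule abelian_subgroupI3)
  show "additive_subgroup H M"
  proof
    show "H \<subseteq> carrier (add_monoid M)" using H_subset by simp
    show "\<And>x y. x \<in> H \<Longrightarrow> y \<in> H \<Longrightarrow> x \<otimes>\<^bsub>add_monoid M\<^esub> y \<in> H" using H_closed(2) by simp
    show "\<one>\<^bsub>add_monoid M\<^esub> \<in> H" using H_closed(1) by simp
    show "inv\<^bsub>add_monoid M\<^esub> x \<in> H" if "x \<in> H" for x using H_minus[OF that] by (simp add: a_inv_def)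
  qed
  show "abelian_group M" ..
qed

sublocale abelian_subgroup H M by (rule abelian_subgroup_H)

definition quot :: "'c \<Rightarrow> 'c set" where
  "quot x = H +>\<^bsub>M\<^esub> x"

lemma quot_eq_iff:
  assumes "x \<in> carrier M" "y \<in> carrier M"
  shows "quot x = quot y \<longleftrightarrow> x \<ominus>\<^bsub>M\<^esub> y \<in> H"
proof
  assume "quot x = quot y"
  then have "x \<in> H +>\<^bsub>M\<^esub> y" using a_rcos_self[OF assms(1)] by (simp add: quot_def)
  then show "x \<ominus>\<^bsub>M\<^esub> y \<in> H" using a_rcos_module[of y x] assms by (simp add: M.minus_eq)
next
  assume "x \<ominus>\<^bsub>M\<^esub> y \<in> H"
  then have "x \<in> H +>\<^bsub>M\<^esub> y" using a_rcos_module[of y x] assms by (simp add: M.minus_eq)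
  then show "quot x = quot y" unfolding quot_def
    by (rule M.a_repr_independence[symmetric, OF _ assms(2) a_subgroup])
qed

lemma carrier_Q: "carrier Q = quot ` carrier M"
  by (auto simp: quotient_module_def A_RCOSETS_def' quot_def)

lemma quot_closed [simp, intro]: "x \<in> carrier M \<Longrightarrow> quot x \<in> carrier Q"
  by (auto simp: carrier_Q)

lemma quot_add: "x \<in> carrier M \<Longrightarrow> y \<in> carrier M \<Longrightarrow> quot x \<oplus>\<^bsub>Q\<^esub> quot y = quot (x \<oplus>\<^bsub>M\<^esub> y)"
  by (simp add: quotient_module_def quot_def a_rcos_sum)

lemma quot_zero: "\<zero>\<^bsub>Q\<^esub> = quot \<zero>\<^bsub>M\<^esub>"
  using M.a_coset_join2[OF M.zero_closed a_subgroup H_closed(1)] by (simp add: quotient_module_def quot_def)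

text \<open>The scalar multiple is a union over all representatives; it is a single coset because
  \<open>H\<close> is closed under scalars.\<close>

lemma quot_smult:
  assumes "c \<in> carrier R" "x \<in> carrier M"
  shows "c \<odot>\<^bsub>Q\<^esub> quot x = quot (c \<odot>\<^bsub>M\<^esub> x)"
proof -
  have "quot (c \<odot>\<^bsub>M\<^esub> y) = quot (c \<odot>\<^bsub>M\<^esub> x)" if y: "y \<in> quot x" for y
  proof -
    have yM: "y \<in> carrier M"
      using y M.a_r_coset_subset_G[OF H_subset assms(2)] by (auto simp: quot_def)
    then have "y \<ominus>\<^bsub>M\<^esub> x \<in> H" using y a_rcos_module[of x y] assms by (simp add: quot_def M.minus_eq)
    then have "c \<odot>\<^bsub>M\<^esub> (y \<ominus>\<^bsub>M\<^esub> x) \<in> H" using H_closed(3) assms by simp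
    then show ?thesis
      using yM assms by (simp add: quot_eq_iff M.minus_eq smult_r_distr smult_r_minus)
  qed
  then have "(\<Union>y\<in>quot x. quot (c \<odot>\<^bsub>M\<^esub> y)) = (\<Union>y\<in>quot x. quot (c \<odot>\<^bsub>M\<^esub> x))"
    by (intro SUP_cong refl)
  moreover have "quot x \<noteq> {}" using a_rcos_self[OF assms(2)] by (auto simp: quot_def)
  moreover have "c \<odot>\<^bsub>Q\<^esub> quot x = (\<Union>y\<in>quot x. quot (c \<odot>\<^bsub>M\<^esub> y))"
    by (simp add: quotient_module_def quot_def)
  ultimately show ?thesis by simp
qed

lemma module_Q: "module R Q"
proof (rule module_criteria)
  show "cring R" by (rule R.is_cring)
  show "\<forall>v\<in>carrier Q. \<exists>w\<in>carrier Q. v \<oplus>\<^bsub>Q\<^esub> w = \<zero>\<^bsub>Q\<^esub>"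
  proof
    fix v assume "v \<in> carrier Q"
    then obtain x where x: "x \<in> carrier M" "v = quot x" by (auto simp: carrier_Q)
    then have "v \<oplus>\<^bsub>Q\<^esub> quot (\<ominus>\<^bsub>M\<^esub> x) = \<zero>\<^bsub>Q\<^esub>" by (simp add: quot_add quot_zero M.r_neg)
    then show "\<exists>w\<in>carrier Q. v \<oplus>\<^bsub>Q\<^esub> w = \<zero>\<^bsub>Q\<^esub>" using x by blast
  qed
qed (auto simp: carrier_Q quot_add quot_zero quot_smult smult_r_distr smult_l_distr smult_assoc1 M.a_ac)

lemma quot_hom: "quot \<in> module_hom R M Q"
  by (auto simp: module_hom_def quot_add quot_smult)

lemma quot_lift:
  assumes N: "module R N" and f: "f \<in> module_hom R M N" and zero: "\<And>h. h \<in> H \<Longrightarrow> f h = \<zero>\<^bsub>N\<^esub>"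
  obtains g where "g \<in> module_hom R Q N" "\<And>x. x \<in> carrier M \<Longrightarrow> g (quot x) = f x"
proof -
  interpret N: module R N by (rule N)
  have fM: "f x \<in> carrier N" if "x \<in> carrier M" for x using module_hom_closed[OF f] that by auto
  have eq: "f x = f y" if xy: "x \<in> carrier M" "y \<in> carrier M" "quot x = quot y" for x y
  proof -
    have "x = (x \<ominus>\<^bsub>M\<^esub> y) \<oplus>\<^bsub>M\<^esub> y" using xy by (simp add: M.minus_eq M.a_assoc M.l_neg)
    then have "f x = f (x \<ominus>\<^bsub>M\<^esub> y) \<oplus>\<^bsub>N\<^esub> f y"
      using module_hom_add[OF f, of "x \<ominus>\<^bsub>M\<^esub> y" y] xy by simp
    then show ?thesis using zero xy fM by (simp add: quot_eq_iff)
  qed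
  define g where "g S = f (SOME x. x \<in> carrier M \<and> quot x = S)" for S
  have g: "g (quot x) = f x" if x: "x \<in> carrier M" for x
  proof -
    have "(SOME y. y \<in> carrier M \<and> quot y = quot x) \<in> carrier M \<and> quot (SOME y. y \<in> carrier M \<and> quot y = quot x) = quot x"
      by (rule someI[of "\<lambda>y. y \<in> carrier M \<and> quot y = quot x" x]) (simp add: x)
    then show ?thesis unfolding g_def using eq x by blast
  qed
  have "g \<in> module_hom R Q N"
    by (auto simp: module_hom_def carrier_Q quot_add quot_smult g fM module_hom_add[OF f] module_hom_smult[OF f])
  then show ?thesis using that g by blast
qed

end

section \<open>Free modules and their universal property\<close>

lemma free_module_simps:
  "\<zero>\<^bsub>free_module R X\<^esub> = (\<lambda>x\<in>X. \<zero>\<^bsub>R\<^esub>)"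
  "f \<oplus>\<^bsub>free_module R X\<^esub> g = (\<lambda>x\<in>X. f x \<oplus>\<^bsub>R\<^esub> g x)"
  "c \<odot>\<^bsub>free_module R X\<^esub> f = (\<lambda>x\<in>X. c \<otimes>\<^bsub>R\<^esub> f x)"
  by (simp_all add: free_module_def)

lemma carrier_free_module:
  "carrier (free_module R X) = {f \<in> X \<rightarrow>\<^sub>E carrier R. finite {x \<in> X. f x \<noteq> \<zero>\<^bsub>R\<^esub>}}"
  by (simp add: free_module_def)

context cring
begin

lemma free_module_app_closed [simp, intro]: "f \<in> carrier (free_module R X) \<Longrightarrow> x \<in> X \<Longrightarrow> f x \<in> carrier R"
  by (auto simp: carrier_free_module)

lemma free_module_eqI:
  assumes "f \<in> carrier (free_module R X)" "g \<in> carrier (free_module R X)" "\<And>x. x \<in> X \<Longrightarrow> f x = g x"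
  shows "f = g"
  using assms by (auto simp: carrier_free_module intro: PiE_ext)

lemma free_module_zero_closed: "\<zero>\<^bsub>free_module R X\<^esub> \<in> carrier (free_module R X)"
  by (auto simp: carrier_free_module free_module_simps cong: conj_cong)

lemma free_module_add_closed:
  assumes "f \<in> carrier (free_module R X)" "g \<in> carrier (free_module R X)"
  shows "f \<oplus>\<^bsub>free_module R X\<^esub> g \<in> carrier (free_module R X)"
proof -
  have "{x \<in> X. f x \<oplus> g x \<noteq> \<zero>} \<subseteq> {x \<in> X. f x \<noteq> \<zero>} \<union> {x \<in> X. g x \<noteq> \<zero>}" by auto
  then have "finite {x \<in> X. f x \<oplus> g x \<noteq> \<zero>}"
    using assms by (elim finite_subset) (simp add: carrier_free_module)
  then show ?thesis using assms by (auto simp: carrier_free_module free_module_simps cong: conj_cong)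
qed

lemma free_module_smult_closed:
  assumes "c \<in> carrier R" "f \<in> carrier (free_module R X)"
  shows "c \<odot>\<^bsub>free_module R X\<^esub> f \<in> carrier (free_module R X)"
proof -
  have "{x \<in> X. c \<otimes> f x \<noteq> \<zero>} \<subseteq> {x \<in> X. f x \<noteq> \<zero>}" using assms(1) by auto
  then have "finite {x \<in> X. c \<otimes> f x \<noteq> \<zero>}"
    using assms by (elim finite_subset) (simp add: carrier_free_module)
  then show ?thesis using assms by (auto simp: carrier_free_module free_module_simps cong: conj_cong)
qed

lemma module_free_module: "module R (free_module R X)" (is "module R ?F")
proof (rule module_criteria)
  show "cring R" by (rule is_cring)
  note cl = free_module_zero_closed free_module_add_closed free_module_smult_closed
  show "\<forall>v\<in>carrier ?F. \<exists>w\<in>carrier ?F. v \<oplus>\<^bsub>?F\<^esub> w = \<zero>\<^bsub>?F\<^esub>"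
  proof
    fix f assume f: "f \<in> carrier ?F"
    have "f \<oplus>\<^bsub>?F\<^esub> (\<ominus> \<one>) \<odot>\<^bsub>?F\<^esub> f = \<zero>\<^bsub>?F\<^esub>"
      unfolding free_module_simps
      by (rule restrict_ext) (use f in \<open>simp add: l_minus r_neg\<close>)
    then show "\<exists>w\<in>carrier ?F. f \<oplus>\<^bsub>?F\<^esub> w = \<zero>\<^bsub>?F\<^esub>"
      using cl(3)[of "\<ominus> \<one>" f] f by blast
  qed
  show "\<forall>v w. v \<in> carrier ?F \<and> w \<in> carrier ?F \<longrightarrow> v \<oplus>\<^bsub>?F\<^esub> w \<in> carrier ?F" using cl by blast
  show "\<forall>c v. c \<in> carrier R \<and> v \<in> carrier ?F \<longrightarrow> c \<odot>\<^bsub>?F\<^esub> v \<in> carrier ?F" using cl by blast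
  show "\<forall>v\<in>carrier ?F. v \<oplus>\<^bsub>?F\<^esub> \<zero>\<^bsub>?F\<^esub> = v"
    by (intro ballI free_module_eqI[OF cl(2)[OF _ cl(1)]]) (simp_all add: free_module_simps)
  show "\<forall>v\<in>carrier ?F. \<one> \<odot>\<^bsub>?F\<^esub> v = v"
    by (intro ballI free_module_eqI[OF cl(3)[OF one_closed]]) (simp_all add: free_module_simps)
  show "\<zero>\<^bsub>?F\<^esub> \<in> carrier ?F" by (rule cl)
  show "\<forall>v w. v \<in> carrier ?F \<and> w \<in> carrier ?F \<longrightarrow> v \<oplus>\<^bsub>?F\<^esub> w = w \<oplus>\<^bsub>?F\<^esub> v"
    unfolding free_module_simps by (intro allI impI restrict_ext, elim conjE) (simp add: a_comm)
  show "\<forall>v w x. v \<in> carrier ?F \<and> w \<in> carrier ?F \<and> x \<in> carrier ?F \<longrightarrow> v \<oplus>\<^bsub>?F\<^esub> w \<oplus>\<^bsub>?F\<^esub> x = v \<oplus>\<^bsub>?F\<^esub> (w \<oplus>\<^bsub>?F\<^esub> x)"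
    unfolding free_module_simps by (intro allI impI restrict_ext, elim conjE) (simp add: a_assoc)
  show "\<forall>a b v. a \<in> carrier R \<and> b \<in> carrier R \<and> v \<in> carrier ?F \<longrightarrow> (a \<otimes> b) \<odot>\<^bsub>?F\<^esub> v = a \<odot>\<^bsub>?F\<^esub> (b \<odot>\<^bsub>?F\<^esub> v)"
    unfolding free_module_simps by (intro allI impI restrict_ext, elim conjE) (simp add: m_assoc)
  show "\<forall>a b v. a \<in> carrier R \<and> b \<in> carrier R \<and> v \<in> carrier ?F \<longrightarrow>
      (a \<oplus> b) \<odot>\<^bsub>?F\<^esub> v = a \<odot>\<^bsub>?F\<^esub> v \<oplus>\<^bsub>?F\<^esub> b \<odot>\<^bsub>?F\<^esub> v"
    unfolding free_module_simps by (intro allI impI restrict_ext, elim conjE) (simp add: l_distr)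
  show "\<forall>a v w. a \<in> carrier R \<and> v \<in> carrier ?F \<and> w \<in> carrier ?F \<longrightarrow>
      a \<odot>\<^bsub>?F\<^esub> (v \<oplus>\<^bsub>?F\<^esub> w) = a \<odot>\<^bsub>?F\<^esub> v \<oplus>\<^bsub>?F\<^esub> a \<odot>\<^bsub>?F\<^esub> w"
    unfolding free_module_simps by (intro allI impI restrict_ext, elim conjE) (simp add: r_distr)
qed

lemma free_gen_closed [simp, intro]: "x \<in> X \<Longrightarrow> free_gen R X x \<in> carrier (free_module R X)"
proof -
  assume "x \<in> X"
  have "{y \<in> X. free_gen R X x y \<noteq> \<zero>} \<subseteq> {x}" by (auto simp: free_gen_def)
  then have "finite {y \<in> X. free_gen R X x y \<noteq> \<zero>}" by (rule finite_subset) simp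
  then show ?thesis by (auto simp: carrier_free_module free_gen_def)
qed

lemma free_module_finsum_app:
  assumes "finite J" "f \<in> J \<rightarrow> carrier (free_module R X)" "x \<in> X"
  shows "(\<Oplus>\<^bsub>free_module R X\<^esub>j\<in>J. f j) x = (\<Oplus>j\<in>J. f j x)"
  using assms(1,2)
proof (induction J rule: finite_induct)
  interpret F: module R "free_module R X" by (rule module_free_module)
  case empty
  then show ?case using assms(3) by (simp add: free_module_simps)
next
  interpret F: module R "free_module R X" by (rule module_free_module)
  case (insert j J)
  then have fx: "f i x \<in> carrier R" if "i \<in> insert j J" for i
    using that assms(3) free_module_app_closed[of "f i" X x] by auto
  have "(\<Oplus>\<^bsub>free_module R X\<^esub>j\<in>insert j J. f j) x = f j x \<oplus> (\<Oplus>\<^bsub>free_module R X\<^esub>j\<in>J. f j) x"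
    using insert assms(3) by (subst F.M.finsum_insert) (auto simp: free_module_simps)
  also have "\<dots> = (\<Oplus>j\<in>insert j J. f j x)"
    using insert fx by (subst finsum_insert) auto
  finally show ?case .
qed

lemma free_module_comb_app:
  assumes "finite J" "J \<subseteq> X" "c \<in> J \<rightarrow> carrier R" "x \<in> X"
  shows "(\<Oplus>\<^bsub>free_module R X\<^esub>j\<in>J. c j \<odot>\<^bsub>free_module R X\<^esub> free_gen R X j) x = (if x \<in> J then c x else \<zero>)"
proof -
  have "(\<Oplus>\<^bsub>free_module R X\<^esub>j\<in>J. c j \<odot>\<^bsub>free_module R X\<^esub> free_gen R X j) x
      = (\<Oplus>j\<in>J. (c j \<odot>\<^bsub>free_module R X\<^esub> free_gen R X j) x)"
    by (rule free_module_finsum_app) (use assms in \<open>auto intro!: free_module_smult_closed simp: Pi_def\<close>)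
  also have "\<dots> = (\<Oplus>j\<in>J. if x = j then c j else \<zero>)"
    by (rule finsum_cong') (use assms in \<open>auto simp: free_module_simps free_gen_def Pi_def\<close>)
  also have "\<dots> = (if x \<in> J then c x else \<zero>)"
  proof (cases "x \<in> J")
    case True
    then show ?thesis using finsum_singleton[of x J c] assms by simp
  next
    case False
    then have "(\<Oplus>j\<in>J. if x = j then c j else \<zero>) = \<zero>" by (intro finsum_all0) auto
    then show ?thesis using False by simp
  qed
  finally show ?thesis .
qed

lemma free_module_expand:
  assumes f: "f \<in> carrier (free_module R X)" and S: "finite S" "S \<subseteq> X" "{x \<in> X. f x \<noteq> \<zero>} \<subseteq> S"
  shows "f = (\<Oplus>\<^bsub>free_module R X\<^esub>x\<in>S. f x \<odot>\<^bsub>free_module R X\<^esub> free_gen R X x)"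
proof -
  interpret F: module R "free_module R X" by (rule module_free_module)
  show ?thesis
  proof (rule free_module_eqI[OF f])
    show "(\<Oplus>\<^bsub>free_module R X\<^esub>x\<in>S. f x \<odot>\<^bsub>free_module R X\<^esub> free_gen R X x) \<in> carrier (free_module R X)"
      by (rule F.M.finsum_closed) (use f S in auto)
    fix x assume x: "x \<in> X"
    have "f \<in> S \<rightarrow> carrier R" using f S(2) by (auto simp: carrier_free_module)
    from free_module_comb_app[OF S(1,2) this x]
    show "f x = (\<Oplus>\<^bsub>free_module R X\<^esub>x\<in>S. f x \<odot>\<^bsub>free_module R X\<^esub> free_gen R X x) x"
      using S(3) x by auto
  qed
qed

lemma free_module_basis:
  assumes "finite X"
  shows "basis_family R (free_module R X) X (free_gen R X)"
  unfolding basis_family_def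
proof (intro conjI ballI)
  fix f assume f: "f \<in> carrier (free_module R X)"
  show "\<exists>!c. c \<in> X \<rightarrow>\<^sub>E carrier R \<and> f = (\<Oplus>\<^bsub>free_module R X\<^esub>x\<in>X. c x \<odot>\<^bsub>free_module R X\<^esub> free_gen R X x)"
  proof (rule ex1I[of _ f])
    show "f \<in> X \<rightarrow>\<^sub>E carrier R \<and> f = (\<Oplus>\<^bsub>free_module R X\<^esub>x\<in>X. f x \<odot>\<^bsub>free_module R X\<^esub> free_gen R X x)"
      using free_module_expand[OF f, of X] f assms by (auto simp: carrier_free_module)
    fix c assume c: "c \<in> X \<rightarrow>\<^sub>E carrier R \<and> f = (\<Oplus>\<^bsub>free_module R X\<^esub>x\<in>X. c x \<odot>\<^bsub>free_module R X\<^esub> free_gen R X x)"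
    have "f x = c x" if "x \<in> X" for x
      using free_module_comb_app[of X X c x] c that assms by auto
    then show "c = f" using c f by (auto simp: carrier_free_module intro: PiE_ext)
  qed
qed (use assms in auto)

end

text \<open>The sum runs over the support, which is finite although \<open>X\<close>, later a set of
  tuples of vectors, need not be.\<close>

definition free_lift :: "('a, 'm) ring_scheme \<Rightarrow> ('a, 'n, 'k) module_scheme \<Rightarrow> 'x set \<Rightarrow> ('x \<Rightarrow> 'n) \<Rightarrow> ('x \<Rightarrow> 'a) \<Rightarrow> 'n" where
  "free_lift R N X m f = (\<Oplus>\<^bsub>N\<^esub>x\<in>{x \<in> X. f x \<noteq> \<zero>\<^bsub>R\<^esub>}. f x \<odot>\<^bsub>N\<^esub> m x)"

context module
begin

text \<open>Supports change under addition and scaling; sums over a common finite superset can be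
  compared termwise.\<close>

lemma free_lift_superset:
  assumes m: "m \<in> X \<rightarrow> carrier M" and f: "f \<in> carrier (free_module R X)"
    and S: "finite S" "S \<subseteq> X" "{x \<in> X. f x \<noteq> \<zero>} \<subseteq> S"
  shows "free_lift R M X m f = (\<Oplus>\<^bsub>M\<^esub>x\<in>S. f x \<odot>\<^bsub>M\<^esub> m x)"
  unfolding free_lift_def
  by (rule M.add.finprod_mono_neutral_cong_left[OF S(1,3)]) (use S(2) m f in \<open>auto simp: Pi_def\<close>)

lemma free_lift_hom:
  assumes m: "m \<in> X \<rightarrow> carrier M"
  shows "free_lift R M X m \<in> module_hom R (free_module R X) M"
  unfolding module_hom_def mem_Collect_eq
proof (intro conjI allI impI funcsetI)
  have mc: "m x \<in> carrier M" if "x \<in> X" for x using m that by auto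
  {
    fix f assume "f \<in> carrier (free_module R X)"
    then show "free_lift R M X m f \<in> carrier M"
      unfolding free_lift_def by (intro M.finsum_closed) (use mc in auto)
  next
    fix f g assume "f \<in> carrier (free_module R X) \<and> g \<in> carrier (free_module R X)"
    then have f: "f \<in> carrier (free_module R X)" and g: "g \<in> carrier (free_module R X)" by auto
    let ?S = "{x \<in> X. f x \<noteq> \<zero>} \<union> {x \<in> X. g x \<noteq> \<zero>}"
    have S: "finite ?S" "?S \<subseteq> X" using f g by (auto simp: carrier_free_module)
    have "free_lift R M X m (f \<oplus>\<^bsub>free_module R X\<^esub> g) = (\<Oplus>\<^bsub>M\<^esub>x\<in>?S. (f \<oplus>\<^bsub>free_module R X\<^esub> g) x \<odot>\<^bsub>M\<^esub> m x)"
      by (rule free_lift_superset[OF m R.free_module_add_closed[OF f g] S]) (auto simp: free_module_simps)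
    also have "\<dots> = (\<Oplus>\<^bsub>M\<^esub>x\<in>?S. f x \<odot>\<^bsub>M\<^esub> m x \<oplus>\<^bsub>M\<^esub> g x \<odot>\<^bsub>M\<^esub> m x)"
      by (rule M.finsum_cong') (use S f g mc in \<open>auto simp: free_module_simps smult_l_distr\<close>)
    also have "\<dots> = (\<Oplus>\<^bsub>M\<^esub>x\<in>?S. f x \<odot>\<^bsub>M\<^esub> m x) \<oplus>\<^bsub>M\<^esub> (\<Oplus>\<^bsub>M\<^esub>x\<in>?S. g x \<odot>\<^bsub>M\<^esub> m x)"
      by (rule M.finsum_addf) (use S f g mc in auto)
    also have "(\<Oplus>\<^bsub>M\<^esub>x\<in>?S. f x \<odot>\<^bsub>M\<^esub> m x) = free_lift R M X m f"
      by (rule free_lift_superset[OF m f S, symmetric]) auto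
    also have "(\<Oplus>\<^bsub>M\<^esub>x\<in>?S. g x \<odot>\<^bsub>M\<^esub> m x) = free_lift R M X m g"
      by (rule free_lift_superset[OF m g S, symmetric]) auto
    finally show "free_lift R M X m (f \<oplus>\<^bsub>free_module R X\<^esub> g) = free_lift R M X m f \<oplus>\<^bsub>M\<^esub> free_lift R M X m g" .
  next
    fix c f assume "c \<in> carrier R \<and> f \<in> carrier (free_module R X)"
    then have c: "c \<in> carrier R" and f: "f \<in> carrier (free_module R X)" by auto
    let ?S = "{x \<in> X. f x \<noteq> \<zero>}"
    have S: "finite ?S" "?S \<subseteq> X" using f by (auto simp: carrier_free_module)
    have "free_lift R M X m (c \<odot>\<^bsub>free_module R X\<^esub> f) = (\<Oplus>\<^bsub>M\<^esub>x\<in>?S. (c \<odot>\<^bsub>free_module R X\<^esub> f) x \<odot>\<^bsub>M\<^esub> m x)"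
      by (rule free_lift_superset[OF m R.free_module_smult_closed[OF c f] S]) (use c in \<open>auto simp: free_module_simps\<close>)
    also have "\<dots> = (\<Oplus>\<^bsub>M\<^esub>x\<in>?S. c \<odot>\<^bsub>M\<^esub> (f x \<odot>\<^bsub>M\<^esub> m x))"
      by (rule M.finsum_cong') (use c S f mc in \<open>auto simp: free_module_simps smult_assoc1\<close>)
    also have "\<dots> = c \<odot>\<^bsub>M\<^esub> free_lift R M X m f"
      unfolding free_lift_def by (rule finsum_smult[symmetric]) (use c S f mc in auto)
    finally show "free_lift R M X m (c \<odot>\<^bsub>free_module R X\<^esub> f) = c \<odot>\<^bsub>M\<^esub> free_lift R M X m f" .
  }
qed

lemma free_lift_gen:
  assumes m: "m \<in> X \<rightarrow> carrier M" and x: "x \<in> X"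
  shows "free_lift R M X m (free_gen R X x) = m x"
proof -
  have "free_lift R M X m (free_gen R X x) = (\<Oplus>\<^bsub>M\<^esub>y\<in>{x}. free_gen R X x y \<odot>\<^bsub>M\<^esub> m y)"
    by (rule free_lift_superset[OF m R.free_gen_closed[OF x]]) (use x in \<open>auto simp: free_gen_def\<close>)
  also have "\<dots> = m x" using m x by (simp add: free_gen_def Pi_def)
  finally show ?thesis .
qed

lemma free_module_hom_eqI:
  assumes f: "f \<in> module_hom R (free_module R X) M" and g: "g \<in> module_hom R (free_module R X) M"
    and eq: "\<And>x. x \<in> X \<Longrightarrow> f (free_gen R X x) = g (free_gen R X x)" and v: "v \<in> carrier (free_module R X)"
  shows "f v = g v"
proof -
  interpret F: module R "free_module R X" by (rule R.module_free_module)
  let ?S = "{x \<in> X. v x \<noteq> \<zero>}"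
  have S: "finite ?S" using v by (simp add: carrier_free_module)
  have h: "h v = (\<Oplus>\<^bsub>M\<^esub>x\<in>?S. v x \<odot>\<^bsub>M\<^esub> h (free_gen R X x))" if h: "h \<in> module_hom R (free_module R X) M" for h
  proof -
    have "h v = h (\<Oplus>\<^bsub>free_module R X\<^esub>x\<in>?S. v x \<odot>\<^bsub>free_module R X\<^esub> free_gen R X x)"
      using R.free_module_expand[OF v S] by simp
    also have "\<dots> = (\<Oplus>\<^bsub>M\<^esub>x\<in>?S. h (v x \<odot>\<^bsub>free_module R X\<^esub> free_gen R X x))"
      by (rule F.module_hom_finsum[OF module_axioms h S]) (use v in auto)
    also have "\<dots> = (\<Oplus>\<^bsub>M\<^esub>x\<in>?S. v x \<odot>\<^bsub>M\<^esub> h (free_gen R X x))"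
      by (rule M.finsum_cong')
        (use v module_hom_closed[OF h] module_hom_smult[OF h] in \<open>auto simp: Pi_def\<close>)
    finally show ?thesis .
  qed
  show ?thesis
    unfolding h[OF f] h[OF g]
    by (rule M.finsum_cong') (use v eq module_hom_closed[OF g] in \<open>auto simp: Pi_def\<close>)
qed

end

section \<open>Tensor powers\<close>

definition multilinear ::
  "('a, 'm) ring_scheme \<Rightarrow> ('a, 'b, 'k) module_scheme \<Rightarrow> nat \<Rightarrow> ('a, 'n, 'l) module_scheme \<Rightarrow>
   ((nat \<Rightarrow> 'b) \<Rightarrow> 'n) \<Rightarrow> bool" where
  "multilinear R E r N m \<longleftrightarrow> m \<in> tuples r (carrier E) \<rightarrow> carrier N \<and>
     (\<forall>x\<in>tuples r (carrier E). \<forall>k\<in>{1..r}. \<forall>a\<in>carrier E. \<forall>b\<in>carrier E.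
        m (x(k := a \<oplus>\<^bsub>E\<^esub> b)) = m (x(k := a)) \<oplus>\<^bsub>N\<^esub> m (x(k := b))) \<and>
     (\<forall>x\<in>tuples r (carrier E). \<forall>k\<in>{1..r}. \<forall>c\<in>carrier R. \<forall>a\<in>carrier E.
        m (x(k := c \<odot>\<^bsub>E\<^esub> a)) = c \<odot>\<^bsub>N\<^esub> m (x(k := a)))"

text \<open>Otherwise \<open>{1..r}\<close> is rewritten to \<open>{Suc 0..r}\<close>, to which the facts about \<open>tuples r\<close> do not apply.\<close>

declare One_nat_def [simp del]

lemma tuples_upd: "x \<in> tuples r A \<Longrightarrow> k \<in> {1..r} \<Longrightarrow> a \<in> A \<Longrightarrow> x(k := a) \<in> tuples r A"
  by (auto simp: PiE_iff extensional_def)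

locale tensor_module = module R E for R (structure) and E (structure) +
  fixes r :: nat
begin

abbreviation "X \<equiv> tuples r (carrier E)"
abbreviation "F \<equiv> free_module R X"
abbreviation "T \<equiv> tensor_power R E r"
abbreviation "pure \<equiv> pure_tensor R E r"

lemma module_F: "module R F"
  by (rule R.module_free_module)

lemma tensor_relations_cases:
  assumes "v \<in> tensor_relations R E r"
  obtains (add) x k a b where "x \<in> X" "k \<in> {1..r}" "a \<in> carrier E" "b \<in> carrier E"
      "v = free_gen R X (x(k := a \<oplus>\<^bsub>E\<^esub> b)) \<ominus>\<^bsub>F\<^esub> (free_gen R X (x(k := a)) \<oplus>\<^bsub>F\<^esub> free_gen R X (x(k := b)))"
  | (smult) x k c a where "x \<in> X" "k \<in> {1..r}" "c \<in> carrier R" "a \<in> carrier E"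
      "v = free_gen R X (x(k := c \<odot>\<^bsub>E\<^esub> a)) \<ominus>\<^bsub>F\<^esub> c \<odot>\<^bsub>F\<^esub> free_gen R X (x(k := a))"
  using assms unfolding tensor_relations_def Let_def by blast

lemma tensor_relations_closed: "tensor_relations R E r \<subseteq> carrier F"
proof
  interpret F: module R F by (rule module_F)
  fix v assume "v \<in> tensor_relations R E r"
  then show "v \<in> carrier F"
    by (cases rule: tensor_relations_cases) (auto intro!: F.M.minus_closed F.M.a_closed F.smult_closed R.free_gen_closed tuples_upd)
qed

sublocale Qt: quotient_by R F "tensor_kernel R E r"
  rewrites "quotient_module F (tensor_kernel R E r) = T"
proof -
  interpret F: module R F by (rule module_F)
  show "quotient_by R F (tensor_kernel R E r)"
    unfolding tensor_kernel_def
    by (rule quotient_by.intro[OF module_F quotient_by_axioms.intro])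
      (rule F.span_is_submodule[OF tensor_relations_closed])
  show "quotient_module F (tensor_kernel R E r) = T" by (simp add: tensor_power_def)
qed

lemma module_T: "module R T"
  by (rule Qt.module_Q)

lemma pure_quot: "pure x = Qt.quot (free_gen R X x)"
  by (simp add: pure_tensor_def Qt.quot_def)

lemma relations_kernel: "tensor_relations R E r \<subseteq> tensor_kernel R E r"
  unfolding tensor_kernel_def
  by (rule module.in_own_span[OF module_F tensor_relations_closed])

lemma multilinear_pure: "multilinear R E r T pure"
  unfolding multilinear_def
proof (intro conjI ballI)
  show "pure \<in> X \<rightarrow> carrier T" by (auto simp: pure_quot)
  fix x k assume x: "x \<in> X" and k: "k \<in> {1..r}"
  have gen: "free_gen R X (x(k := a)) \<in> carrier F" if "a \<in> carrier E" for a
    using x k that by (intro R.free_gen_closed tuples_upd)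
  {
    fix a b assume ab: "a \<in> carrier E" "b \<in> carrier E"
    have "free_gen R X (x(k := a \<oplus>\<^bsub>E\<^esub> b)) \<ominus>\<^bsub>F\<^esub> (free_gen R X (x(k := a)) \<oplus>\<^bsub>F\<^esub> free_gen R X (x(k := b)))
        \<in> tensor_relations R E r"
      unfolding tensor_relations_def Let_def using x k ab by blast
    then show "pure (x(k := a \<oplus>\<^bsub>E\<^esub> b)) = pure (x(k := a)) \<oplus>\<^bsub>T\<^esub> pure (x(k := b))"
      unfolding pure_quot using relations_kernel ab
      by (subst Qt.quot_add) (auto simp: gen Qt.quot_eq_iff)
  next
    fix c a assume ca: "c \<in> carrier R" "a \<in> carrier E"
    have "free_gen R X (x(k := c \<odot>\<^bsub>E\<^esub> a)) \<ominus>\<^bsub>F\<^esub> c \<odot>\<^bsub>F\<^esub> free_gen R X (x(k := a)) \<in> tensor_relations R E r"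
      unfolding tensor_relations_def Let_def using x k ca by blast
    then show "pure (x(k := c \<odot>\<^bsub>E\<^esub> a)) = c \<odot>\<^bsub>T\<^esub> pure (x(k := a))"
      unfolding pure_quot using relations_kernel ca
      by (subst Qt.quot_smult) (auto simp: gen Qt.quot_eq_iff)
  }
qed

lemma pure_closed [simp, intro]: "x \<in> X \<Longrightarrow> pure x \<in> carrier T"
  by (auto simp: pure_quot)

text \<open>The linear extension of \<open>m\<close> to \<open>F\<close> kills the defining
  relations by multilinearity, hence their span, and so descends to the quotient.\<close>

lemma tensor_lift:
  assumes N: "module R N" and m: "multilinear R E r N m"
  obtains h where "h \<in> module_hom R T N" "\<And>x. x \<in> X \<Longrightarrow> h (pure x) = m x"
proof -
  interpret N: module R N by (rule N)
  have mX: "m \<in> X \<rightarrow> carrier N" using m by (simp add: multilinear_def)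
  let ?f = "free_lift R N X m"
  have hom: "?f \<in> module_hom R F N" by (rule N.free_lift_hom[OF mX])
  have gen: "?f (free_gen R X x) = m x" if "x \<in> X" for x by (rule N.free_lift_gen[OF mX that])
  have minus: "?f (u \<ominus>\<^bsub>F\<^esub> v) = \<zero>\<^bsub>N\<^esub>" if uv: "u \<in> carrier F" "v \<in> carrier F" "?f u = ?f v" for u v
  proof -
    have "u = (u \<ominus>\<^bsub>F\<^esub> v) \<oplus>\<^bsub>F\<^esub> v" using uv by (simp add: Qt.M.minus_eq Qt.M.a_assoc Qt.M.l_neg)
    then have "?f u = ?f (u \<ominus>\<^bsub>F\<^esub> v) \<oplus>\<^bsub>N\<^esub> ?f v"
      using module_hom_add[OF hom, of "u \<ominus>\<^bsub>F\<^esub> v" v] uv by simp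
    then show ?thesis
      using uv funcset_mem[OF module_hom_closed[OF hom], of "u \<ominus>\<^bsub>F\<^esub> v"]
        funcset_mem[OF module_hom_closed[OF hom], of v] by simp
  qed
  have rel: "?f v = \<zero>\<^bsub>N\<^esub>" if "v \<in> tensor_relations R E r" for v
    using that
  proof (cases rule: tensor_relations_cases)
    case (add x k a b)
    note g = R.free_gen_closed[OF tuples_upd[OF add(1,2)]]
    show ?thesis
      unfolding add(5)
    proof (rule minus)
      show "?f (free_gen R X (x(k := a \<oplus>\<^bsub>E\<^esub> b))) = ?f (free_gen R X (x(k := a)) \<oplus>\<^bsub>F\<^esub> free_gen R X (x(k := b)))"
        using m add(1-4) tuples_upd[OF add(1,2)]
        by (simp add: module_hom_add[OF hom g g] gen multilinear_def)
    qed (use add g in auto)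
  next
    case (smult x k c a)
    note g = R.free_gen_closed[OF tuples_upd[OF smult(1,2)]]
    show ?thesis
      unfolding smult(5)
    proof (rule minus)
      show "?f (free_gen R X (x(k := c \<odot>\<^bsub>E\<^esub> a))) = ?f (c \<odot>\<^bsub>F\<^esub> free_gen R X (x(k := a)))"
        using m smult(1-4) tuples_upd[OF smult(1,2)]
        by (simp add: module_hom_smult[OF hom smult(3) g] gen multilinear_def)
    qed (use smult g in auto)
  qed
  have ker: "?f v = \<zero>\<^bsub>N\<^esub>" if "v \<in> tensor_kernel R E r" for v
  proof -
    from that obtain A a where A: "finite A" "A \<subseteq> tensor_relations R E r" "a \<in> A \<rightarrow> carrier R"
      "v = Qt.lincomb a A"
      unfolding tensor_kernel_def Qt.span_def by blast
    have AF: "A \<subseteq> carrier F" using A(2) tensor_relations_closed by blast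
    have "?f v = (\<Oplus>\<^bsub>N\<^esub>u\<in>A. ?f (a u \<odot>\<^bsub>F\<^esub> u))"
      unfolding A(4) Qt.lincomb_def by (rule Qt.module_hom_finsum[OF N hom A(1)]) (use A AF in auto)
    also have "\<dots> = \<zero>\<^bsub>N\<^esub>"
    proof (rule N.M.finsum_all0)
      fix u assume u: "u \<in> A"
      then have "a u \<in> carrier R" "u \<in> carrier F" "?f u = \<zero>\<^bsub>N\<^esub>" using A AF rel by auto
      then show "?f (a u \<odot>\<^bsub>F\<^esub> u) = \<zero>\<^bsub>N\<^esub>" by (simp add: module_hom_smult[OF hom])
    qed
    finally show ?thesis .
  qed
  obtain h where h: "h \<in> module_hom R T N" "\<And>v. v \<in> carrier F \<Longrightarrow> h (Qt.quot v) = ?f v"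
    using Qt.quot_lift[OF N hom ker] by blast
  show ?thesis by (rule that[OF h(1)]) (simp add: pure_quot h(2) gen)
qed

lemma tensor_hom_eqI:
  assumes N: "module R N" and f: "f \<in> module_hom R T N" and g: "g \<in> module_hom R T N"
    and eq: "\<And>x. x \<in> X \<Longrightarrow> f (pure x) = g (pure x)" and t: "t \<in> carrier T"
  shows "f t = g t"
proof -
  interpret N: module R N by (rule N)
  obtain v where v: "v \<in> carrier F" "t = Qt.quot v" using t by (auto simp: Qt.carrier_Q)
  have "(\<lambda>v. f (Qt.quot v)) v = (\<lambda>v. g (Qt.quot v)) v"
    by (rule N.free_module_hom_eqI[OF module_hom_comp[OF f Qt.quot_hom] module_hom_comp[OF g Qt.quot_hom] _ v(1)])
      (simp add: eq pure_quot[symmetric])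
  then show ?thesis using v by simp
qed

text \<open>The definite description denotes because existence follows from
  \<open>tensor_lift\<close> and uniqueness from \<open>tensor_hom_eqI\<close> together with
  extensionality on the carrier.\<close>

lemma tensor_map:
  assumes g: "g \<in> module_hom R E E"
  shows "tensor_map R E r g \<in> module_hom R T T"
    and "x \<in> X \<Longrightarrow> tensor_map R E r g (pure x) = pure (compose {1..r} g x)"
proof -
  have gE: "g a \<in> carrier E" if "a \<in> carrier E" for a using module_hom_closed[OF g] that by auto
  have upd: "compose {1..r} g (x(k := a)) = (compose {1..r} g x)(k := g a)" if "k \<in> {1..r}" for x k a
    using that by (auto simp: compose_def)
  have cX: "compose {1..r} g x \<in> X" if "x \<in> X" for x using that gE by (auto simp: compose_def)
  have "multilinear R E r T (\<lambda>x. pure (compose {1..r} g x))"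
    using multilinear_pure cX
    unfolding multilinear_def by (auto simp: upd module_hom_add[OF g] module_hom_smult[OF g] gE)
  then obtain h where h: "h \<in> module_hom R T T" "\<And>x. x \<in> X \<Longrightarrow> h (pure x) = pure (compose {1..r} g x)"
    using tensor_lift[OF module_T] by blast
  let ?P = "\<lambda>h. h \<in> module_hom R T T \<inter> extensional (carrier T) \<and>
      (\<forall>x\<in>X. h (pure x) = pure (compose {1..r} g x))"
  interpret T: module R T by (rule module_T)
  have "?P (tensor_map R E r g)"
    unfolding tensor_map_def
  proof (rule theI[where P = ?P and a = "restrict h (carrier T)"])
    show "?P (restrict h (carrier T))" using h by (auto intro: T.module_hom_restrict)
    fix k assume k: "?P k"
    have "k t = h t" if "t \<in> carrier T" for t
      by (rule tensor_hom_eqI[OF module_T _ h(1) _ that]) (use k h(2) in auto)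
    then show "k = restrict h (carrier T)"
      using k by (intro extensionalityI[of k "carrier T"]) auto
  qed
  then show "tensor_map R E r g \<in> module_hom R T T"
    and "x \<in> X \<Longrightarrow> tensor_map R E r g (pure x) = pure (compose {1..r} g x)" by auto
qed

end

section \<open>Multi-indices\<close>

lemma basis_family_iso:
  assumes M: "module R M" and N: "module R N" and b: "basis_family R M I b"
    and f: "f \<in> module_hom R M N" "bij_betw f (carrier M) (carrier N)"
    and c: "\<And>i. i \<in> I \<Longrightarrow> c i = f (b i)"
  shows "basis_family R N I c"
proof -
  interpret M: module R M by (rule M)
  interpret N: module R N by (rule N)
  have bM: "b i \<in> carrier M" if "i \<in> I" for i
    using b that by (auto simp: basis_family_def)
  have fin: "finite I" using b by (simp add: basis_family_def)
  have fM: "f x \<in> carrier N" if "x \<in> carrier M" for x using module_hom_closed[OF f(1)] that by auto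
  have inj: "inj_on f (carrier M)" using f(2) by (simp add: bij_betw_def)
  have im: "f (\<Oplus>\<^bsub>M\<^esub>i\<in>I. d i \<odot>\<^bsub>M\<^esub> b i) = (\<Oplus>\<^bsub>N\<^esub>i\<in>I. d i \<odot>\<^bsub>N\<^esub> c i)"
    if d: "d \<in> I \<rightarrow>\<^sub>E carrier R" for d
  proof -
    have dR: "d i \<in> carrier R" if "i \<in> I" for i using d that by auto
    have "f (\<Oplus>\<^bsub>M\<^esub>i\<in>I. d i \<odot>\<^bsub>M\<^esub> b i) = (\<Oplus>\<^bsub>N\<^esub>i\<in>I. f (d i \<odot>\<^bsub>M\<^esub> b i))"
      by (rule M.module_hom_finsum[OF N f(1) fin]) (use dR bM in auto)
    also have "\<dots> = (\<Oplus>\<^bsub>N\<^esub>i\<in>I. d i \<odot>\<^bsub>N\<^esub> c i)"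
      by (rule N.M.finsum_cong') (use dR bM fM c in \<open>auto simp: module_hom_smult[OF f(1)]\<close>)
    finally show ?thesis .
  qed
  have sumM: "(\<Oplus>\<^bsub>M\<^esub>i\<in>I. d i \<odot>\<^bsub>M\<^esub> b i) \<in> carrier M" if "d \<in> I \<rightarrow>\<^sub>E carrier R" for d
    by (rule M.M.finsum_closed) (use that bM in auto)
  show ?thesis
    unfolding basis_family_def
  proof (intro conjI ballI)
    show "finite I" by (rule fin)
    show "c \<in> I \<rightarrow> carrier N" using c fM bM by auto
    fix y assume "y \<in> carrier N"
    then obtain x where x: "x \<in> carrier M" "y = f x" using f(2) by (auto simp: bij_betw_def)
    have ex1: "\<exists>!d. d \<in> I \<rightarrow>\<^sub>E carrier R \<and> x = (\<Oplus>\<^bsub>M\<^esub>i\<in>I. d i \<odot>\<^bsub>M\<^esub> b i)"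
      using b x(1) by (simp add: basis_family_def)
    have iff: "x = (\<Oplus>\<^bsub>M\<^esub>i\<in>I. d i \<odot>\<^bsub>M\<^esub> b i) \<longleftrightarrow> y = (\<Oplus>\<^bsub>N\<^esub>i\<in>I. d i \<odot>\<^bsub>N\<^esub> c i)"
      if "d \<in> I \<rightarrow>\<^sub>E carrier R" for d
      using inj_on_eq_iff[OF inj x(1) sumM[OF that]] im[OF that] x(2) by simp
    show "\<exists>!d. d \<in> I \<rightarrow>\<^sub>E carrier R \<and> y = (\<Oplus>\<^bsub>N\<^esub>i\<in>I. d i \<odot>\<^bsub>N\<^esub> c i)"
      using ex1 iff by (simp cong: conj_cong)
  qed
qed

lemma basis_family_reindex:
  assumes M: "module R M" and b: "basis_family R M I b" and h: "bij_betw h I J"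
    and c: "\<And>i. i \<in> I \<Longrightarrow> c (h i) = b i"
  shows "basis_family R M J c"
proof -
  interpret free_basis R M I b by (intro free_basis.intro free_basis_axioms.intro M b)
  have inj: "inj_on h I" and img: "h ` I = J" using h by (auto simp: bij_betw_def)
  have cM: "c j \<in> carrier M" if "j \<in> J" for j
    using that c unfolding img[symmetric] by auto
  have sum: "(\<Oplus>\<^bsub>M\<^esub>j\<in>J. d j \<odot>\<^bsub>M\<^esub> c j) = (\<Oplus>\<^bsub>M\<^esub>i\<in>I. d (h i) \<odot>\<^bsub>M\<^esub> b i)"
    if "d \<in> J \<rightarrow> carrier R" for d
  proof -
    have "(\<Oplus>\<^bsub>M\<^esub>j\<in>h ` I. d j \<odot>\<^bsub>M\<^esub> c j) = (\<Oplus>\<^bsub>M\<^esub>i\<in>I. d (h i) \<odot>\<^bsub>M\<^esub> c (h i))"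
      by (rule M.finsum_reindex[OF _ inj]) (use that cM img in \<open>auto simp: Pi_def\<close>)
    also have "\<dots> = (\<Oplus>\<^bsub>M\<^esub>i\<in>I. d (h i) \<odot>\<^bsub>M\<^esub> b i)"
      by (rule M.finsum_cong') (use that img c in \<open>auto simp: Pi_def\<close>)
    finally show ?thesis unfolding img .
  qed
  show ?thesis
    unfolding basis_family_def
  proof (intro conjI ballI)
    show "finite J" unfolding img[symmetric] by simp
    show "c \<in> J \<rightarrow> carrier M" using cM by auto
    fix x assume x: "x \<in> carrier M"
    let ?d = "\<lambda>j\<in>J. coord x (inv_into I h j)"
    have dh: "?d (h i) = coord x i" if "i \<in> I" for i using that inj img by auto
    have d: "?d \<in> J \<rightarrow>\<^sub>E carrier R"
      using x unfolding img[symmetric] by (auto simp: inv_into_into)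
    show "\<exists>!d. d \<in> J \<rightarrow>\<^sub>E carrier R \<and> x = (\<Oplus>\<^bsub>M\<^esub>j\<in>J. d j \<odot>\<^bsub>M\<^esub> c j)"
    proof (rule ex1I[of _ ?d])
      have "(\<Oplus>\<^bsub>M\<^esub>i\<in>I. ?d (h i) \<odot>\<^bsub>M\<^esub> b i) = (\<Oplus>\<^bsub>M\<^esub>i\<in>I. coord x i \<odot>\<^bsub>M\<^esub> b i)"
        by (rule M.finsum_cong') (use dh x in auto)
      then have "x = (\<Oplus>\<^bsub>M\<^esub>i\<in>I. ?d (h i) \<odot>\<^bsub>M\<^esub> b i)"
        by (rule trans[OF coord_expand[OF x] sym])
      moreover have "?d \<in> J \<rightarrow> carrier R" using d unfolding PiE_def by (rule IntD1)
      ultimately show "?d \<in> J \<rightarrow>\<^sub>E carrier R \<and> x = (\<Oplus>\<^bsub>M\<^esub>j\<in>J. ?d j \<odot>\<^bsub>M\<^esub> c j)"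
        using d sum[of ?d] by metis
      fix d' assume d': "d' \<in> J \<rightarrow>\<^sub>E carrier R \<and> x = (\<Oplus>\<^bsub>M\<^esub>j\<in>J. d' j \<odot>\<^bsub>M\<^esub> c j)"
      then have "d' \<in> J \<rightarrow> carrier R" by auto
      then have x': "x = (\<Oplus>\<^bsub>M\<^esub>i\<in>I. d' (h i) \<odot>\<^bsub>M\<^esub> b i)" using sum d' by simp
      have "coord x i = d' (h i)" if "i \<in> I" for i
        by (rule coord_eqI[OF _ x' that]) (use d' img in \<open>auto simp: PiE_iff\<close>)
      then have "d' j = ?d j" if "j \<in> J" for j using that dh unfolding img[symmetric] by auto
      then show "d' = ?d" using d d' by (intro PiE_ext[of _ J "\<lambda>_. carrier R"]) auto
    qed
  qed
qed

text \<open>A permutation of the values of \<open>i\<close> becomes a permutation of the places of its word. The letters are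
  encoded as natural numbers only to have a linear order on them.\<close>

definition fibre_word :: "nat \<Rightarrow> (nat \<Rightarrow> nat) \<Rightarrow> nat \<Rightarrow> nat" where
  "fibre_word r i p = set_encode {k \<in> {1..r}. i k = p}"

text \<open>Each \<open>k\<close> lies in exactly one fibre of \<open>i\<close>, the one over
  \<open>i k\<close>, so the fibres determine \<open>i\<close>.\<close>

lemma fibre_word_inj: "inj_on (fibre_word r) (multi_indices n r)"
proof (rule inj_onI)
  fix i j assume ij: "i \<in> multi_indices n r" "j \<in> multi_indices n r" "fibre_word r i = fibre_word r j"
  have eq: "{k \<in> {1..r}. i k = p} = {k \<in> {1..r}. j k = p}" for p
    using fun_cong[OF ij(3), of p] by (auto simp: fibre_word_def set_encode_eq)
  show "i = j"
  proof (rule PiE_ext)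
    fix k assume "k \<in> {1..r}"
    then have "k \<in> {l \<in> {1..r}. j l = i k}" unfolding eq[symmetric] by simp
    then show "i k = j k" by simp
  qed (use ij(1,2) in \<open>auto simp: multi_indices_def\<close>)
qed

lemma fibre_word_compose:
  assumes "w permutes {1..n}"
  shows "fibre_word r (compose {1..r} w i) = fibre_word r i \<circ> inv_into UNIV w"
proof
  fix p
  have "w (i k) = p \<longleftrightarrow> i k = inv_into UNIV w p" for k using permutes_inv_eq[OF assms] by metis
  then have "{k \<in> {1..r}. compose {1..r} w i k = p} = {k \<in> {1..r}. i k = inv_into UNIV w p}"
    by (auto simp: compose_def)
  then show "fibre_word r (compose {1..r} w i) p = (fibre_word r i \<circ> inv_into UNIV w) p"
    by (simp add: fibre_word_def)
qed

lemma compose_multi_indices: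
  assumes "w permutes {1..n}" "i \<in> multi_indices n r"
  shows "compose {1..r} w i \<in> multi_indices n r"
proof -
  have "w (i k) \<in> {1..n}" if "k \<in> {1..r}" for k
    using assms that permutes_in_image[OF assms(1)] by (auto simp: multi_indices_def)
  then show ?thesis by (auto simp: multi_indices_def compose_def)
qed

text \<open>Stated for any module whose basis is indexed by multi-indices and permuted accordingly,
  so that it covers the tensor power and \<open>RI\<close> alike. The basis is reindexed by fibre
  words, on which the group acts through places.\<close>

theorem cellular_multi_indices:
  assumes M: "module R M" and b: "basis_family R M (multi_indices n r) b"
    and hom: "\<And>w. w \<in> carrier (sym_group n) \<Longrightarrow> \<phi> w \<in> module_hom R M M"
    and act: "\<And>w i. w \<in> carrier (sym_group n) \<Longrightarrow> i \<in> multi_indices n r \<Longrightarrow> \<phi> w (b i) = b (compose {1..r} w i)"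
  shows "cellular R (endo_algebra (sym_group n) R M \<phi>)"
proof -
  let ?I = "multi_indices n r" and ?w = "fibre_word r"
  interpret position_set "{1..n}" by unfold_locales simp
  have finI: "finite ?I" using b by (simp add: basis_family_def)
  \<comment> \<open>These contents make the fibre words exactly \<open>wset\<close>: a word with the
    content of a fibre word is a place permutation of it, hence the fibre word of another
    multi-index.\<close>
  define \<C> where "\<C> = content ` ?w ` ?I"
  interpret word_set "{1..n}" \<C> by unfold_locales (simp add: \<C>_def finI)
  have words: "?w i \<in> words" if "i \<in> ?I" for i
  proof -
    have "?w i p = 0" if "p \<notin> {1..n}" for p
    proof -
      have "{k \<in> {1..r}. i k = p} = {}"
        using \<open>i \<in> ?I\<close> that by (auto simp: multi_indices_def PiE_iff)
      then show ?thesis by (simp only: fibre_word_def set_encode_empty)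
    qed
    then show ?thesis by (simp add: words_def)
  qed
  have img: "?w ` ?I = wset"
  proof
    have "content (?w i) \<in> \<C>" if "i \<in> ?I" for i using that by (simp add: \<C>_def)
    then show "?w ` ?I \<subseteq> wset" using words by (auto simp: wset_def)
    show "wset \<subseteq> ?w ` ?I"
    proof
      fix x assume x: "x \<in> wset"
      then have "content x \<in> \<C>" by (simp add: wset_def)
      then obtain i where i: "i \<in> ?I" "content x = content (?w i)" by (auto simp: \<C>_def)
      obtain \<sigma> where \<sigma>: "\<sigma> permutes {1..n}" "x = ?w i \<circ> \<sigma>"
        using content_eqE[OF i(2) wset_words[OF x] words[OF i(1)]] by blast
      have "x = ?w (compose {1..r} (inv_into UNIV \<sigma>) i)"
        using fibre_word_compose[OF permutes_inv[OF \<sigma>(1)]] permutes_inv_inv[OF \<sigma>(1)] \<sigma>(2) by simp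
      then show "x \<in> ?w ` ?I" using compose_multi_indices[OF permutes_inv[OF \<sigma>(1)] i(1)] by blast
    qed
  qed
  have bij: "bij_betw ?w ?I wset" using img fibre_word_inj by (simp add: bij_betw_def)
  define c where "c x = b (inv_into ?I ?w x)" for x
  have c: "c (?w i) = b i" if "i \<in> ?I" for i
    using that fibre_word_inj by (simp add: c_def)
  have basis: "basis_family R M wset c" by (rule basis_family_reindex[OF M b bij]) (rule c)
  have move: "\<phi> v (c x) = c (x \<circ> inv_into UNIV v)" if v: "v permutes {1..n}" and x: "x \<in> wset" for v x
  proof -
    obtain i where i: "i \<in> ?I" "x = ?w i" using x img by blast
    have "\<phi> v (c x) = b (compose {1..r} v i)" using act[of v i] v i c by (simp add: sym_group_carrier)
    also have "\<dots> = c (?w (compose {1..r} v i))" using c compose_multi_indices[OF v i(1)] by simp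
    finally show ?thesis using fibre_word_compose[OF v, of r i] i(2) by simp
  qed
  have "free_basis R M wset c" by (intro free_basis.intro free_basis_axioms.intro M basis)
  moreover have "equivariant R M (sym_group n) \<phi>"
    by (intro equivariant.intro equivariant_axioms.intro M hom)
  moreover have "permutation_module_axioms {1..n} \<C> c (sym_group n) \<phi>"
  proof (rule permutation_module_axioms.intro)
    fix v assume v: "v \<in> carrier (sym_group n)"
    show "\<exists>\<sigma>. \<sigma> permutes {1..n} \<and> (\<forall>x\<in>wset. \<phi> v (c x) = c (x \<circ> \<sigma>))"
      using v move by (intro exI[of _ "inv_into UNIV v"]) (simp add: sym_group_carrier permutes_inv)
  next
    fix \<sigma> assume \<sigma>: "\<sigma> permutes {1..n}"
    show "\<exists>g\<in>carrier (sym_group n). \<forall>x\<in>wset. \<phi> g (c x) = c (x \<circ> \<sigma>)"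
      using move[OF permutes_inv[OF \<sigma>]] permutes_inv[OF \<sigma>] permutes_inv_inv[OF \<sigma>]
      by (intro bexI[of _ "inv_into UNIV \<sigma>"]) (simp_all add: sym_group_carrier)
  qed
  ultimately have "permutation_module {1..n} \<C> R M c (sym_group n) \<phi>"
    by (intro permutation_module.intro word_set_axioms)
  then show ?thesis by (rule permutation_module.cellular_End)
qed

section \<open>A basis of the tensor power indexed by multi-indices\<close>

locale tensor_basis = tensor_module R E r + free_basis R E "{1..n}" e
  for R (structure) and E (structure) and r n :: nat and e
begin

abbreviation "I \<equiv> multi_indices n r"
abbreviation "RI \<equiv> free_module R I"

definition tensor_vec :: "(nat \<Rightarrow> nat) \<Rightarrow> ((nat \<Rightarrow> 'c) \<Rightarrow> 'a) set" where
  "tensor_vec i = pure (compose {1..r} e i)"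

lemma finite_I: "finite I"
  unfolding multi_indices_def by (intro finite_PiE) auto

lemma module_RI: "module R RI"
  by (rule R.module_free_module)

lemma basis_RI: "free_basis R RI I (free_gen R I)"
  by (intro free_basis.intro free_basis_axioms.intro module_RI R.free_module_basis finite_I)

lemma basis_tuple: "i \<in> I \<Longrightarrow> compose {1..r} e i \<in> X"
  by (auto simp: multi_indices_def compose_def)

lemma tensor_vec_closed [simp, intro]: "i \<in> I \<Longrightarrow> tensor_vec i \<in> carrier T"
  unfolding tensor_vec_def by (intro pure_closed basis_tuple)

text \<open>The multilinear map that induces a left inverse of \<open>index_map\<close> on the
  tensor power.\<close>

definition coord_prod :: "(nat \<Rightarrow> 'c) \<Rightarrow> (nat \<Rightarrow> nat) \<Rightarrow> 'a" where
  "coord_prod v = (\<lambda>i\<in>I. finprod R (\<lambda>k. coord (v k) (i k)) {1..r})"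

lemma coord_mem: "v \<in> X \<Longrightarrow> i \<in> I \<Longrightarrow> k \<in> {1..r} \<Longrightarrow> coord (v k) (i k) \<in> carrier R"
  by (intro coord_closed) (auto simp: multi_indices_def)

lemma coord_prod_closed: "v \<in> X \<Longrightarrow> coord_prod v \<in> carrier RI"
  unfolding carrier_free_module
  using finite_I coord_mem by (auto simp: coord_prod_def intro!: R.finprod_closed)

text \<open>Isolates the one factor that depends on slot \<open>k\<close>, which reduces
  multilinearity to linearity of \<open>coord\<close>.\<close>

lemma coord_prod_upd:
  assumes v: "v \<in> X" and k: "k \<in> {1..r}" and a: "a \<in> carrier E" and i: "i \<in> I"
  shows "coord_prod (v(k := a)) i = coord a (i k) \<otimes> finprod R (\<lambda>l. coord (v l) (i l)) ({1..r} - {k})"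
proof -
  have ik: "i k \<in> {1..n}" using i k by (auto simp: multi_indices_def)
  have "finprod R (\<lambda>l. coord ((v(k := a)) l) (i l)) (insert k ({1..r} - {k}))
      = coord ((v(k := a)) k) (i k) \<otimes> finprod R (\<lambda>l. coord ((v(k := a)) l) (i l)) ({1..r} - {k})"
    by (rule R.finprod_insert) (use coord_mem[OF v i] a ik in auto)
  also have "finprod R (\<lambda>l. coord ((v(k := a)) l) (i l)) ({1..r} - {k})
      = finprod R (\<lambda>l. coord (v l) (i l)) ({1..r} - {k})"
    by (rule R.finprod_cong') (use coord_mem[OF v i] in auto)
  also have "insert k ({1..r} - {k}) = {1..r}" using k by auto
  finally show ?thesis using i by (simp add: coord_prod_def)
qed

lemma multilinear_coord_prod: "multilinear R E r RI coord_prod"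
  unfolding multilinear_def
proof (intro conjI ballI)
  show "coord_prod \<in> X \<rightarrow> carrier RI" using coord_prod_closed by auto
  fix v k assume v: "v \<in> X" and k: "k \<in> {1..r}"
  have ik: "i k \<in> {1..n}" if "i \<in> I" for i using that k by (auto simp: multi_indices_def)
  have rest: "finprod R (\<lambda>l. coord (v l) (i l)) ({1..r} - {k}) \<in> carrier R" if "i \<in> I" for i
    by (rule R.finprod_closed) (use coord_mem[OF v that] in auto)
  {
    fix a b assume ab: "a \<in> carrier E" "b \<in> carrier E"
    show "coord_prod (v(k := a \<oplus>\<^bsub>E\<^esub> b)) = coord_prod (v(k := a)) \<oplus>\<^bsub>RI\<^esub> coord_prod (v(k := b))"
    proof (rule R.free_module_eqI)
      fix i assume i: "i \<in> I"
      show "coord_prod (v(k := a \<oplus>\<^bsub>E\<^esub> b)) i = (coord_prod (v(k := a)) \<oplus>\<^bsub>RI\<^esub> coord_prod (v(k := b))) i"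
        using i ab ik[OF i] rest[OF i] v k
        by (simp add: free_module_simps coord_prod_upd coord_add R.l_distr)
    qed (use v k ab in \<open>auto intro!: coord_prod_closed R.free_module_add_closed tuples_upd\<close>)
  next
    fix c a assume ca: "c \<in> carrier R" "a \<in> carrier E"
    show "coord_prod (v(k := c \<odot>\<^bsub>E\<^esub> a)) = c \<odot>\<^bsub>RI\<^esub> coord_prod (v(k := a))"
    proof (rule R.free_module_eqI)
      fix i assume i: "i \<in> I"
      show "coord_prod (v(k := c \<odot>\<^bsub>E\<^esub> a)) i = (c \<odot>\<^bsub>RI\<^esub> coord_prod (v(k := a))) i"
        using i ca ik[OF i] rest[OF i] v k
        by (simp add: free_module_simps coord_prod_upd coord_smult R.m_assoc)
    qed (use v k ca in \<open>auto intro!: coord_prod_closed R.free_module_smult_closed tuples_upd\<close>)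
  }
qed

lemma coord_prod_basis:
  assumes i: "i \<in> I"
  shows "coord_prod (compose {1..r} e i) = free_gen R I i"
proof (rule R.free_module_eqI)
  fix j assume j: "j \<in> I"
  have ij: "i k \<in> {1..n}" "j k \<in> {1..n}" if "k \<in> {1..r}" for k
    using i j that by (auto simp: multi_indices_def)
  have fac: "coord (compose {1..r} e i k) (j k) = (if j k = i k then \<one> else \<zero>)" if "k \<in> {1..r}" for k
    using ij[OF that] that by (simp add: compose_def coord_basis)
  have "finprod R (\<lambda>k. coord (compose {1..r} e i k) (j k)) {1..r} = (if j = i then \<one> else \<zero>)"
  proof (cases "j = i")
    case True
    have "finprod R (\<lambda>k. coord (compose {1..r} e i k) (j k)) {1..r} = finprod R (\<lambda>k. \<one>) {1..r}"
      by (rule R.finprod_cong') (use fac True in auto)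
    then show ?thesis using True by simp
  next
    case False
    have "\<exists>k\<in>{1..r}. j k \<noteq> i k"
    proof (rule ccontr)
      assume "\<not> (\<exists>k\<in>{1..r}. j k \<noteq> i k)"
      then have "j = i" using i j unfolding multi_indices_def by (intro PiE_ext[OF j[unfolded multi_indices_def]]) auto
      then show False using False by simp
    qed
    then obtain k where k: "k \<in> {1..r}" "j k \<noteq> i k" by blast
    \<comment> \<open>Slot \<open>k\<close> is overwritten by its own value, so that
      \<open>coord_prod_upd\<close> splits off the factor at \<open>k\<close>, which is
      \<open>\<zero>\<close>.\<close>
    have "coord_prod ((compose {1..r} e i)(k := e (i k))) j = \<zero>"
      using coord_prod_upd[OF basis_tuple[OF i] k(1) _ j, of "e (i k)"] ij[OF k(1)] k(2)
        coord_mem[OF basis_tuple[OF i] j] R.finprod_closed[of "\<lambda>l. coord (compose {1..r} e i l) (j l)" "{1..r} - {k}"]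
      by (simp add: coord_basis Pi_def)
    moreover have "(compose {1..r} e i)(k := e (i k)) = compose {1..r} e i"
      using k(1) by (auto simp: compose_def)
    ultimately show ?thesis using False j by (simp add: coord_prod_def)
  qed
  then show "coord_prod (compose {1..r} e i) j = free_gen R I i j" using j by (simp add: coord_prod_def free_gen_def)
qed (use i in \<open>auto intro!: coord_prod_closed basis_tuple\<close>)

definition index_map :: "((nat \<Rightarrow> nat) \<Rightarrow> 'a) \<Rightarrow> ((nat \<Rightarrow> 'c) \<Rightarrow> 'a) set" where
  "index_map = free_basis.lin_ext R RI I (free_gen R I) T tensor_vec"

lemma index_map_hom: "index_map \<in> module_hom R RI T"
  unfolding index_map_def by (rule free_basis.lin_ext_hom[OF basis_RI module_T]) auto

lemma index_map_gen: "i \<in> I \<Longrightarrow> index_map (free_gen R I i) = tensor_vec i"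
  unfolding index_map_def by (rule free_basis.lin_ext_basis[OF basis_RI module_T]) auto

text \<open>\<open>coord_prod\<close> factors through the tensor power and sends each
  \<open>tensor_vec i\<close> back to its generator, so it provides a left inverse.\<close>

lemma index_map_inj: "inj_on index_map (carrier RI)"
proof -
  obtain h where h: "h \<in> module_hom R T RI" "\<And>v. v \<in> X \<Longrightarrow> h (pure v) = coord_prod v"
    using tensor_lift[OF module_RI multilinear_coord_prod] by blast
  have "h (index_map x) = x" if x: "x \<in> carrier RI" for x
  proof (rule free_basis.hom_eqI[OF basis_RI module_RI module_hom_comp[OF h(1) index_map_hom] _ _ x])
    show "(\<lambda>x. x) \<in> module_hom R RI RI" by (auto simp: module_hom_def)
    fix i assume i: "i \<in> I"
    show "h (index_map (free_gen R I i)) = free_gen R I i"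
      by (simp add: index_map_gen i tensor_vec_def h(2) basis_tuple coord_prod_basis)
  qed
  then show ?thesis by (rule inj_on_inverseI)
qed

text \<open>Induction on the number \<open>m\<close> of leading slots that may still hold arbitrary
  vectors; expanding slot \<open>m\<close> in the basis lowers it. Once all slots hold basis
  vectors, the tensor is the image of a generator.\<close>

lemma pure_in_index_map:
  assumes "x \<in> X" "m \<le> r" "\<And>k. k \<in> {1..r} \<Longrightarrow> m < k \<Longrightarrow> x k \<in> e ` {1..n}"
  shows "pure x \<in> index_map ` carrier RI"
  using assms
proof (induction m arbitrary: x)
  case 0
  then have "\<forall>k\<in>{1..r}. \<exists>j\<in>{1..n}. x k = e j" by fastforce
  then obtain i0 where i0: "\<And>k. k \<in> {1..r} \<Longrightarrow> i0 k \<in> {1..n} \<and> x k = e (i0 k)" by metis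
  define i where "i = restrict i0 {1..r}"
  have i: "i \<in> I" using i0 by (auto simp: i_def multi_indices_def)
  have "compose {1..r} e i = x"
    by (rule PiE_ext[OF basis_tuple[OF i] 0(1)]) (use i0 in \<open>simp add: compose_def i_def\<close>)
  then have "pure x = index_map (free_gen R I i)" using i by (simp add: index_map_gen tensor_vec_def)
  then show ?case using R.free_gen_closed[OF i] by blast
next
  case (Suc m)
  interpret T: module R T by (rule module_T)
  let ?k = "Suc m"
  have k: "?k \<in> {1..r}" using Suc.prems(2) by auto
  have xk: "x ?k \<in> carrier E" using Suc.prems(1) k by auto
  have "(\<lambda>a. pure (x(?k := a))) \<in> module_hom R E T"
    using multilinear_pure Suc.prems(1) k tuples_upd[OF Suc.prems(1) k]
    unfolding module_hom_def multilinear_def by auto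
  from hom_expand[OF module_T this xk]
  have expand: "pure x = (\<Oplus>\<^bsub>T\<^esub>j\<in>{1..n}. coord (x ?k) j \<odot>\<^bsub>T\<^esub> pure (x(?k := e j)))" by simp
  have "pure (x(?k := e j)) \<in> index_map ` carrier RI" if j: "j \<in> {1..n}" for j
  proof (rule Suc.IH)
    show "x(?k := e j) \<in> X" by (rule tuples_upd[OF Suc.prems(1) k]) (use j in auto)
    show "m \<le> r" using Suc.prems(2) by simp
    fix l assume "l \<in> {1..r}" "m < l"
    then show "(x(?k := e j)) l \<in> e ` {1..n}" using Suc.prems(3)[of l] j by auto
  qed
  then have ex: "\<exists>u. u \<in> carrier RI \<and> pure (x(?k := e j)) = index_map u" if "j \<in> {1..n}" for j
    using that by blast
  define y where "y j = (SOME u. u \<in> carrier RI \<and> pure (x(?k := e j)) = index_map u)" for j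
  have y: "y j \<in> carrier RI \<and> pure (x(?k := e j)) = index_map (y j)" if "j \<in> {1..n}" for j
    using someI_ex[OF ex[OF that]] unfolding y_def .
  interpret RI: module R RI by (rule module_RI)
  have cl: "coord (x ?k) j \<odot>\<^bsub>RI\<^esub> y j \<in> carrier RI" if "j \<in> {1..n}" for j
    using y[OF that] that xk by auto
  have "index_map (\<Oplus>\<^bsub>RI\<^esub>j\<in>{1..n}. coord (x ?k) j \<odot>\<^bsub>RI\<^esub> y j)
      = (\<Oplus>\<^bsub>T\<^esub>j\<in>{1..n}. index_map (coord (x ?k) j \<odot>\<^bsub>RI\<^esub> y j))"
    by (rule RI.module_hom_finsum[OF module_T index_map_hom]) (use cl in auto)
  also have "\<dots> = pure x"
    unfolding expand
  proof (rule T.M.finsum_cong')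
    fix j assume j: "j \<in> {1..n}"
    show "index_map (coord (x ?k) j \<odot>\<^bsub>RI\<^esub> y j) = coord (x ?k) j \<odot>\<^bsub>T\<^esub> pure (x(?k := e j))"
      using y[OF j] xk j by (simp add: module_hom_smult[OF index_map_hom])
  qed (use xk tuples_upd[OF Suc.prems(1) k] in auto)
  finally have "pure x = index_map (\<Oplus>\<^bsub>RI\<^esub>j\<in>{1..n}. coord (x ?k) j \<odot>\<^bsub>RI\<^esub> y j)" by simp
  moreover have "(\<Oplus>\<^bsub>RI\<^esub>j\<in>{1..n}. coord (x ?k) j \<odot>\<^bsub>RI\<^esub> y j) \<in> carrier RI"
    by (rule RI.M.finsum_closed) (use cl in auto)
  ultimately show ?case by blast
qed

text \<open>Preimages \<open>m x\<close> of the pure tensors are extended linearly to the free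
  module on tuples. The composite with \<open>index_map\<close> agrees with the quotient map on
  generators, hence everywhere, and the quotient map is onto.\<close>

lemma index_map_surj: "index_map ` carrier RI = carrier T"
proof
  show "index_map ` carrier RI \<subseteq> carrier T" using module_hom_closed[OF index_map_hom] by auto
  interpret RI: module R RI by (rule module_RI)
  have ex: "\<exists>y. y \<in> carrier RI \<and> index_map y = pure x" if "x \<in> X" for x
    using pure_in_index_map[OF that order_refl] by force
  define m where "m x = (SOME y. y \<in> carrier RI \<and> index_map y = pure x)" for x
  have m: "m x \<in> carrier RI" "index_map (m x) = pure x" if "x \<in> X" for x
    using someI_ex[OF ex[OF that]] unfolding m_def by auto
  show "carrier T \<subseteq> index_map ` carrier RI"
  proof
    fix t assume "t \<in> carrier T"
    then obtain v where v: "v \<in> carrier F" "t = Qt.quot v" by (auto simp: Qt.carrier_Q)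
    have mX: "m \<in> X \<rightarrow> carrier RI" using m by auto
    note lift = RI.free_lift_hom[OF mX]
    have "(\<lambda>v. index_map (free_lift R RI X m v)) v = Qt.quot v"
      by (rule module.free_module_hom_eqI[OF module_T module_hom_comp[OF index_map_hom lift] Qt.quot_hom _ v(1)])
        (simp add: RI.free_lift_gen[OF mX] m pure_quot)
    moreover have "free_lift R RI X m v \<in> carrier RI" using module_hom_closed[OF lift] v(1) by auto
    ultimately show "t \<in> index_map ` carrier RI" using v(2) by force
  qed
qed

lemma index_map_bij: "bij_betw index_map (carrier RI) (carrier T)"
  using index_map_inj index_map_surj by (simp add: bij_betw_def)

lemma basis_T: "basis_family R T I tensor_vec"
  by (rule basis_family_iso[OF module_RI module_T R.free_module_basis[OF finite_I] index_map_hom index_map_bij])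
    (simp add: index_map_gen)

end

section \<open>The action on \<open>RI\<close> and the conclusion\<close>

lemma (in cring) index_action_hom:
  assumes w: "w \<in> carrier (sym_group n)"
  shows "index_action R n r w \<in> module_hom R (free_module R (multi_indices n r)) (free_module R (multi_indices n r))"
proof -
  let ?I = "multi_indices n r"
  have w': "inv\<^bsub>sym_group n\<^esub> w permutes {1..n}"
    using group.inv_closed[OF sym_group_is_group w] by (simp add: sym_group_carrier)
  note cI = compose_multi_indices[OF w']
  have fin: "finite ?I" unfolding multi_indices_def by (intro finite_PiE) auto
  have cl: "(\<lambda>i\<in>?I. f (compose {1..r} (inv\<^bsub>sym_group n\<^esub> w) i)) \<in> carrier (free_module R ?I)"
    if "f \<in> carrier (free_module R ?I)" for f
    using that fin cI by (auto simp: carrier_free_module)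
  show ?thesis
    unfolding module_hom_def mem_Collect_eq
  proof (intro conjI allI impI funcsetI)
    fix f assume "f \<in> carrier (free_module R ?I)"
    then show "index_action R n r w f \<in> carrier (free_module R ?I)" using cl by (simp add: index_action_def)
  next
    fix f g assume "f \<in> carrier (free_module R ?I) \<and> g \<in> carrier (free_module R ?I)"
    then show "index_action R n r w (f \<oplus>\<^bsub>free_module R ?I\<^esub> g)
        = index_action R n r w f \<oplus>\<^bsub>free_module R ?I\<^esub> index_action R n r w g"
      using free_module_add_closed[of f ?I g] cI
      by (auto simp: index_action_def) (auto simp: free_module_simps intro!: restrict_ext)
  next
    fix c f assume "c \<in> carrier R \<and> f \<in> carrier (free_module R ?I)"
    then show "index_action R n r w (c \<odot>\<^bsub>free_module R ?I\<^esub> f) = c \<odot>\<^bsub>free_module R ?I\<^esub> index_action R n r w f"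
      using free_module_smult_closed[of c f ?I] cI
      by (auto simp: index_action_def) (auto simp: free_module_simps intro!: restrict_ext)
  qed
qed

lemma (in cring) index_action_gen:
  assumes w: "w \<in> carrier (sym_group n)" and i: "i \<in> multi_indices n r"
  shows "index_action R n r w (free_gen R (multi_indices n r) i)
    = free_gen R (multi_indices n r) (compose {1..r} w i)"
proof -
  let ?I = "multi_indices n r" and ?w' = "inv\<^bsub>sym_group n\<^esub> w"
  note grp = sym_group_is_group[of n]
  have w': "?w' permutes {1..n}"
    using group.inv_closed[OF grp w] by (simp add: sym_group_carrier)
  have wp: "w permutes {1..n}" using w by (simp add: sym_group_carrier)
  have ww': "w (?w' p) = p" and w'w: "?w' (w p) = p" for p
    using group.r_inv[OF grp w] group.l_inv[OF grp w]
    by (simp_all add: sym_group_mult sym_group_one fun_eq_iff)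
  have eq: "compose {1..r} ?w' j = i \<longleftrightarrow> j = compose {1..r} w i" if j: "j \<in> ?I" for j
  proof
    assume "compose {1..r} ?w' j = i"
    then have "compose {1..r} w i = compose {1..r} w (compose {1..r} ?w' j)" by simp
    also have "\<dots> = j"
      by (rule extensionalityI[of _ "{1..r}"]) (use j ww' in \<open>auto simp: multi_indices_def compose_def PiE_def\<close>)
    finally show "j = compose {1..r} w i" by simp
  next
    assume "j = compose {1..r} w i"
    then show "compose {1..r} ?w' j = i"
      by (intro extensionalityI[of _ "{1..r}"]) (use i w'w in \<open>auto simp: multi_indices_def compose_def PiE_def\<close>)
  qed
  show ?thesis
    using free_gen_closed[OF i] compose_multi_indices[OF w'] eq
    by (auto simp: index_action_def) (auto simp: free_gen_def intro!: restrict_ext)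
qed

theorem proposition7p2:
  fixes R :: "('a, 'm) ring_scheme"
    and E :: "('a, 'b, 'k) module_scheme"
    and n r :: nat
    and e :: "nat \<Rightarrow> 'b"
    and \<rho> :: "(nat \<Rightarrow> nat) \<Rightarrow> 'b \<Rightarrow> 'b"
  assumes "cring R"
    and "n \<ge> 1"
    and "r \<ge> 1"
    and "group_module (sym_group n) R E \<rho>"
    and "basis_family R E {1..n} e"
    and "\<And>w j. w \<in> carrier (sym_group n) \<Longrightarrow> j \<in> {1..n} \<Longrightarrow> \<rho> w (e j) = e (w j)"
  shows "let RI = free_module R (multi_indices n r);
             T = tensor_power R E r;
             diag = (\<lambda>w. tensor_map R E r (\<rho> w))
         in
           (\<exists>\<phi>\<in>module_hom R RI T.
              bij_betw \<phi> (carrier RI) (carrier T) \<and>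
              (\<forall>i\<in>multi_indices n r.
                 \<phi> (free_gen R (multi_indices n r) i) = pure_tensor R E r (compose {1..r} e i)) \<and>
              (\<forall>w\<in>carrier (sym_group n). \<forall>x\<in>carrier RI.
                 \<phi> (index_action R n r w x) = diag w (\<phi> x))) \<and>
           cellular R (endo_algebra (sym_group n) R T diag) \<and>
           cellular R (endo_algebra (sym_group n) R RI (index_action R n r))"
proof -
  have \<rho>: "\<rho> w \<in> module_hom R E E" if "w \<in> carrier (sym_group n)" for w
    using assms(4) that by (auto simp: group_module_def)
  have modE: "module R E" using assms(4) by (simp add: group_module_def)
  interpret cring R by (rule assms(1))
  interpret tb: tensor_basis R E r n e
    by (intro tensor_basis.intro tensor_module.intro free_basis.intro free_basis_axioms.intro modE assms(5))
  let ?I = "multi_indices n r" and ?RI = "free_module R (multi_indices n r)" and ?T = "tensor_power R E r"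
  let ?diag = "\<lambda>w. tensor_map R E r (\<rho> w)"
  have diag_hom: "?diag w \<in> module_hom R ?T ?T" if "w \<in> carrier (sym_group n)" for w
    by (rule tb.tensor_map(1)[OF \<rho>[OF that]])
  have diag_vec: "?diag w (tb.tensor_vec i) = tb.tensor_vec (compose {1..r} w i)"
    if w: "w \<in> carrier (sym_group n)" and i: "i \<in> ?I" for w i
  proof -
    have "i k \<in> {1..n}" if "k \<in> {1..r}" for k using i that by (auto simp: multi_indices_def)
    then have "compose {1..r} (\<rho> w) (compose {1..r} e i) = compose {1..r} e (compose {1..r} w i)"
      unfolding compose_def by (intro restrict_ext) (simp add: assms(6)[OF w])
    then show ?thesis
      unfolding tb.tensor_vec_def using tb.tensor_map(2)[OF \<rho>[OF w] tb.basis_tuple[OF i]] by simp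
  qed
  have "cellular R (endo_algebra (sym_group n) R ?T ?diag)"
    by (rule cellular_multi_indices[OF tb.module_T tb.basis_T diag_hom diag_vec])
  moreover have "cellular R (endo_algebra (sym_group n) R ?RI (index_action R n r))"
    by (rule cellular_multi_indices[OF module_free_module free_module_basis[OF tb.finite_I]
          index_action_hom index_action_gen])
  \<comment> \<open>Both sides are linear in \<open>x\<close>, so equivariance is checked on
    generators, where both actions replace \<open>i\<close> by \<open>w \<circ> i\<close>.\<close>
  moreover have "tb.index_map (index_action R n r w x) = ?diag w (tb.index_map x)"
    if w: "w \<in> carrier (sym_group n)" and x: "x \<in> carrier ?RI" for w x
  proof (rule free_basis.hom_eqI[OF tb.basis_RI tb.module_T
        module_hom_comp[OF tb.index_map_hom index_action_hom[OF w]]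
        module_hom_comp[OF diag_hom[OF w] tb.index_map_hom] _ x])
    fix i assume i: "i \<in> ?I"
    have "compose {1..r} w i \<in> ?I" by (rule compose_multi_indices) (use w i in \<open>simp_all add: sym_group_carrier\<close>)
    then show "tb.index_map (index_action R n r w (free_gen R ?I i)) = ?diag w (tb.index_map (free_gen R ?I i))"
      using i w by (simp add: index_action_gen tb.index_map_gen diag_vec)
  qed
  ultimately show ?thesis
    unfolding Let_def using tb.index_map_hom tb.index_map_bij tb.index_map_gen
    by (intro conjI bexI[of _ tb.index_map] ballI) (simp_all add: tb.tensor_vec_def)
qed

end
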